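(* Let $d\ge1$ and let $k(x,x')$ be a (continuous positive definite) dot-product kernel on $\mathbb{S}^d$ with spherical-harmonic eigenvalues $(\mu_n)_{n\ge0}$, i.e. $k(x,x')=\sum_{n\ge0}\mu_n\sum_{l=1}^{a_n}Y_{n,l}(x)Y_{n,l}(x')$. Assume there is a sequence $(\tilde\mu_n)_{n\ge0}$ satisfying Condition (EDR) below such that $\mu_n\asymp\tilde\mu_n$. Then for every bounded, non-zero, Riemann-integrable function $\rho$ on $\mathbb{S}^d$, $$\lambda_i(k;\mathbb{S}^d,\rho^2\,d\sigma)\asymp\lambda_i(k;\mathbb{S}^d,d\sigma).$$
   Context: $\mathbb{S}^d\subset\mathbb{R}^{d+1}$ is the unit sphere and $\sigma$ its surface (Lebesgue) measure. A dot-product kernel is one of the form $k(x,x')=f(\langle x,x'\rangle)$. $\{Y_{n,l}:n\ge0,\,1\le l\le a_n\}$ is an orthonormal basis of $L^2(\mathbb{S}^d)$ (with inner product $\frac{1}{\omega_d}\int fg\,d\sigma$, $\omega_d=\sigma(\mathbb{S}^d)$) where $Y_{n,l}$ are spherical harmonics of degree $n$ and $a_n=\binom{n+d}{n}-\binom{n-2+d}{n-2}$; every dot-product kernel has such an expansion. $\lambda_i(k;\mathbb{S}^d,d\nu)$ is the $i$-th largest eigenvalue (with multiplicity) of $(Tf)(x)=\int k(x,x')f(x')\,d\nu(x')$ on $L^2(\mathbb{S}^d,d\nu)$. Forward difference: $(\triangle a)_n=a_n-a_{n+1}$, $\triangle^{p+1}=\triangle(\triangle^p)$, $\triangle^0=\mathrm{id}$.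 Condition (EDR) for a decreasing sequence $(\mu_n)_{n\ge0}$ of positive numbers: (a) with $N(\varepsilon)=\max\{n:\mu_n>\varepsilon\}$, for every fixed $c>0$, $N(c\varepsilon)=\Theta(N(\varepsilon))$ as $\varepsilon\to0$, and if $\varepsilon,\delta\to0$ with $\varepsilon=o(\delta)$ then $N(\delta)=o(N(\varepsilon))$; (b) $\triangle^{d+1}\mu_n\ge0$ for all $n$; (c) there exist $q\in\mathbb{N}_+$ and $D>0$ such that for all $n\ge0$, with $\tilde n=qn$, $\sum_{l=0}^{d}\binom{\tilde n+l}{l}\triangle^l\mu_{\tilde n}\le D\mu_n$. $a\asymp b$ means bounded above and below by constant multiples.
   Formalization: "Non-zero" is taken to mean that ρ is not zero σ-almost everywhere; if ρ vanishes almost everywhere (e.g. the indicator of one point), then ρ²dσ = 0, all its eigenvalues are 0 and the claim fails. *)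

theory Defs
  imports "HOL-Analysis.Analysis" "HOL-Library.Landau_Symbols"
begin

text \<open>Unit sphere of R^(d+1) is sphere 0 1 in real^'n with CARD('n) = d+1.
  Surface measure: completion of the push-forward of CARD('n) times Lebesgue measure on the
  punctured unit ball under radial projection (cone construction).\<close>

definition sphere_measure :: "(real^'n) measure" where
  "sphere_measure = completion
     (distr (density (restrict_space lborel (ball 0 1 - {0})) (\<lambda>_. ennreal (real CARD('n))))
            (restrict_space borel (sphere 0 1)) (\<lambda>x. x /\<^sub>R norm x))"

definition homogeneous_poly :: "nat \<Rightarrow> (real^'n \<Rightarrow> real) \<Rightarrow> bool" where
  "homogeneous_poly n p \<longleftrightarrow> polynomial_function p \<and> (\<forall>t x. p (t *\<^sub>R x) = t ^ n * p x)"

definition laplacian :: "(real^'n \<Rightarrow> real) \<Rightarrow> real^'n \<Rightarrow> real" where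
  "laplacian p x = (\<Sum>i\<in>UNIV. deriv (deriv (\<lambda>t. p (x + t *\<^sub>R axis i 1))) 0)"

definition harmonic :: "(real^'n \<Rightarrow> real) \<Rightarrow> bool" where
  "harmonic p \<longleftrightarrow> (\<forall>x. laplacian p x = 0)"

definition spherical_harmonic :: "nat \<Rightarrow> (real^'n \<Rightarrow> real) \<Rightarrow> bool" where
  "spherical_harmonic n Y \<longleftrightarrow>
     (\<exists>p. homogeneous_poly n p \<and> harmonic p \<and> (\<forall>x\<in>sphere 0 1. Y x = p x))"

text \<open>i-th largest eigenvalue (with multiplicity, i \<ge> 1) of the integral operator
  (T g)(x) = \<integral> K x y g y dM(y) on L^2(M): the supremum of all m > 0 such that there are i
  orthonormal eigenfunctions with eigenvalues \<ge> m (0 if there is no such m).\<close>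
definition kernel_eigenvalue :: "('a \<Rightarrow> 'a \<Rightarrow> real) \<Rightarrow> 'a measure \<Rightarrow> nat \<Rightarrow> real" where
  "kernel_eigenvalue K M i = Sup (insert 0 {m. m > 0 \<and>
     (\<exists>fs :: nat \<Rightarrow> 'a \<Rightarrow> real.
        (\<forall>j<i. fs j \<in> borel_measurable M \<and> integrable M (\<lambda>x. (fs j x)\<^sup>2)) \<and>
        (\<forall>j<i. \<forall>j'<i. (LINT x|M. fs j x * fs j' x) = (if j = j' then 1 else 0)) \<and>
        (\<forall>j<i. \<exists>l\<ge>m. AE x in M. (LINT y|M. K x y * fs j y) = l * fs j x))})"

definition fdiff :: "(nat \<Rightarrow> real) \<Rightarrow> nat \<Rightarrow> real" where
  "fdiff a n = a n - a (Suc n)"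

definition edr_N :: "(nat \<Rightarrow> real) \<Rightarrow> real \<Rightarrow> nat" where
  "edr_N \<mu> \<epsilon> = Max {n. \<mu> n > \<epsilon>}"

definition EDR :: "nat \<Rightarrow> (nat \<Rightarrow> real) \<Rightarrow> bool" where
  "EDR d \<mu> \<longleftrightarrow> (\<forall>n. \<mu> n > 0) \<and> decseq \<mu> \<and>
     (\<forall>c>0. (\<lambda>\<epsilon>. real (edr_N \<mu> (c * \<epsilon>))) \<in> \<Theta>[at_right 0](\<lambda>\<epsilon>. real (edr_N \<mu> \<epsilon>))) \<and>
     (\<forall>e \<delta> :: nat \<Rightarrow> real. (\<forall>k. e k > 0 \<and> \<delta> k > 0) \<longrightarrow> e \<longlonglongrightarrow> 0 \<longrightarrow> \<delta> \<longlonglongrightarrow> 0 \<longrightarrow>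
        e \<in> o(\<delta>) \<longrightarrow> (\<lambda>k. real (edr_N \<mu> (\<delta> k))) \<in> o(\<lambda>k. real (edr_N \<mu> (e k)))) \<and>
     (\<forall>n. ((fdiff ^^ (d + 1)) \<mu>) n \<ge> 0) \<and>
     (\<exists>q::nat. q \<ge> 1 \<and> (\<exists>D>0. \<forall>n.
        (\<Sum>l\<le>d. real ((q * n + l) choose l) * ((fdiff ^^ l) \<mu>) (q * n)) \<le> D * \<mu> n))"

text \<open>Riemann integrability on the sphere (Lebesgue criterion): bounded and continuous
  (relative to the sphere) outside a surface-null set.\<close>
definition riemann_integrable_sphere :: "(real^'n \<Rightarrow> real) \<Rightarrow> bool" where
  "riemann_integrable_sphere \<rho> \<longleftrightarrow> bounded (\<rho> ` sphere 0 1) \<and>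
     {x\<in>sphere 0 1. \<not> continuous (at x within sphere 0 1) \<rho>} \<in> null_sets sphere_measure"

end

theory Submission
  imports Defs "HOL-Complex_Analysis.Great_Picard"
begin

text \<open>
  An eigenvalue bound from below only needs a space of test functions: if the span of \<open>i\<close> functions has
  Rayleigh quotients at least \<open>t\<close>, there are \<open>i\<close> eigenfunctions with eigenvalue at least \<open>t\<close>. For a
  continuous kernel these are obtained by maximizing the quotient, with Arzela-Ascoli providing the limit.

  Multiplying the eigenfunctions for \<open>\<rho>\<^sup>2 d\<sigma>\<close> by \<open>\<rho>\<^sup>2\<close> gives test functions for \<open>d\<sigma>\<close>, hence the upper bound.
  For the lower bound, \<open>\<rho>\<^sup>2 \<ge> c\<close> on some ball, and finitely many, say \<open>m\<close>, rotations of it cover the sphere. As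
  the kernel is rotation invariant, among \<open>m i\<close> eigenfunctions for \<open>d\<sigma>\<close> with eigenvalue at least \<open>t\<close> there is a
  combination some rotation of which is a test function for \<open>\<rho>\<^sup>2 d\<sigma>\<close>; this bounds the \<open>i\<close>-th eigenvalue for
  \<open>\<rho>\<^sup>2 d\<sigma>\<close> by the \<open>(m i)\<close>-th one for \<open>d\<sigma>\<close>. Finally the \<open>(m i)\<close>-th and \<open>i\<close>-th eigenvalues for \<open>d\<sigma>\<close> are
  comparable: the number of harmonics of degree less than \<open>n\<close> has order \<open>n\<^sup>d\<close>, and part (a) of Condition (EDR)
  makes \<open>\<mu>\<close> comparable at \<open>n\<close> and \<open>2 n\<close>.
\<close>

section \<open>Square integrable functions\<close>

text \<open>The weight may vanish on a set of positive measure, so nothing can be divided by it; the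
  only lower bound available is \<open>\<rho>\<^sup>2 \<ge> c\<close> near one continuity point. A
  function in the span of the eigenfunctions for \<sigma> need not carry mass there. Some rotation
  of it does, but which one depends on the function. Orthogonality to the \<open>p\<close> functions
  already found is therefore imposed on all \<open>m\<close> rotations at once. These
  \<open>m p\<close> linear conditions are the reason for starting from \<open>m i\<close>
  eigenfunctions, and paying back the factor \<open>m\<close> in the index is where the rate of
  decay of \<mu> enters.

  Completeness of the harmonics and positivity of the operator are derived from the action of the
  kernel on harmonics: polynomials restricted to the sphere are sums of harmonics, and
  Stone-Weierstrass extends this to continuous functions. Eigenvalues are never enumerated:
  \<open>kernel_eigenvalue\<close> is a supremum of levels \<open>t\<close> at which
  \<open>i\<close> orthonormal eigenfunctions exist, so a comparison of eigenvalues amounts to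
  turning a system at level \<open>t\<close> into one at level \<open>c t\<close>.\<close>

lemma discriminant_le:
  fixes a b c :: real
  assumes pos: "\<And>s t. 0 \<le> a * s\<^sup>2 + 2 * b * s * t + c * t\<^sup>2"
  shows "b\<^sup>2 \<le> a * c"
proof -
  have a: "0 \<le> a" and c: "0 \<le> c"
    using pos[of 1 0] pos[of 0 1] by auto
  \<comment> \<open>The vectors \<open>(c, -b)\<close> and \<open>(b, -a)\<close> minimize the form
    for fixed first or second coefficient, up to scaling; they fail only for
    \<open>a = c = 0\<close>, which \<open>(1, 1)\<close> and \<open>(1, -1)\<close> settle.\<close>
  have 1: "0 \<le> c * (a * c - b\<^sup>2)" and 2: "0 \<le> a * (a * c - b\<^sup>2)"
    using pos[of c "-b"] pos[of b "-a"] by (auto simp: power2_eq_square algebra_simps)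
  show ?thesis
  proof (cases "a = 0 \<and> c = 0")
    case True
    then show ?thesis using pos[of 1 1] pos[of 1 "-1"] by auto
  next
    case False
    then have "a > 0 \<or> c > 0" using a c by auto
    then show ?thesis using 1 2 by (auto simp: zero_le_mult_iff)
  qed
qed

text \<open>Gaussian elimination, one row at a time. Every test function below is obtained from it:
  a non-trivial combination of \<open>card C\<close> functions that is orthogonal to fewer than
  \<open>card C\<close> given ones.\<close>

lemma underdetermined_system:
  fixes A :: "'r \<Rightarrow> 'c \<Rightarrow> real"
  assumes "finite R" "finite C" "card R < card C"
  shows "\<exists>c. (\<exists>k\<in>C. c k \<noteq> 0) \<and> (\<forall>r\<in>R. (\<Sum>k\<in>C. A r k * c k) = 0)"
  using assms
proof (induction R arbitrary: C A rule: finite_induct)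
  case empty
  then have "C \<noteq> {}" by auto
  then show ?case by (intro exI[of _ "\<lambda>_. 1"]) auto
next
  case (insert r R)
  show ?case
  proof (cases "\<forall>k\<in>C. A r k = 0")
    case True
    obtain c where "\<exists>k\<in>C. c k \<noteq> 0" "\<forall>r\<in>R. (\<Sum>k\<in>C. A r k * c k) = 0"
      using insert.IH[of C A] insert.prems insert.hyps by auto
    then show ?thesis using True by (intro exI[of _ c]) auto
  next
    case False
    then obtain k0 where k0: "k0 \<in> C" "A r k0 \<noteq> 0" by auto
    define C' where "C' = C - {k0}"
    \<comment> \<open>Row \<open>r\<close> eliminates column \<open>k0\<close> from the other rows;
      the coefficient \<open>z\<close> of column \<open>k0\<close> is recovered by back
      substitution.\<close>
    define A' where "A' s k = A s k - A s k0 * A r k / A r k0" for s k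
    have "finite C'" "card R < card C'"
      using insert.prems insert.hyps k0 by (auto simp: C'_def)
    then obtain c' where c': "\<exists>k\<in>C'. c' k \<noteq> 0" "\<forall>s\<in>R. (\<Sum>k\<in>C'. A' s k * c' k) = 0"
      using insert.IH[of C' A'] by auto
    define z where "z = - (\<Sum>k\<in>C'. A r k * c' k) / A r k0"
    define c where "c = c'(k0 := z)"
    have sum_c: "(\<Sum>k\<in>C. A s k * c k) = A s k0 * z + (\<Sum>k\<in>C'. A s k * c' k)" for s
    proof -
      have "(\<Sum>k\<in>C. A s k * c k) = A s k0 * c k0 + (\<Sum>k\<in>C'. A s k * c k)"
        unfolding C'_def using insert.prems k0 by (simp add: sum.remove)
      also have "(\<Sum>k\<in>C'. A s k * c k) = (\<Sum>k\<in>C'. A s k * c' k)"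
        by (intro sum.cong) (auto simp: c_def C'_def)
      finally show ?thesis by (simp add: c_def)
    qed
    have "(\<Sum>k\<in>C. A r k * c k) = 0"
      using k0 by (simp add: sum_c z_def)
    moreover have "(\<Sum>k\<in>C. A s k * c k) = 0" if "s \<in> R" for s
    proof -
      have "0 = (\<Sum>k\<in>C'. A s k * c' k) - (\<Sum>k\<in>C'. A s k0 * A r k / A r k0 * c' k)"
        using c'(2) \<open>s \<in> R\<close> by (simp add: A'_def left_diff_distrib sum_subtractf)
      also have "(\<Sum>k\<in>C'. A s k0 * A r k / A r k0 * c' k) = - A s k0 * z"
        using k0 by (simp add: z_def sum_distrib_left sum_divide_distrib sum_negf mult_ac)
      finally show ?thesis by (simp add: sum_c)
    qed
    moreover have "\<exists>k\<in>C. c k \<noteq> 0"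
      using c'(1) by (auto simp: C'_def c_def)
    ultimately show ?thesis by (intro exI[of _ c]) auto
  qed
qed

text \<open>Functions, not classes modulo null sets: \<open>ip\<close> is only a semi-inner product,
  so \<open>ip M h h > 0\<close> appears as a separate condition on test functions.\<close>

definition L2 :: "'a measure \<Rightarrow> ('a \<Rightarrow> real) set" where
  "L2 M = {u \<in> borel_measurable M. integrable M (\<lambda>x. (u x)\<^sup>2)}"

definition ip :: "'a measure \<Rightarrow> ('a \<Rightarrow> real) \<Rightarrow> ('a \<Rightarrow> real) \<Rightarrow> real" where
  "ip M u v = (LINT x|M. u x * v x)"

lemma L2_measurable: "u \<in> L2 M \<Longrightarrow> u \<in> borel_measurable M"
  by (simp add: L2_def)

lemma L2_integrable_mult:
  assumes "u \<in> L2 M" "v \<in> L2 M"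
  shows "integrable M (\<lambda>x. u x * v x)"
proof (rule Bochner_Integration.integrable_bound)
  show "integrable M (\<lambda>x. (u x)\<^sup>2 + (v x)\<^sup>2)"
    using assms by (simp add: L2_def)
  have "\<bar>a * b\<bar> \<le> a\<^sup>2 + b\<^sup>2" for a b :: real
    using sum_squares_bound[of "\<bar>a\<bar>" "\<bar>b\<bar>"] abs_ge_zero[of "a * b"]
    unfolding abs_mult power2_abs by linarith
  then show "AE x in M. norm (u x * v x) \<le> norm ((u x)\<^sup>2 + (v x)\<^sup>2)"
    by auto
qed (use assms in \<open>auto simp: L2_def\<close>)

lemma L2_comb:
  assumes "u \<in> L2 M" "v \<in> L2 M"
  shows "(\<lambda>x. a * u x + b * v x) \<in> L2 M"
proof -
  have "integrable M (\<lambda>x. a\<^sup>2 * (u x * u x) + 2 * a * b * (u x * v x) + b\<^sup>2 * (v x * v x))"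
    using assms by (intro Bochner_Integration.integrable_add integrable_mult_right L2_integrable_mult) auto
  then show ?thesis
    using assms by (auto simp: L2_def power2_eq_square algebra_simps)
qed

lemma L2_cmult: "u \<in> L2 M \<Longrightarrow> (\<lambda>x. a * u x) \<in> L2 M"
  using L2_comb[of u M u a 0] by simp

lemma L2_diff: "u \<in> L2 M \<Longrightarrow> v \<in> L2 M \<Longrightarrow> (\<lambda>x. u x - v x) \<in> L2 M"
  using L2_comb[of u M v 1 "-1"] by simp

lemma L2_zero: "(\<lambda>x. 0) \<in> L2 M"
  by (simp add: L2_def)

lemma L2_sum:
  assumes "\<And>j. j \<in> J \<Longrightarrow> u j \<in> L2 M"
  shows "(\<lambda>x. \<Sum>j\<in>J. c j * u j x) \<in> L2 M"
  using assms
proof (induction J rule: infinite_finite_induct)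
  case (insert j J)
  then show ?case
    using L2_comb[of "u j" M "\<lambda>x. \<Sum>j\<in>J. c j * u j x" "c j" 1] by simp
qed (auto simp: L2_zero)

lemma ip_commute: "ip M u v = ip M v u"
  by (simp add: ip_def mult.commute)

lemma ip_comb:
  assumes "u \<in> L2 M" "v \<in> L2 M" "w \<in> L2 M"
  shows "ip M (\<lambda>x. a * u x + b * v x) w = a * ip M u w + b * ip M v w"
proof -
  have "ip M (\<lambda>x. a * u x + b * v x) w = (LINT x|M. a * (u x * w x) + b * (v x * w x))"
    by (simp add: ip_def algebra_simps)
  then show ?thesis
    using L2_integrable_mult[OF assms(1,3)] L2_integrable_mult[OF assms(2,3)] by (simp add: ip_def)
qed

lemma ip_cmult: "ip M (\<lambda>x. a * u x) w = a * ip M u w"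
  by (simp add: ip_def mult.assoc)

lemma ip_diff:
  "u \<in> L2 M \<Longrightarrow> v \<in> L2 M \<Longrightarrow> w \<in> L2 M \<Longrightarrow> ip M (\<lambda>x. u x - v x) w = ip M u w - ip M v w"
  using ip_comb[of u M v w 1 "-1"] by simp

lemma ip_sum:
  assumes "\<And>j. j \<in> J \<Longrightarrow> u j \<in> L2 M" "w \<in> L2 M"
  shows "ip M (\<lambda>x. \<Sum>j\<in>J. c j * u j x) w = (\<Sum>j\<in>J. c j * ip M (u j) w)"
  using assms
proof (induction J rule: infinite_finite_induct)
  case (insert j J)
  then show ?case
    using ip_comb[of "u j" M "\<lambda>x. \<Sum>j\<in>J. c j * u j x" w "c j" 1] L2_sum[of J u M c] by simp
qed (auto simp: ip_def)

lemma ip_sum_right: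
  assumes "\<And>j. j \<in> J \<Longrightarrow> u j \<in> L2 M" "w \<in> L2 M"
  shows "ip M w (\<lambda>x. \<Sum>j\<in>J. c j * u j x) = (\<Sum>j\<in>J. c j * ip M w (u j))"
  using ip_sum[OF assms] by (simp add: ip_commute[of M w])

lemma ip_nonneg: "0 \<le> ip M u u"
  by (simp add: ip_def)

lemma ip_cong_AE:
  assumes "u \<in> L2 M" "u' \<in> L2 M" "v \<in> L2 M" "AE x in M. u x = u' x"
  shows "ip M u v = ip M u' v"
  unfolding ip_def using assms by (intro integral_cong_AE) (auto simp: L2_def)

section \<open>Cauchy-Schwarz and convergence in norm\<close>

lemma form_expand:
  assumes "u \<in> L2 M" "v \<in> L2 M"
  shows "ip M (\<lambda>x. s * u x + t * v x) (\<lambda>x. s * u x + t * v x) =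
         ip M u u * s\<^sup>2 + 2 * ip M u v * s * t + ip M v v * t\<^sup>2"
proof -
  have c: "(\<lambda>x. s * u x + t * v x) \<in> L2 M" using assms by (rule L2_comb)
  have "ip M u (\<lambda>x. s * u x + t * v x) = s * ip M u u + t * ip M u v"
       "ip M v (\<lambda>x. s * u x + t * v x) = s * ip M u v + t * ip M v v"
    using ip_comb[OF assms, of u s t] ip_comb[OF assms, of v s t] assms
    by (simp_all add: ip_commute[of M _ "\<lambda>x. s * u x + t * v x"] ip_commute[of M v u])
  then show ?thesis
    using ip_comb[OF assms c, of s t] by (simp add: power2_eq_square algebra_simps)
qed

lemma ip_Cauchy_Schwarz:
  assumes "u \<in> L2 M" "v \<in> L2 M"
  shows "(ip M u v)\<^sup>2 \<le> ip M u u * ip M v v"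
proof (rule discriminant_le)
  fix s t
  show "0 \<le> ip M u u * s\<^sup>2 + 2 * ip M u v * s * t + ip M v v * t\<^sup>2"
    using form_expand[OF assms, of s t] ip_nonneg by metis
qed

lemma ip_tendsto:
  assumes u: "\<And>k::nat. u k \<in> L2 M" and g: "g \<in> L2 M" and v: "v \<in> L2 M"
    and lim: "(\<lambda>k. ip M (\<lambda>x. u k x - g x) (\<lambda>x. u k x - g x)) \<longlonglongrightarrow> 0"
  shows "(\<lambda>k. ip M (u k) v) \<longlonglongrightarrow> ip M g v"
proof -
  have "(\<lambda>k. (ip M (\<lambda>x. u k x - g x) v)\<^sup>2) \<longlonglongrightarrow> 0"
  proof (rule tendsto_sandwich[where f = "\<lambda>_. 0"])
    show "(\<lambda>k. ip M (\<lambda>x. u k x - g x) (\<lambda>x. u k x - g x) * ip M v v) \<longlonglongrightarrow> 0"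
      using lim by (rule tendsto_mult_left_zero)
    show "\<forall>\<^sub>F k in sequentially. (ip M (\<lambda>x. u k x - g x) v)\<^sup>2
        \<le> ip M (\<lambda>x. u k x - g x) (\<lambda>x. u k x - g x) * ip M v v"
      using u g v by (intro always_eventually allI ip_Cauchy_Schwarz L2_diff)
  qed auto
  then have "(\<lambda>k. ip M (\<lambda>x. u k x - g x) v) \<longlonglongrightarrow> 0"
    by simp
  then have "(\<lambda>k. ip M (u k) v - ip M g v) \<longlonglongrightarrow> 0"
    using u g v by (simp add: ip_diff)
  then show ?thesis by (rule LIM_zero_cancel)
qed

lemma ip_self_tendsto:
  assumes u: "\<And>k::nat. u k \<in> L2 M" and g: "g \<in> L2 M"
    and lim: "(\<lambda>k. ip M (\<lambda>x. u k x - g x) (\<lambda>x. u k x - g x)) \<longlonglongrightarrow> 0"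
  shows "(\<lambda>k. ip M (u k) (u k)) \<longlonglongrightarrow> ip M g g"
proof -
  have "ip M (\<lambda>x. u k x - g x) (\<lambda>x. u k x - g x) + 2 * ip M (u k) g - ip M g g = ip M (u k) (u k)" for k
    using form_expand[OF u[of k] g, of 1 "-1"] by simp
  moreover have "(\<lambda>k. ip M (\<lambda>x. u k x - g x) (\<lambda>x. u k x - g x) + 2 * ip M (u k) g - ip M g g)
      \<longlonglongrightarrow> 0 + 2 * ip M g g - ip M g g"
    by (intro tendsto_intros lim ip_tendsto[OF u g g lim])
  ultimately show ?thesis by simp
qed

section \<open>Eigenfunctions of an integral operator with continuous kernel\<close>

text \<open>The witness condition inside \<open>kernel_eigenvalue\<close>. The eigenvalues may
  differ and may exceed \<open>t\<close>, so a system at level \<open>t\<close> is one at every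
  lower level too, and it can be extended function by function at fixed \<open>t\<close>.\<close>

definition eigensystem :: "'a measure \<Rightarrow> ('a \<Rightarrow> 'a \<Rightarrow> real) \<Rightarrow> nat \<Rightarrow> real \<Rightarrow> (nat \<Rightarrow> 'a \<Rightarrow> real) \<Rightarrow> bool" where
  "eigensystem M K i t fs \<longleftrightarrow>
     (\<forall>j<i. fs j \<in> L2 M) \<and>
     (\<forall>j<i. \<forall>j'<i. ip M (fs j) (fs j') = (if j = j' then 1 else 0)) \<and>
     (\<forall>j<i. \<exists>l\<ge>t. AE x in M. (LINT y|M. K x y * fs j y) = l * fs j x)"

lemma ip_cong_space:
  "(\<And>x. x \<in> space M \<Longrightarrow> u x = u' x) \<Longrightarrow> (\<And>x. x \<in> space M \<Longrightarrow> v x = v' x) \<Longrightarrow> ip M u v = ip M u' v'"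
  unfolding ip_def by (rule Bochner_Integration.integral_cong) auto

lemma L2_cong_space:
  assumes "u \<in> L2 M" "\<And>x. x \<in> space M \<Longrightarrow> u x = v x"
  shows "v \<in> L2 M"
proof -
  have "u \<in> borel_measurable M \<longleftrightarrow> v \<in> borel_measurable M"
    by (rule measurable_cong) (use assms in auto)
  moreover have "integrable M (\<lambda>x. (u x)\<^sup>2) \<longleftrightarrow> integrable M (\<lambda>x. (v x)\<^sup>2)"
    by (rule Bochner_Integration.integrable_cong) (use assms in auto)
  ultimately show ?thesis using assms by (simp add: L2_def)
qed

text \<open>One setting for three operators: the kernel with \<sigma>, the kernel with the weighted
  measure, and the negated kernel in the proof of positivity. Hence \<open>K\<close> is symmetric
  but of no particular sign. Equicontinuity is uniform in the second argument, which makes the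
  images of norm-bounded sets equicontinuous.\<close>

locale kernel_operator = finite_measure M for M :: "'a::euclidean_space measure" +
  fixes K :: "'a \<Rightarrow> 'a \<Rightarrow> real" and B :: real
  assumes compact_space: "compact (space M)"
    and continuous_measurable: "\<And>g :: 'a \<Rightarrow> real. continuous_on (space M) g \<Longrightarrow> g \<in> borel_measurable M"
    and K_measurable: "(\<lambda>(x, y). K x y) \<in> borel_measurable (M \<Otimes>\<^sub>M M)"
    and K_bound: "\<And>x y. x \<in> space M \<Longrightarrow> y \<in> space M \<Longrightarrow> \<bar>K x y\<bar> \<le> B"
    and B_nonneg: "0 \<le> B"
    and K_sym: "\<And>x y. x \<in> space M \<Longrightarrow> y \<in> space M \<Longrightarrow> K x y = K y x"
    and K_equicontinuous: "\<And>x e. x \<in> space M \<Longrightarrow> e > 0 \<Longrightarrow>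
      \<exists>d>0. \<forall>x'\<in>space M. norm (x - x') < d \<longrightarrow> (\<forall>y\<in>space M. \<bar>K x y - K x' y\<bar> \<le> e)"
begin

definition op :: "('a \<Rightarrow> real) \<Rightarrow> 'a \<Rightarrow> real" where
  "op u x = (LINT y|M. K x y * u y)"

abbreviation "mass \<equiv> measure M (space M)"

lemma op_ip: "op u x = ip M (K x) u"
  by (simp add: op_def ip_def)

lemma bounded_L2:
  assumes "u \<in> borel_measurable M" "\<And>x. x \<in> space M \<Longrightarrow> \<bar>u x\<bar> \<le> C"
  shows "u \<in> L2 M"
proof -
  have "(u x)\<^sup>2 \<le> C\<^sup>2" if "x \<in> space M" for x
    using assms(2)[OF that] by (metis abs_ge_zero power2_abs power_mono)
  then have "integrable M (\<lambda>x. (u x)\<^sup>2)"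
    using assms by (intro integrable_const_bound[of _ "C\<^sup>2"]) auto
  then show ?thesis using assms by (simp add: L2_def)
qed

lemma ip_self_bound:
  assumes "u \<in> borel_measurable M" "\<And>x. x \<in> space M \<Longrightarrow> (u x)\<^sup>2 \<le> C"
  shows "ip M u u \<le> C * mass"
proof -
  have "integrable M (\<lambda>x. u x * u x)"
    using assms by (intro integrable_const_bound[of _ C]) (auto simp: power2_eq_square)
  then have "ip M u u \<le> (LINT x|M. C)"
    unfolding ip_def using assms by (intro integral_mono) (auto simp: power2_eq_square)
  then show ?thesis by (simp add: mult.commute)
qed

lemma K_section_measurable: "x \<in> space M \<Longrightarrow> K x \<in> borel_measurable M"
  using measurable_compose[OF measurable_Pair1' K_measurable] by simp

lemma K_section_L2: "x \<in> space M \<Longrightarrow> K x \<in> L2 M"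
  by (rule bounded_L2[of _ B]) (auto simp: K_section_measurable K_bound)

lemma op_comb:
  assumes "x \<in> space M" "u \<in> L2 M" "v \<in> L2 M"
  shows "op (\<lambda>x. a * u x + b * v x) x = a * op u x + b * op v x"
  using ip_comb[OF assms(2,3) K_section_L2[OF assms(1)], of a b] by (simp add: op_ip ip_commute)

lemma op_cmult: "op (\<lambda>x. a * u x) x = a * op u x"
  by (simp add: op_def mult.left_commute)

lemma op_sum:
  assumes "x \<in> space M" "\<And>j. j \<in> J \<Longrightarrow> u j \<in> L2 M"
  shows "op (\<lambda>x. \<Sum>j\<in>J. c j * u j x) x = (\<Sum>j\<in>J. c j * op (u j) x)"
  using ip_sum_right[where w = "K x" and c = c, OF assms(2) K_section_L2[OF assms(1)]] by (simp add: op_ip)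

lemma op_square_bound:
  assumes "x \<in> space M" "u \<in> L2 M"
  shows "(op u x)\<^sup>2 \<le> B\<^sup>2 * mass * ip M u u"
proof -
  have "(K x y)\<^sup>2 \<le> B\<^sup>2" if "y \<in> space M" for y
    using K_bound[OF assms(1) that] by (metis abs_ge_zero power2_abs power_mono)
  then have "ip M (K x) (K x) \<le> B\<^sup>2 * mass"
    using K_section_measurable[OF assms(1)] by (intro ip_self_bound) auto
  then have "ip M (K x) (K x) * ip M u u \<le> B\<^sup>2 * mass * ip M u u"
    by (rule mult_right_mono) (rule ip_nonneg)
  then show ?thesis
    using ip_Cauchy_Schwarz[OF K_section_L2[OF assms(1)] assms(2)] by (simp add: op_ip)
qed

lemma op_difference_bound:
  assumes "x \<in> space M" "x' \<in> space M" "u \<in> L2 M"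
    and e: "\<And>y. y \<in> space M \<Longrightarrow> \<bar>K x y - K x' y\<bar> \<le> e"
  shows "(op u x - op u x')\<^sup>2 \<le> e\<^sup>2 * mass * ip M u u"
proof -
  have "(K x y - K x' y)\<^sup>2 \<le> e\<^sup>2" if "y \<in> space M" for y
    using e[OF that] by (metis abs_ge_zero power2_abs power_mono)
  then have "ip M (\<lambda>y. K x y - K x' y) (\<lambda>y. K x y - K x' y) \<le> e\<^sup>2 * mass"
    using K_section_measurable[OF assms(1)] K_section_measurable[OF assms(2)]
    by (intro ip_self_bound) auto
  then have "ip M (\<lambda>y. K x y - K x' y) (\<lambda>y. K x y - K x' y) * ip M u u \<le> e\<^sup>2 * mass * ip M u u"
    by (rule mult_right_mono) (rule ip_nonneg)
  moreover have "op u x - op u x' = ip M (\<lambda>y. K x y - K x' y) u"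
    using assms K_section_L2 by (simp add: op_ip ip_diff)
  ultimately show ?thesis
    using ip_Cauchy_Schwarz[OF L2_diff[OF K_section_L2[OF assms(1)] K_section_L2[OF assms(2)]] assms(3)]
    by simp
qed

text \<open>The same \<open>d\<close> serves the whole ball \<open>ip M u u \<le> C\<close>.
  Together with \<open>op_square_bound\<close> this meets the assumptions of Arzela-Ascoli.\<close>

lemma op_equicontinuous:
  assumes "x \<in> space M" "e > 0" "0 \<le> C"
  shows "\<exists>d>0. \<forall>x'\<in>space M. norm (x - x') < d \<longrightarrow>
    (\<forall>u\<in>L2 M. ip M u u \<le> C \<longrightarrow> \<bar>op u x - op u x'\<bar> < e)"
proof -
  \<comment> \<open>The summand 1 keeps the denominator positive when
    \<open>mass * C = 0\<close>.\<close>
  define a where "a = e / (sqrt (mass * C) + 1)"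
  have den: "0 < sqrt (mass * C) + 1"
    using assms(3) by (intro add_nonneg_pos real_sqrt_ge_zero mult_nonneg_nonneg) auto
  then have "a > 0" using assms(2) by (simp add: a_def)
  then obtain d where d: "d > 0"
    "\<forall>x'\<in>space M. norm (x - x') < d \<longrightarrow> (\<forall>y\<in>space M. \<bar>K x y - K x' y\<bar> \<le> a)"
    using K_equicontinuous[OF assms(1)] by blast
  have "\<bar>op u x - op u x'\<bar> < e"
    if "x' \<in> space M" "norm (x - x') < d" "u \<in> L2 M" "ip M u u \<le> C" for x' u
  proof -
    have "(op u x - op u x')\<^sup>2 \<le> a\<^sup>2 * mass * ip M u u"
      using that d assms(1) by (intro op_difference_bound) auto
    also have "\<dots> \<le> a\<^sup>2 * mass * C"
      using that(4) by (intro mult_left_mono) auto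
    finally have "\<bar>op u x - op u x'\<bar> \<le> sqrt (a\<^sup>2 * mass * C)"
      by (intro real_le_rsqrt) simp
    also have "\<dots> = a * sqrt (mass * C)"
      using \<open>a > 0\<close> by (simp add: real_sqrt_mult)
    also have "\<dots> < a * (sqrt (mass * C) + 1)"
      using \<open>a > 0\<close> by simp
    also have "\<dots> = e" using den by (simp add: a_def)
    finally show ?thesis .
  qed
  then show ?thesis using d(1) by (intro exI[of _ d]) auto
qed

lemma op_continuous:
  assumes "u \<in> L2 M"
  shows "continuous_on (space M) (op u)"
  unfolding continuous_on_iff
proof (intro ballI allI impI)
  fix x and e :: real assume "x \<in> space M" "e > 0"
  then obtain d where d: "d > 0" "\<forall>x'\<in>space M. norm (x - x') < d \<longrightarrow>
      (\<forall>v\<in>L2 M. ip M v v \<le> ip M u u \<longrightarrow> \<bar>op v x - op v x'\<bar> < e)"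
    using op_equicontinuous[of x e "ip M u u"] ip_nonneg by blast
  then show "\<exists>d>0. \<forall>x'\<in>space M. dist x' x < d \<longrightarrow> dist (op u x') (op u x) < e"
    using assms by (intro exI[of _ d]) (simp add: dist_norm norm_minus_commute[of x] abs_minus_commute)
qed

lemma continuous_L2:
  assumes "continuous_on (space M) g"
  shows "g \<in> L2 M"
proof -
  have "bounded (g ` space M)"
    using assms compact_space by (intro compact_imp_bounded compact_continuous_image)
  then obtain C where "\<And>x. x \<in> space M \<Longrightarrow> \<bar>g x\<bar> \<le> C"
    by (auto simp: bounded_iff)
  then show ?thesis
    using continuous_measurable[OF assms] by (rule bounded_L2[rotated])
qed

lemma op_L2: "u \<in> L2 M \<Longrightarrow> op u \<in> L2 M"
  by (rule continuous_L2[OF op_continuous])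

text \<open>Besides bounding Rayleigh quotients, this makes the form vanish wherever
  \<open>ip M u u = 0\<close>, which disposes of the degenerate cases that a semi-inner product
  brings along.\<close>

lemma ip_op_bound:
  assumes "u \<in> L2 M"
  shows "\<bar>ip M (op u) u\<bar> \<le> B * mass * ip M u u"
proof -
  have "ip M (op u) (op u) \<le> B\<^sup>2 * mass * ip M u u * mass"
    using op_square_bound[OF _ assms] L2_measurable[OF op_L2[OF assms]] by (intro ip_self_bound) auto
  then have "ip M (op u) (op u) * ip M u u \<le> B\<^sup>2 * mass * ip M u u * mass * ip M u u"
    by (rule mult_right_mono) (rule ip_nonneg)
  then have "(ip M (op u) u)\<^sup>2 \<le> (B * mass * ip M u u)\<^sup>2"
    using ip_Cauchy_Schwarz[OF op_L2[OF assms] assms] by (simp add: power2_eq_square mult_ac)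
  then have "\<bar>ip M (op u) u\<bar> \<le> \<bar>B * mass * ip M u u\<bar>"
    by (simp only: abs_le_square_iff)
  then show ?thesis
    using B_nonneg ip_nonneg[of M u] by (simp add: abs_mult)
qed

text \<open>Fubini and the symmetry of \<open>K\<close>. The integrand is dominated by
  \<open>B * \<bar>v x * u y\<bar>\<close>, integrable on the product because square integrable
  functions are integrable over a finite measure.\<close>

lemma op_adjoint:
  assumes u: "u \<in> L2 M" and v: "v \<in> L2 M"
  shows "ip M (op u) v = ip M u (op v)"
proof -
  interpret P: pair_sigma_finite M M ..
  have [measurable]: "u \<in> borel_measurable M" "v \<in> borel_measurable M"
    using u v by (auto simp: L2_measurable)
  note [measurable] = K_measurable
  have one: "(\<lambda>x. 1::real) \<in> L2 M" by (rule bounded_L2[of _ 1]) auto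
  have iu: "integrable M u" and iv: "integrable M v"
    using L2_integrable_mult[OF u one] L2_integrable_mult[OF v one] by auto
  have prod: "integrable (M \<Otimes>\<^sub>M M) (\<lambda>(x, y). v x * u y)"
  proof (rule P.Fubini_integrable)
    have "integrable M (\<lambda>x. \<bar>v x\<bar> * (LINT y|M. \<bar>u y\<bar>))"
      using iv by auto
    then show "integrable M (\<lambda>x. LINT y|M. norm (case (x, y) of (x, y) \<Rightarrow> v x * u y))"
      by (simp add: abs_mult)
  qed (use iu in auto)
  have int: "integrable (M \<Otimes>\<^sub>M M) (\<lambda>(x, y). K x y * u y * v x)"
  proof (rule Bochner_Integration.integrable_bound)
    show "integrable (M \<Otimes>\<^sub>M M) (\<lambda>p. B * (case p of (x, y) \<Rightarrow> v x * u y))"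
      using prod by (rule integrable_mult_right)
    show "(\<lambda>(x, y). K x y * u y * v x) \<in> borel_measurable (M \<Otimes>\<^sub>M M)"
      by measurable
    have "\<bar>K x y * u y * v x\<bar> \<le> \<bar>B * (v x * u y)\<bar>" if "x \<in> space M" "y \<in> space M" for x y
      using mult_right_mono[OF K_bound[OF that], of "\<bar>v x * u y\<bar>"] B_nonneg
      by (simp add: abs_mult mult_ac)
    then show "AE p in M \<Otimes>\<^sub>M M. norm (case p of (x, y) \<Rightarrow> K x y * u y * v x)
        \<le> norm (B * (case p of (x, y) \<Rightarrow> v x * u y))"
      by (intro AE_I2) (auto simp: space_pair_measure)
  qed
  have "ip M (op u) v = (LINT x|M. LINT y|M. K x y * u y * v x)"
    by (simp add: ip_def op_def)
  also have "\<dots> = (LINT y|M. LINT x|M. K x y * u y * v x)"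
    using P.Fubini_integral[OF int] by simp
  also have "\<dots> = (LINT y|M. LINT x|M. u y * (K y x * v x))"
    by (intro Bochner_Integration.integral_cong) (auto simp: K_sym mult_ac)
  also have "\<dots> = ip M u (op v)"
    by (simp add: ip_def op_def)
  finally show ?thesis .
qed

lemma op_cong_AE:
  assumes "x \<in> space M" "u \<in> L2 M" "v \<in> L2 M" "AE y in M. u y = v y"
  shows "op u x = op v x"
  using ip_cong_AE[OF assms(2,3) K_section_L2[OF assms(1)] assms(4)] by (simp add: op_ip ip_commute)

lemma op_tendsto:
  assumes "x \<in> space M" and u: "\<And>k::nat. u k \<in> L2 M" and g: "g \<in> L2 M"
    and lim: "(\<lambda>k. ip M (\<lambda>x. u k x - g x) (\<lambda>x. u k x - g x)) \<longlonglongrightarrow> 0"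
  shows "(\<lambda>k. op (u k) x) \<longlonglongrightarrow> op g x"
  using ip_tendsto[OF u g K_section_L2[OF assms(1)] lim] by (simp add: op_ip ip_commute)

end

section \<open>Variational construction of eigenfunctions\<close>

lemma ip_cmult_right: "ip M w (\<lambda>x. a * u x) = a * ip M w u"
  by (simp add: ip_def mult.left_commute)

context kernel_operator
begin

definition orth :: "nat \<Rightarrow> (nat \<Rightarrow> 'a \<Rightarrow> real) \<Rightarrow> ('a \<Rightarrow> real) set" where
  "orth j fs = {u \<in> L2 M. \<forall>i<j. ip M u (fs i) = 0}"

lemma orth_comb:
  assumes "eigensystem M K j t fs" "u \<in> orth j fs" "v \<in> orth j fs"
  shows "(\<lambda>x. a * u x + b * v x) \<in> orth j fs"
  using assms by (auto simp: orth_def L2_comb ip_comb eigensystem_def)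

lemma eigensystemD:
  assumes "eigensystem M K j t fs" "i < j"
  shows "fs i \<in> L2 M" "\<exists>l\<ge>t. AE x in M. op (fs i) x = l * fs i x"
  using assms by (auto simp: eigensystem_def op_def)

text \<open>Symmetry moves the operator onto the eigenfunctions. The complement is thus invariant,
  and the next eigenfunction can be sought inside it.\<close>

lemma op_orth:
  assumes "eigensystem M K j t fs" "u \<in> orth j fs"
  shows "op u \<in> orth j fs"
proof -
  have u: "u \<in> L2 M" using assms(2) by (simp add: orth_def)
  have "ip M (op u) (fs i) = 0" if i: "i < j" for i
  proof -
    note fs = eigensystemD[OF assms(1) i]
    from fs(2) obtain l where l: "AE x in M. op (fs i) x = l * fs i x" by blast
    have "ip M (op u) (fs i) = ip M (op (fs i)) u"
      using op_adjoint[OF u fs(1)] by (simp add: ip_commute)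
    also have "\<dots> = ip M (\<lambda>x. l * fs i x) u"
      by (rule ip_cong_AE) (use fs(1) u l in \<open>auto intro: op_L2 L2_cmult\<close>)
    also have "\<dots> = 0"
      using assms(2) i by (simp add: ip_cmult orth_def ip_commute)
    finally show ?thesis .
  qed
  then show ?thesis using op_L2[OF u] by (simp add: orth_def)
qed

text \<open>On the complement, \<open>A = L - op\<close> is symmetric with non-negative form, so
  Cauchy-Schwarz for that form applies to \<open>u\<close> and \<open>A u\<close>: the square of
  \<open>ip (A u) (A u)\<close> is at most \<open>ip (A u) u * ip (A (A u)) (A u)\<close>, and the
  last factor is at most \<open>(L + B * mass) * ip (A u) (A u)\<close>. Consequently, functions
  whose quotient is close to the supremum \<open>L\<close> are approximate eigenfunctions.\<close>

lemma residual_bound: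
  assumes es: "eigensystem M K j t fs" and u: "u \<in> orth j fs"
    and L: "0 \<le> L" "\<And>v. v \<in> orth j fs \<Longrightarrow> ip M (op v) v \<le> L * ip M v v"
  defines "A \<equiv> \<lambda>v x. L * v x - op v x"
  shows "ip M (A u) (A u) \<le> (L + B * mass) * (L * ip M u u - ip M (op u) u)"
proof -
  have orthD: "v \<in> L2 M" if "v \<in> orth j fs" for v
    using that by (simp add: orth_def)
  have A_orth: "A v \<in> orth j fs" if "v \<in> orth j fs" for v
    using orth_comb[OF es that op_orth[OF es that], of L "-1"] by (simp add: A_def)
  have A_ip: "ip M (A v) w = L * ip M v w - ip M (op v) w" if "v \<in> L2 M" "w \<in> L2 M" for v w
    using ip_comb[OF that(1) op_L2[OF that(1)] that(2), of L "-1"] by (simp add: A_def)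
  have A_sym: "ip M (A v) w = ip M (A w) v" if "v \<in> L2 M" "w \<in> L2 M" for v w
    using op_adjoint[OF that] that
    by (simp add: A_ip ip_commute[of M w v] ip_commute[of M "op w" v])
  have A_pos: "0 \<le> ip M (A v) v" if "v \<in> orth j fs" for v
    using L(2)[OF that] orthD[OF that] by (simp add: A_ip)
  have A_CS: "(ip M (A u) v)\<^sup>2 \<le> ip M (A u) u * ip M (A v) v" if v: "v \<in> orth j fs" for v
  proof (rule discriminant_le)
    fix a b
    let ?w = "\<lambda>x. a * u x + b * v x"
    have w: "?w \<in> orth j fs" by (rule orth_comb[OF es u v])
    have Lu: "u \<in> L2 M" "v \<in> L2 M" "A u \<in> L2 M" "A v \<in> L2 M" "?w \<in> L2 M"
      using u v w A_orth orthD by blast+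
    have "ip M (A ?w) ?w = ip M (\<lambda>x. a * A u x + b * A v x) ?w"
      using Lu by (intro ip_cong_space) (auto simp: A_def op_comb algebra_simps)
    also have "\<dots> = a * ip M (A u) ?w + b * ip M (A v) ?w"
      using Lu by (simp add: ip_comb)
    also have "ip M (A u) ?w = a * ip M (A u) u + b * ip M (A u) v"
      using ip_comb[OF Lu(1,2,3), of a b] by (simp add: ip_commute)
    also have "ip M (A v) ?w = a * ip M (A u) v + b * ip M (A v) v"
      using ip_comb[OF Lu(1,2,4), of a b] A_sym[OF Lu(1,2)] by (simp add: ip_commute)
    finally show "0 \<le> ip M (A u) u * a\<^sup>2 + 2 * ip M (A u) v * a * b + ip M (A v) v * b\<^sup>2"
      using A_pos[OF w] by (simp add: power2_eq_square algebra_simps)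
  qed
  define s where "s = ip M (A u) (A u)"
  have Au: "A u \<in> orth j fs" "A u \<in> L2 M" using A_orth[OF u] orthD by auto
  have "ip M (A (A u)) (A u) \<le> L * s + \<bar>ip M (op (A u)) (A u)\<bar>"
    using A_ip[OF Au(2) Au(2)] by (simp add: s_def)
  also have "\<dots> \<le> (L + B * mass) * s"
    using ip_op_bound[OF Au(2)] by (simp add: s_def algebra_simps)
  finally have 1: "ip M (A (A u)) (A u) \<le> (L + B * mass) * s" .
  have "s * s \<le> ip M (A u) u * ip M (A (A u)) (A u)"
    using A_CS[OF Au(1)] by (simp add: s_def power2_eq_square)
  also have "\<dots> \<le> ip M (A u) u * ((L + B * mass) * s)"
    using 1 A_pos[OF u] by (rule mult_left_mono)
  finally have 2: "s * s \<le> ((L + B * mass) * ip M (A u) u) * s"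
    by (simp add: mult_ac)
  have "s \<le> (L + B * mass) * ip M (A u) u"
  proof (cases "s = 0")
    case True
    then show ?thesis using A_pos[OF u] L(1) B_nonneg by simp
  next
    case False
    then have "s > 0" using ip_nonneg[of M "A u"] by (simp add: s_def)
    then show ?thesis using 2 by simp
  qed
  then show ?thesis using A_ip[OF orthD[OF u] orthD[OF u]] by (simp add: s_def)
qed

text \<open>The test function \<open>h\<close> forces the supremum \<open>L\<close> of the quotient
  to be at least \<open>t\<close>, hence positive. Compactness only concerns the images
  \<open>op (u k)\<close>, which converge uniformly to some \<open>G\<close> along a subsequence. As
  \<open>L * u k - op (u k)\<close> tends to 0 by \<open>residual_bound\<close>, the functions
  themselves converge in norm to \<open>G / L\<close>.\<close>

theorem eigensystem_extend:
  assumes es: "eigensystem M K j t fs" and t: "t > 0"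
    and h: "h \<in> orth j fs" "ip M h h > 0" "ip M (op h) h \<ge> t * ip M h h"
  shows "\<exists>g. eigensystem M K (Suc j) t (fs(j := g))"
proof -
  define P where "P = {u \<in> orth j fs. ip M u u = 1}"
  define Q where "Q u = ip M (op u) u" for u
  have orthD: "v \<in> L2 M" if "v \<in> orth j fs" for v
    using that by (simp add: orth_def)
  have scale: "(\<lambda>x. c * u x) \<in> orth j fs" if "u \<in> orth j fs" for c u
    using orth_comb[OF es that that, of c 0] by simp
  have normalize: "(\<lambda>x. (1 / sqrt (ip M u u)) * u x) \<in> P"
    "Q (\<lambda>x. (1 / sqrt (ip M u u)) * u x) = Q u / ip M u u"
    if u: "u \<in> orth j fs" "ip M u u > 0" for u
  proof -
    let ?c = "1 / sqrt (ip M u u)"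
    have "ip M (\<lambda>x. ?c * u x) (\<lambda>x. ?c * u x) = ?c * ?c * ip M u u"
      by (simp only: ip_cmult ip_cmult_right mult.assoc)
    moreover have "?c * ?c * ip M u u = 1"
      using u(2) by (simp add: field_simps)
    ultimately show "(\<lambda>x. ?c * u x) \<in> P"
      using scale[OF u(1), of ?c] by (simp add: P_def)
    have "op (\<lambda>x. ?c * u x) = (\<lambda>x. ?c * op u x)"
      by (rule ext) (rule op_cmult)
    then have "Q (\<lambda>x. ?c * u x) = ?c * ?c * Q u"
      unfolding Q_def by (simp only: ip_cmult ip_cmult_right mult.assoc)
    then show "Q (\<lambda>x. ?c * u x) = Q u / ip M u u"
      using u(2) by simp
  qed
  define L where "L = Sup (Q ` P)"
  have bdd: "bdd_above (Q ` P)"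
  proof (rule bdd_aboveI2)
    fix u assume "u \<in> P"
    then show "Q u \<le> B * mass"
      using ip_op_bound[of u] by (auto simp: P_def Q_def orth_def)
  qed
  have "t \<le> Q h / ip M h h"
    using h(2,3) by (simp add: Q_def field_simps)
  also have "\<dots> \<le> L"
    using cSUP_upper[OF normalize(1)[OF h(1,2)] bdd] normalize(2)[OF h(1,2)] by (simp add: L_def)
  finally have tL: "t \<le> L" .
  then have L0: "L > 0" using t by simp
  have QL: "Q v \<le> L * ip M v v" if v: "v \<in> orth j fs" for v
  proof (cases "ip M v v = 0")
    case True
    then show ?thesis using ip_op_bound[OF orthD[OF v]] by (simp add: Q_def)
  next
    case False
    then have pos: "ip M v v > 0" using ip_nonneg[of M v] by simp
    then have "Q v / ip M v v \<le> L"
      using cSUP_upper[OF normalize(1)[OF v pos] bdd] normalize(2)[OF v pos] by (simp add: L_def)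
    then show ?thesis using pos by (simp add: field_simps)
  qed
  have "\<exists>u\<in>P. L - 1 / real (Suc k) < Q u" for k
    using less_cSUP_iff[OF _ bdd, of "L - 1 / real (Suc k)"] normalize(1)[OF h(1,2)]
    by (auto simp: L_def)
  then obtain u where uP: "\<And>k. u k \<in> P" and uQ: "\<And>k. L - 1 / real (Suc k) < Q (u k)"
    by metis
  have uO: "\<And>k. u k \<in> orth j fs" and u1: "\<And>k. ip M (u k) (u k) = 1" and uL: "\<And>k. u k \<in> L2 M"
    using uP by (auto simp: P_def orth_def)
  obtain G r where G: "continuous_on (space M) G" and r: "strict_mono (r :: nat \<Rightarrow> nat)"
    and unif: "\<And>e. 0 < e \<Longrightarrow> \<exists>N. \<forall>n x. n \<ge> N \<and> x \<in> space M \<longrightarrow> norm (op (u (r n)) x - G x) < e"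
  proof (rule Arzela_Ascoli[OF compact_space, of "\<lambda>k. op (u k)" "sqrt (B\<^sup>2 * mass)"])
    show "norm (op (u n) x) \<le> sqrt (B\<^sup>2 * mass)" if "x \<in> space M" for n x
      using op_square_bound[OF that uL[of n]] u1 by (intro real_le_rsqrt) simp
    show "\<exists>d>0. \<forall>n y. y \<in> space M \<and> norm (x - y) < d \<longrightarrow> norm (op (u n) x - op (u n) y) < e"
      if x: "x \<in> space M" "0 < e" for x e
      using op_equicontinuous[OF x, of 1] uL u1 by simp (metis order_refl)
  qed blast
  define v where "v n = u (r n)" for n
  define g where "g x = G x / L" for x
  have vL: "v n \<in> L2 M" and v1: "ip M (v n) (v n) = 1" and vO: "v n \<in> orth j fs" for n
    using uL u1 uO by (auto simp: v_def)
  have GL: "G \<in> L2 M" using G by (rule continuous_L2)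
  have gL: "g \<in> L2 M" using L2_cmult[OF GL, of "1 / L"] by (simp add: g_def[abs_def])
  let ?d = "\<lambda>n x. v n x - g x"
  let ?R = "\<lambda>n x. L * v n x - op (v n) x"
  let ?S = "\<lambda>n x. op (v n) x - G x"
  have RL: "?R n \<in> L2 M" and SL: "?S n \<in> L2 M" for n
    using L2_comb[OF vL op_L2[OF vL], of L n "-1" n] L2_diff[OF op_L2[OF vL] GL] by auto
  have R_lim: "(\<lambda>n. ip M (?R n) (?R n)) \<longlonglongrightarrow> 0"
  proof (rule tendsto_sandwich[where f = "\<lambda>_. 0"])
    show "(\<lambda>n. (L + B * mass) * (1 / real (Suc (r n)))) \<longlonglongrightarrow> 0"
      using LIMSEQ_subseq_LIMSEQ[OF LIMSEQ_inverse_real_of_nat r]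
      by (intro tendsto_mult_right_zero) (simp add: o_def inverse_eq_divide)
    have "ip M (?R n) (?R n) \<le> (L + B * mass) * (1 / real (Suc (r n)))" for n
    proof -
      have "ip M (?R n) (?R n) \<le> (L + B * mass) * (L * ip M (v n) (v n) - ip M (op (v n)) (v n))"
        using L0 QL by (intro residual_bound[OF es vO]) (auto simp: Q_def)
      also have "\<dots> \<le> (L + B * mass) * (1 / real (Suc (r n)))"
        using uQ[of "r n"] v1[of n] L0 B_nonneg
        by (intro mult_left_mono) (auto simp: v_def Q_def)
      finally show ?thesis .
    qed
    then show "\<forall>\<^sub>F n in sequentially. ip M (?R n) (?R n) \<le> (L + B * mass) * (1 / real (Suc (r n)))"
      by simp
  qed (auto simp: ip_nonneg)
  have S_lim: "(\<lambda>n. ip M (?S n) (?S n)) \<longlonglongrightarrow> 0"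
  proof (rule LIMSEQ_I)
    fix e :: real assume e: "0 < e"
    define a where "a = sqrt (e / (mass + 1))"
    have m1: "mass + 1 > 0" by (intro add_nonneg_pos) auto
    then have "a > 0" using e by (simp add: a_def)
    then obtain N where N: "\<forall>n x. n \<ge> N \<and> x \<in> space M \<longrightarrow> norm (op (v n) x - G x) < a"
      using unif unfolding v_def by blast
    have "norm (ip M (?S n) (?S n) - 0) < e" if "n \<ge> N" for n
    proof -
      have "(?S n x)\<^sup>2 \<le> a\<^sup>2" if "x \<in> space M" for x
        using N \<open>n \<ge> N\<close> that by (metis abs_ge_zero less_imp_le power2_abs power_mono real_norm_def)
      then have "ip M (?S n) (?S n) \<le> a\<^sup>2 * mass"
        using L2_measurable[OF SL] by (intro ip_self_bound) auto
      also have "\<dots> < a\<^sup>2 * (mass + 1)" using \<open>a > 0\<close> by simp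
      also have "\<dots> = e" using m1 e by (simp add: a_def)
      finally show ?thesis using ip_nonneg[of M "?S n"] by simp
    qed
    then show "\<exists>N. \<forall>n\<ge>N. norm (ip M (?S n) (?S n) - 0) < e" by blast
  qed
  have d_bound: "ip M (?d n) (?d n) \<le> (2 * ip M (?R n) (?R n) + 2 * ip M (?S n) (?S n)) / L\<^sup>2" for n
  proof -
    \<comment> \<open>\<open>L * (v n - g)\<close> is the sum of the residual and of the error of
      the uniform limit; the parallelogram identity bounds its squared norm.\<close>
    let ?p = "\<lambda>x. 1 * ?R n x + 1 * ?S n x" and ?m = "\<lambda>x. 1 * ?R n x + (-1) * ?S n x"
    have "ip M ?p ?p + ip M ?m ?m = 2 * ip M (?R n) (?R n) + 2 * ip M (?S n) (?S n)"
      unfolding form_expand[OF RL SL] by simp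
    then have "ip M ?p ?p \<le> 2 * ip M (?R n) (?R n) + 2 * ip M (?S n) (?S n)"
      using ip_nonneg[of M ?m] by simp
    moreover have "?p = (\<lambda>x. L * ?d n x)"
      using L0 by (auto simp: g_def field_simps)
    moreover have "ip M (\<lambda>x. L * ?d n x) (\<lambda>x. L * ?d n x) = L\<^sup>2 * ip M (?d n) (?d n)"
      by (simp only: ip_cmult ip_cmult_right power2_eq_square mult.assoc)
    ultimately show ?thesis using L0 by (simp add: field_simps)
  qed
  have lim: "(\<lambda>n. ip M (?d n) (?d n)) \<longlonglongrightarrow> 0"
  proof (rule tendsto_sandwich[where f = "\<lambda>_. 0"])
    have "(\<lambda>n. (2 * ip M (?R n) (?R n) + 2 * ip M (?S n) (?S n)) / L\<^sup>2) \<longlonglongrightarrow> (2 * 0 + 2 * 0) / L\<^sup>2"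
      using L0 by (intro tendsto_intros R_lim S_lim) auto
    then show "(\<lambda>n. (2 * ip M (?R n) (?R n) + 2 * ip M (?S n) (?S n)) / L\<^sup>2) \<longlonglongrightarrow> 0"
      by simp
  qed (auto intro!: always_eventually simp: ip_nonneg d_bound)
  have g1: "ip M g g = 1"
    using LIMSEQ_unique[OF ip_self_tendsto[OF vL gL lim]] v1 by simp
  have gfs: "ip M g (fs i) = 0" if "i < j" for i
  proof -
    have "ip M (v n) (fs i) = 0" for n
      using vO[of n] that by (simp add: orth_def)
    then show ?thesis
      using LIMSEQ_unique[OF ip_tendsto[OF vL gL eigensystemD(1)[OF es that] lim]] by simp
  qed
  have gfs': "ip M (fs i) g = 0" if "i < j" for i
    using gfs[OF that] by (subst ip_commute)
  have eig: "op g x = L * g x" if x: "x \<in> space M" for x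
  proof -
    have "(\<lambda>n. op (v n) x) \<longlonglongrightarrow> G x"
    proof (rule LIMSEQ_I)
      fix e :: real assume "0 < e"
      then show "\<exists>N. \<forall>n\<ge>N. norm (op (v n) x - G x) < e"
        using unif[of e] x unfolding v_def by blast
    qed
    moreover have "(\<lambda>n. op (v n) x) \<longlonglongrightarrow> op g x"
      by (rule op_tendsto[OF x vL gL lim])
    ultimately have "op g x = G x" by (rule LIMSEQ_unique[rotated])
    then show ?thesis using L0 by (simp add: g_def)
  qed
  have "eigensystem M K (Suc j) t (fs(j := g))"
    unfolding eigensystem_def
  proof (intro conjI allI impI)
    show "(fs(j := g)) i \<in> L2 M" if "i < Suc j" for i
      using that gL eigensystemD(1)[OF es] by (auto simp: less_Suc_eq)
    show "ip M ((fs(j := g)) i) ((fs(j := g)) i') = (if i = i' then 1 else 0)"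
      if "i < Suc j" "i' < Suc j" for i i'
      using that es g1 gfs gfs' unfolding eigensystem_def by (auto simp: less_Suc_eq)
    show "\<exists>l\<ge>t. AE x in M. (LINT y|M. K x y * (fs(j := g)) i y) = l * (fs(j := g)) i x" if "i < Suc j" for i
    proof (cases "i = j")
      case True
      have "AE x in M. (LINT y|M. K x y * g y) = L * g x"
        using eig by (intro AE_I2) (simp add: op_def)
      then show ?thesis using True tL by auto
    next
      case False
      then show ?thesis using es that unfolding eigensystem_def by (auto simp: less_Suc_eq)
    qed
  qed
  then show ?thesis by blast
qed

text \<open>The lower half of the Courant-Fischer principle. The hypothesis ranges over arbitrary
  systems of length \<open>p < i\<close>, since nothing is known about the functions found so far;
  an \<open>i\<close>-dimensional test space always contains an element orthogonal to them.\<close>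

theorem eigensystem_minimax:
  assumes t: "t > 0"
    and ex: "\<And>p fs. p < i \<Longrightarrow> eigensystem M K p t fs \<Longrightarrow>
      \<exists>h\<in>orth p fs. ip M h h > 0 \<and> ip M (op h) h \<ge> t * ip M h h"
  shows "\<exists>fs. eigensystem M K i t fs"
proof -
  have "p \<le> i \<Longrightarrow> \<exists>fs. eigensystem M K p t fs" for p
  proof (induction p)
    case 0
    show ?case by (simp add: eigensystem_def)
  next
    case (Suc p)
    then obtain fs where fs: "eigensystem M K p t fs" by auto
    then show ?case
      using ex[OF _ fs] Suc.prems eigensystem_extend[OF fs t] by auto
  qed
  then show ?thesis by simp
qed

end

section \<open>Eigenvalues as suprema of levels\<close>

lemma kernel_eigenvalue_eigensystem:
  "kernel_eigenvalue K M i = Sup (insert 0 {m. m > 0 \<and> (\<exists>fs. eigensystem M K i m fs)})"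
  by (simp add: kernel_eigenvalue_def eigensystem_def L2_def ip_def)

text \<open>Bounds the set of levels, without which \<open>Sup\<close> over the reals would carry no
  information. For \<open>i = 0\<close> every level is attained vacuously.\<close>

lemma (in kernel_operator) eigensystem_bound:
  assumes "eigensystem M K i t fs" "i > 0"
  shows "t \<le> B * mass"
proof -
  note f = eigensystemD[OF assms]
  from f(2) obtain l where l: "l \<ge> t" "AE x in M. op (fs 0) x = l * fs 0 x" by blast
  have 1: "ip M (fs 0) (fs 0) = 1" using assms by (simp add: eigensystem_def)
  have "ip M (op (fs 0)) (fs 0) = ip M (\<lambda>x. l * fs 0 x) (fs 0)"
    using f(1) l(2) by (intro ip_cong_AE) (auto intro: op_L2 L2_cmult)
  then have "l = ip M (op (fs 0)) (fs 0)" using 1 by (simp add: ip_cmult)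
  then show ?thesis using l(1) ip_op_bound[OF f(1)] 1 by simp
qed

text \<open>Only the target needs a bounded set of levels: the supremum for \<open>N\<close> is then
  controlled by the least upper bound property. The inserted 0 makes both sets non-empty.\<close>

lemma kernel_eigenvalue_le:
  assumes "kernel_operator M K B" "i > 0" "c > 0"
    and ex: "\<And>m fs. m > 0 \<Longrightarrow> eigensystem N K i m fs \<Longrightarrow> \<exists>gs. eigensystem M K i (c * m) gs"
  shows "c * kernel_eigenvalue K N i \<le> kernel_eigenvalue K M i"
proof -
  interpret kernel_operator M K B by fact
  let ?E = "\<lambda>M. insert 0 {m. m > 0 \<and> (\<exists>fs. eigensystem M K i m fs)}"
  have bdd: "bdd_above (?E M)"
    by (rule bdd_aboveI[of _ "B * mass"]) (use eigensystem_bound assms(2) B_nonneg in auto)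
  have "m \<le> Sup (?E M) / c" if "m \<in> ?E N" for m
  proof -
    have "c * m \<in> ?E M" using that ex assms(3) by auto
    then have "c * m \<le> Sup (?E M)" by (rule cSup_upper[OF _ bdd])
    then show ?thesis using assms(3) by (simp add: field_simps)
  qed
  then have "Sup (?E N) \<le> Sup (?E M) / c" by (intro cSup_least) auto
  then show ?thesis
    using assms(3) by (simp add: kernel_eigenvalue_eigensystem field_simps)
qed

section \<open>The surface measure of the sphere\<close>

lemma nn_integral_lborel_translate:
  fixes g :: "'a::euclidean_space \<Rightarrow> ennreal"
  assumes "g \<in> borel_measurable borel"
  shows "(\<integral>\<^sup>+z. g (c + z) \<partial>lborel) = (\<integral>\<^sup>+z. g z \<partial>lborel)"
proof -
  have "(\<integral>\<^sup>+z. g z \<partial>lborel) = (\<integral>\<^sup>+z. g z \<partial>distr lborel borel ((+) c))"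
    by (simp add: lborel_distr_plus)
  also have "\<dots> = (\<integral>\<^sup>+z. g (c + z) \<partial>lborel)"
    using assms by (intro nn_integral_distr) auto
  finally show ?thesis by simp
qed

lemma unit_ball_vol_nonzero: "n \<ge> 0 \<Longrightarrow> unit_ball_vol n \<noteq> 0"
  using unit_ball_vol_pos[of n] by linarith

text \<open>Integrate the indicator of \<open>R z \<in> A \<and> R z - y \<in> ball 0 1\<close> over all \<open>z\<close> and \<open>y\<close>, in both orders:
  translation invariance makes this the measure of the ball times that of \<open>R -` A\<close>, respectively \<open>A\<close>.\<close>
lemma emeasure_lborel_orthogonal_vimage:
  fixes R :: "'a::euclidean_space \<Rightarrow> 'a"
  assumes R: "orthogonal_transformation R" and A: "A \<in> sets borel"
  shows "emeasure lborel (R -` A) = emeasure lborel A"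
proof -
  have lin: "linear R" using R by (simp add: orthogonal_transformation_def)
  have [measurable]: "R \<in> borel_measurable borel"
    using lin by (intro borel_measurable_continuous_onI linear_continuous_on linear_conv_bounded_linear[THEN iffD1])
  note [measurable] = A
  define U :: "'a set" where "U = ball 0 1"
  have [measurable]: "U \<in> sets borel" by (simp add: U_def)
  define V where "V = emeasure lborel U"
  have V: "V \<noteq> 0" "V \<noteq> \<infinity>"
    using emeasure_lborel_ball_finite[of 0 1] emeasure_ball[of 1 "0::'a"]
      unit_ball_vol_nonzero[of "real DIM('a)"]
    by (auto simp: V_def U_def)
  have ball: "(\<integral>\<^sup>+y. indicator U (R z - y) \<partial>lborel) = V" for z
  proof -
    have "(\<integral>\<^sup>+y. indicator U (R z - y) \<partial>lborel) = (\<integral>\<^sup>+y. indicator (ball (R z) 1) y \<partial>lborel)"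
      by (intro nn_integral_cong) (simp add: indicator_def U_def dist_norm norm_minus_commute)
    also have "\<dots> = V"
      unfolding V_def U_def by (simp add: emeasure_ball)
    finally show ?thesis .
  qed
  have vim: "R -` X \<in> sets borel" if "X \<in> sets borel" for X
    using measurable_sets[OF \<open>R \<in> borel_measurable borel\<close> that] by simp
  have "emeasure lborel (R -` A) * V = (\<integral>\<^sup>+z. indicator A (R z) * V \<partial>lborel)"
  proof -
    have "(\<integral>\<^sup>+z. indicator A (R z) * V \<partial>lborel) = (\<integral>\<^sup>+z. indicator (R -` A) z * V \<partial>lborel)"
      by (intro nn_integral_cong) (auto simp: indicator_def)
    then show ?thesis using vim[OF A] by (simp add: nn_integral_multc)
  qed
  also have "\<dots> = (\<integral>\<^sup>+z. \<integral>\<^sup>+y. indicator A (R z) * indicator U (R z - y) \<partial>lborel \<partial>lborel)"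
    by (simp add: nn_integral_cmult ball)
  also have "\<dots> = (\<integral>\<^sup>+y. \<integral>\<^sup>+z. indicator A (R z) * indicator U (R z - y) \<partial>lborel \<partial>lborel)"
    by (rule lborel_pair.Fubini'[symmetric]) measurable
  also have "\<dots> = (\<integral>\<^sup>+y. \<integral>\<^sup>+z. indicator A (R z + y) * indicator U (R z) \<partial>lborel \<partial>lborel)"
  proof (rule nn_integral_cong)
    fix y
    obtain c where c: "R c = y" using orthogonal_transformation_surj[OF R] by (metis surjD)
    have "(\<integral>\<^sup>+z. indicator A (R z) * indicator U (R z - y) \<partial>lborel)
        = (\<integral>\<^sup>+z. indicator A (R (c + z)) * indicator U (R (c + z) - y) \<partial>lborel)"
      by (rule nn_integral_lborel_translate[symmetric]) measurable
    then show "(\<integral>\<^sup>+z. indicator A (R z) * indicator U (R z - y) \<partial>lborel)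
        = (\<integral>\<^sup>+z. indicator A (R z + y) * indicator U (R z) \<partial>lborel)"
      by (simp add: linear_add[OF lin] c add.commute)
  qed
  also have "\<dots> = (\<integral>\<^sup>+z. \<integral>\<^sup>+y. indicator A (R z + y) * indicator U (R z) \<partial>lborel \<partial>lborel)"
    by (rule lborel_pair.Fubini') measurable
  also have "\<dots> = (\<integral>\<^sup>+z. emeasure lborel A * indicator U z \<partial>lborel)"
  proof (rule nn_integral_cong)
    fix z
    have "(\<integral>\<^sup>+y. indicator A (R z + y) \<partial>lborel) = emeasure lborel A"
      using nn_integral_lborel_translate[of "indicator A" "R z"] A by simp
    moreover have "(indicator U (R z) :: ennreal) = indicator U z"
      using orthogonal_transformation_norm[OF R, of z] by (simp add: U_def indicator_def)
    ultimately show "(\<integral>\<^sup>+y. indicator A (R z + y) * indicator U (R z) \<partial>lborel) = emeasure lborel A * indicator U z"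
      by (simp add: nn_integral_multc)
  qed
  also have "\<dots> = emeasure lborel A * V"
    by (simp add: nn_integral_cmult V_def)
  finally show ?thesis using V by (simp add: mult.commute[of _ V] ennreal_mult_cancel_left)
qed

section \<open>Surface measure through cones\<close>

definition sphere_cone :: "(real^'n) set \<Rightarrow> (real^'n) set" where
  "sphere_cone A = {x \<in> ball 0 1 - {0}. x /\<^sub>R norm x \<in> A}"

text \<open>The surface measure before completion, on which push-forwards along orthogonal maps are
  a matter of Borel sets.\<close>

definition borel_sphere_measure :: "(real^'n) measure" where
  "borel_sphere_measure = distr (density (restrict_space lborel (ball 0 1 - {0})) (\<lambda>_. ennreal (real CARD('n))))
            (restrict_space borel (sphere 0 1)) (\<lambda>x. x /\<^sub>R norm x)"

lemma sphere_measure_completion: "sphere_measure = completion borel_sphere_measure"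
  by (simp add: sphere_measure_def borel_sphere_measure_def)

lemma space_borel_sphere [simp]: "space borel_sphere_measure = sphere 0 1"
  and sets_borel_sphere [simp]: "sets borel_sphere_measure = sets (restrict_space borel (sphere 0 1))"
  by (simp_all add: borel_sphere_measure_def space_restrict_space)

lemma space_sphere_measure [simp]: "space sphere_measure = sphere 0 1"
  by (simp add: sphere_measure_completion)

lemma radial_measurable:
  "(\<lambda>x::real^'n. x /\<^sub>R norm x) \<in> measurable (restrict_space borel (ball 0 1 - {0})) (restrict_space borel (sphere 0 1))"
proof (rule measurable_restrict_space2)
  show "(\<lambda>x::real^'n. x /\<^sub>R norm x) \<in> borel_measurable (restrict_space borel (ball 0 1 - {0}))"
    by (rule measurable_restrict_space1) measurable
qed (auto simp: space_restrict_space)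

lemma emeasure_borel_sphere:
  fixes A :: "(real^'n) set"
  assumes "A \<in> sets (restrict_space borel (sphere 0 1))"
  shows "sphere_cone A \<in> sets borel"
    "emeasure borel_sphere_measure A = ennreal (real CARD('n)) * emeasure lborel (sphere_cone A)"
proof -
  let ?B = "ball 0 1 - {0} :: (real^'n) set"
  let ?N = "restrict_space lborel ?B"
  have sN: "sets ?N = sets (restrict_space borel ?B)"
    by (simp add: sets_restrict_space)
  have B: "?B \<in> sets borel" by auto
  have cone: "sphere_cone A = (\<lambda>x. x /\<^sub>R norm x) -` A \<inter> space ?N"
    by (auto simp: sphere_cone_def space_restrict_space)
  have meas: "sphere_cone A \<in> sets (restrict_space borel ?B)"
    using measurable_sets[OF radial_measurable assms] cone by (simp add: space_restrict_space)
  then show "sphere_cone A \<in> sets borel"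
    using B by (simp add: sets_restrict_space_iff[of ?B borel])
  have rm: "(\<lambda>x::real^'n. x /\<^sub>R norm x) \<in> measurable (density ?N (\<lambda>_. ennreal (real CARD('n)))) (restrict_space borel (sphere 0 1))"
    using radial_measurable by (simp add: measurable_cong_sets[OF sN refl])
  have "emeasure borel_sphere_measure A = emeasure (density ?N (\<lambda>_. ennreal (real CARD('n)))) (sphere_cone A)"
    unfolding borel_sphere_measure_def cone using emeasure_distr[OF rm assms] by simp
  also have "\<dots> = ennreal (real CARD('n)) * emeasure ?N (sphere_cone A)"
    using meas sN by (simp add: emeasure_density_const)
  also have "emeasure ?N (sphere_cone A) = emeasure lborel (sphere_cone A)"
    by (rule emeasure_restrict_space) (use B in \<open>auto simp: sphere_cone_def\<close>)
  finally show "emeasure borel_sphere_measure A = ennreal (real CARD('n)) * emeasure lborel (sphere_cone A)" .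
qed

lemma emeasure_sphere_space:
  "emeasure (sphere_measure :: (real^'n) measure) (sphere 0 1) \<noteq> 0"
  "emeasure (sphere_measure :: (real^'n) measure) (sphere 0 1) \<noteq> \<infinity>"
proof -
  let ?S = "sphere 0 1 :: (real^'n) set"
  have S: "?S \<in> sets (restrict_space borel ?S)"
    by (simp add: sets_restrict_space_iff borel_closed)
  have "sphere_cone ?S = ball 0 1 - {0}"
    by (auto simp: sphere_cone_def)
  moreover have "emeasure lborel (ball (0::real^'n) 1 - {0}) = emeasure lborel (ball (0::real^'n) 1)"
    by (simp add: emeasure_Diff)
  ultimately have *: "emeasure sphere_measure ?S = ennreal (real CARD('n)) * emeasure lborel (ball (0::real^'n) 1)"
    using emeasure_borel_sphere(2)[OF S] S by (simp add: sphere_measure_completion)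
  show "emeasure sphere_measure ?S \<noteq> 0" "emeasure sphere_measure ?S \<noteq> \<infinity>"
    unfolding * using emeasure_lborel_ball_finite[of "0::real^'n" 1] emeasure_ball[of 1 "0::real^'n"]
      unit_ball_vol_nonzero[of "real CARD('n)"]
    by (auto simp: ennreal_mult_eq_top_iff)
qed

lemma finite_measure_sphere: "finite_measure (sphere_measure :: (real^'n) measure)"
  by (rule finite_measureI) (use emeasure_sphere_space in auto)

lemma orthogonal_transformation_measurable_sphere:
  fixes R :: "real^'n \<Rightarrow> real^'n"
  assumes R: "orthogonal_transformation R"
  shows "R \<in> measurable (restrict_space borel (sphere 0 1)) (restrict_space borel (sphere 0 1))"
proof (rule measurable_restrict_space2)
  have "R \<in> borel_measurable borel"
    using R by (intro borel_measurable_continuous_onI linear_continuous_on linear_conv_bounded_linear[THEN iffD1])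
      (simp add: orthogonal_transformation_def)
  then show "R \<in> borel_measurable (restrict_space borel (sphere 0 1))"
    by (rule measurable_restrict_space1)
qed (auto simp: space_restrict_space orthogonal_transformation_norm[OF R])

text \<open>An orthogonal map commutes with radial projection, so the cone over a preimage is the
  preimage of the cone, and invariance of Lebesgue measure applies.\<close>

lemma distr_borel_sphere_rotate:
  fixes R :: "real^'n \<Rightarrow> real^'n"
  assumes R: "orthogonal_transformation R"
  shows "distr borel_sphere_measure (restrict_space borel (sphere 0 1)) R = borel_sphere_measure"
proof (rule measure_eqI)
  fix A assume "A \<in> sets (distr borel_sphere_measure (restrict_space borel (sphere 0 1)) R)"
  then have A: "A \<in> sets (restrict_space borel (sphere 0 1))" by simp
  have Rm: "R \<in> measurable borel_sphere_measure (restrict_space borel (sphere 0 1))"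
    using orthogonal_transformation_measurable_sphere[OF R] by (simp cong: measurable_cong_sets)
  let ?A = "R -` A \<inter> sphere 0 1"
  have A': "?A \<in> sets (restrict_space borel (sphere 0 1))"
    using measurable_sets[OF Rm A] by simp
  have lin: "linear R" using R by (simp add: orthogonal_transformation_def)
  have "sphere_cone ?A = R -` sphere_cone A"
  proof -
    have n: "norm (R x) = norm x" for x by (rule orthogonal_transformation_norm[OF R])
    have z: "R x = 0 \<longleftrightarrow> x = 0" for x using n[of x] by (metis norm_eq_zero)
    show ?thesis
      by (auto simp: sphere_cone_def n z linear_scale[OF lin])
  qed
  then show "emeasure (distr borel_sphere_measure (restrict_space borel (sphere 0 1)) R) A
      = emeasure borel_sphere_measure A"
    using emeasure_borel_sphere[OF A] emeasure_borel_sphere(2)[OF A']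
      emeasure_lborel_orthogonal_vimage[OF R emeasure_borel_sphere(1)[OF A]]
    by (simp add: emeasure_distr[OF Rm A])
qed simp

text \<open>The integrand is Borel rather than measurable for the completion, so that its
  composition with \<open>R\<close> is measurable at once. Continuous functions and indicators of
  balls are all that will be rotated.\<close>

lemma sphere_integral_rotate:
  fixes R :: "real^'n \<Rightarrow> real^'n" and g :: "real^'n \<Rightarrow> real"
  assumes R: "orthogonal_transformation R" and g: "g \<in> borel_measurable (restrict_space borel (sphere 0 1))"
  shows "(LINT x|sphere_measure. g (R x)) = (LINT x|sphere_measure. g x)"
proof -
  have gm: "g \<in> borel_measurable borel_sphere_measure"
    using g by (simp cong: measurable_cong_sets)
  have Rm: "R \<in> measurable borel_sphere_measure (restrict_space borel (sphere 0 1))"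
    using orthogonal_transformation_measurable_sphere[OF R] by (simp cong: measurable_cong_sets)
  have "(LINT x|sphere_measure. g (R x)) = (LINT x|borel_sphere_measure. g (R x))"
    unfolding sphere_measure_completion using measurable_compose[OF Rm g] by (rule integral_completion)
  also have "\<dots> = (LINT x|distr borel_sphere_measure (restrict_space borel (sphere 0 1)) R. g x)"
    by (rule integral_distr[OF Rm g, symmetric])
  also have "\<dots> = (LINT x|borel_sphere_measure. g x)"
    by (simp add: distr_borel_sphere_rotate[OF R])
  also have "\<dots> = (LINT x|sphere_measure. g x)"
    unfolding sphere_measure_completion using gm by (rule integral_completion[symmetric])
  finally show ?thesis .
qed

section \<open>Polynomials on the sphere are sums of spherical harmonics\<close>

definition pmon :: "('n \<Rightarrow> nat) \<Rightarrow> real^'n \<Rightarrow> real" where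
  "pmon \<alpha> x = (\<Prod>i\<in>UNIV. x $ i ^ \<alpha> i)"

lemma pmon_update: "pmon (\<alpha>(j := m)) x = x $ j ^ m * (\<Prod>i\<in>UNIV - {j}. x $ i ^ \<alpha> i)"
proof -
  have "pmon (\<alpha>(j := m)) x = x $ j ^ m * (\<Prod>i\<in>UNIV - {j}. x $ i ^ (\<alpha>(j := m)) i)"
    unfolding pmon_def by (subst prod.remove[of UNIV j]) auto
  also have "(\<Prod>i\<in>UNIV - {j}. x $ i ^ (\<alpha>(j := m)) i) = (\<Prod>i\<in>UNIV - {j}. x $ i ^ \<alpha> i)"
    by (intro prod.cong) auto
  finally show ?thesis .
qed

lemma pmon_split: "pmon \<alpha> x = x $ j ^ \<alpha> j * (\<Prod>i\<in>UNIV - {j}. x $ i ^ \<alpha> i)"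
  using pmon_update[of \<alpha> j "\<alpha> j" x] by simp

lemma pmon_shift: "x $ j ^ k * pmon \<alpha> x = pmon (\<alpha>(j := \<alpha> j + k)) x"
  unfolding pmon_update pmon_split[of \<alpha> x j] by (simp add: power_add mult_ac)

lemma sum_update_nat: "sum (\<alpha>(j := m)) (UNIV :: 'n::finite set) + \<alpha> j = sum \<alpha> UNIV + (m :: nat)"
proof -
  have "sum (\<alpha>(j := m)) UNIV = m + (\<Sum>i\<in>UNIV - {j}. (\<alpha>(j := m)) i)"
    by (subst sum.remove[of UNIV j]) auto
  also have "(\<Sum>i\<in>UNIV - {j}. (\<alpha>(j := m)) i) = (\<Sum>i\<in>UNIV - {j}. \<alpha> i)"
    by (intro sum.cong) auto
  finally show ?thesis by (subst sum.remove[of UNIV j \<alpha>]) auto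
qed

lemma pmon_scale: "pmon \<alpha> (t *\<^sub>R x) = t ^ sum \<alpha> UNIV * pmon \<alpha> x"
  by (simp add: pmon_def power_mult_distrib prod.distrib power_sum)

lemma pmon_mult: "pmon \<alpha> x * pmon \<beta> x = pmon (\<lambda>i. \<alpha> i + \<beta> i) x"
  by (simp add: pmon_def power_add prod.distrib)

lemma polynomial_pmon:
  fixes \<alpha> :: "'n::finite \<Rightarrow> nat"
  shows "real_polynomial_function (pmon \<alpha>)"
proof -
  have "real_polynomial_function (\<lambda>x::real^'n. \<Prod>i\<in>I. x $ i ^ \<alpha> i)" if "finite I" for I
    using that
  proof (induction I rule: finite_induct)
    case (insert i I)
    have "real_polynomial_function (\<lambda>x::real^'n. x $ i)"
      by (intro real_polynomial_function.intros(1) bounded_linear_vec_nth)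
    then show ?case
      using insert by (simp add: real_polynomial_function.intros(4) real_polynomial_function_power)
  qed (simp add: real_polynomial_function.intros(2))
  then show ?thesis unfolding pmon_def[abs_def] by simp
qed

text \<open>\<open>hom_laplacian n p q\<close>: \<open>p\<close> is a homogeneous polynomial of degree \<open>n\<close> with Laplacian \<open>q\<close>.\<close>
inductive hom_laplacian :: "nat \<Rightarrow> (real^'n \<Rightarrow> real) \<Rightarrow> (real^'n \<Rightarrow> real) \<Rightarrow> bool" where
  mon: "sum \<alpha> UNIV = n \<Longrightarrow> hom_laplacian n (\<lambda>x. c * pmon \<alpha> x)
    (\<lambda>x. c * (\<Sum>i\<in>UNIV. real (\<alpha> i * (\<alpha> i - 1)) * pmon (\<alpha>(i := \<alpha> i - 2)) x))"
| add: "hom_laplacian n p q \<Longrightarrow> hom_laplacian n p' q' \<Longrightarrow>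
    hom_laplacian n (\<lambda>x. p x + p' x) (\<lambda>x. q x + q' x)"

lemma hom_laplacian_cmult:
  "hom_laplacian n p q \<Longrightarrow> hom_laplacian n (\<lambda>x. a * p x) (\<lambda>x. a * q x)"
proof (induction rule: hom_laplacian.induct)
  case (mon \<alpha> n c)
  then show ?case using hom_laplacian.mon[of \<alpha> n "a * c"] by (simp add: mult.assoc)
next
  case (add n p q p' q')
  then show ?case using hom_laplacian.add by (simp add: distrib_left) blast
qed

lemma hom_laplacian_zero: "hom_laplacian n (\<lambda>x::real^'n. 0) (\<lambda>x. 0)"
proof -
  obtain j :: 'n where True by simp
  have "sum ((\<lambda>_. 0)(j := n)) UNIV = n"
    using sum_update_nat[of "\<lambda>_. 0" j n] by simp
  from mon[OF this, of 0] show ?thesis by simp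
qed

lemma hom_laplacian_sum:
  assumes "\<And>j. j \<in> J \<Longrightarrow> hom_laplacian n (p j) (q j)"
  shows "hom_laplacian n (\<lambda>x. \<Sum>j\<in>J. p j x) (\<lambda>x. \<Sum>j\<in>J. q j x)"
  using assms
  by (induction J rule: infinite_finite_induct) (auto simp: hom_laplacian_zero hom_laplacian.add)

lemma hom_laplacian_diff:
  assumes "hom_laplacian n p q" "hom_laplacian n p' q'"
  shows "hom_laplacian n (\<lambda>x. p x - p' x) (\<lambda>x. q x - q' x)"
  using add[OF assms(1) hom_laplacian_cmult[OF assms(2), of "-1"]] by simp

lemma hom_laplacian_polynomial: "hom_laplacian n p q \<Longrightarrow> real_polynomial_function p"
  by (induction rule: hom_laplacian.induct)
    (auto intro: real_polynomial_function.intros polynomial_pmon)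

lemma hom_laplacian_homogeneous: "hom_laplacian n p q \<Longrightarrow> p (t *\<^sub>R x) = t ^ n * p x"
  by (induction rule: hom_laplacian.induct) (auto simp: pmon_scale algebra_simps)

text \<open>\<open>deriv\<close> is additive only where derivatives exist, so the induction carries
  derivatives as witnesses: first ones along the whole line, because they are differentiated again,
  second ones at 0 only.\<close>

lemma hom_laplacian_derivatives:
  fixes p q :: "real^'n \<Rightarrow> real"
  assumes "hom_laplacian n p q"
  shows "\<exists>D E. (\<forall>x i t. ((\<lambda>t. p (x + t *\<^sub>R axis i 1)) has_real_derivative D x i t) (at t)) \<and>
    (\<forall>x i. (D x i has_real_derivative E x i) (at 0)) \<and> (\<forall>x. q x = (\<Sum>i\<in>UNIV. E x i))"
  using assms
proof (induction rule: hom_laplacian.induct)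
  case (mon \<alpha> n c)
  define P where "P x i = (\<Prod>j\<in>UNIV - {i}. x $ j ^ \<alpha> j)" for x :: "real^'n" and i
  have line: "c * pmon \<alpha> (x + t *\<^sub>R axis i 1) = c * ((x $ i + t) ^ \<alpha> i * P x i)" for x i t
  proof -
    have "(\<Prod>j\<in>UNIV - {i}. (x + t *\<^sub>R axis i 1) $ j ^ \<alpha> j) = P x i"
      unfolding P_def by (intro prod.cong) (auto simp: axis_def)
    then show ?thesis by (simp add: pmon_split[of \<alpha> _ i] axis_def)
  qed
  show ?case
  proof (intro exI conjI allI)
    show "((\<lambda>t. c * pmon \<alpha> (x + t *\<^sub>R axis i 1)) has_real_derivative
        c * (real (\<alpha> i) * (x $ i + t) ^ (\<alpha> i - 1) * P x i)) (at t)" for x i t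
      unfolding line by (auto intro!: derivative_eq_intros)
    show "((\<lambda>t. c * (real (\<alpha> i) * (x $ i + t) ^ (\<alpha> i - 1) * P x i)) has_real_derivative
        c * (real (\<alpha> i) * (real (\<alpha> i - 1) * (x $ i) ^ (\<alpha> i - 1 - 1)) * P x i)) (at 0)" for x i
      by (auto intro!: derivative_eq_intros)
    show "c * (\<Sum>i\<in>UNIV. real (\<alpha> i * (\<alpha> i - 1)) * pmon (\<alpha>(i := \<alpha> i - 2)) x) =
        (\<Sum>i\<in>UNIV. c * (real (\<alpha> i) * (real (\<alpha> i - 1) * (x $ i) ^ (\<alpha> i - 1 - 1)) * P x i))" for x
      unfolding sum_distrib_left
      by (intro sum.cong refl) (simp add: pmon_update P_def numeral_2_eq_2)
  qed
next
  case (add n p q p' q')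
  then obtain D E D' E' where
    "\<And>x i t. ((\<lambda>t. p (x + t *\<^sub>R axis i 1)) has_real_derivative D x i t) (at t)"
    "\<And>x i. (D x i has_real_derivative E x i) (at 0)" "\<And>x. q x = (\<Sum>i\<in>UNIV. E x i)"
    "\<And>x i t. ((\<lambda>t. p' (x + t *\<^sub>R axis i 1)) has_real_derivative D' x i t) (at t)"
    "\<And>x i. (D' x i has_real_derivative E' x i) (at 0)" "\<And>x. q' x = (\<Sum>i\<in>UNIV. E' x i)"
    by metis
  then show ?case
    by (intro exI[of _ "\<lambda>x i t. D x i t + D' x i t"] exI[of _ "\<lambda>x i. E x i + E' x i"])
      (auto intro!: DERIV_add simp: sum.distrib)
qed

lemma hom_laplacian_laplacian:
  assumes "hom_laplacian n p q"
  shows "laplacian p x = q x"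
proof -
  obtain D E where D: "\<And>x i t. ((\<lambda>t. p (x + t *\<^sub>R axis i 1)) has_real_derivative D x i t) (at t)"
    and E: "\<And>x i. (D x i has_real_derivative E x i) (at 0)" and q: "\<And>x. q x = (\<Sum>i\<in>UNIV. E x i)"
    using hom_laplacian_derivatives[OF assms] by blast
  have "deriv (\<lambda>t. p (x + t *\<^sub>R axis i 1)) = D x i" for i
    by (rule ext) (rule DERIV_imp_deriv[OF D])
  then show ?thesis
    unfolding laplacian_def q by (simp add: DERIV_imp_deriv[OF E])
qed

lemma hom_laplacian_spherical_harmonic:
  assumes "hom_laplacian n p (\<lambda>x. 0)"
  shows "spherical_harmonic n p"
  unfolding spherical_harmonic_def homogeneous_poly_def harmonic_def
  using hom_laplacian_homogeneous[OF assms] hom_laplacian_laplacian[OF assms]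
    hom_laplacian_polynomial[OF assms] real_polynomial_function_eq by blast

lemma hom_laplacian_of_laplacian:
  "hom_laplacian n p q \<Longrightarrow> 2 \<le> n \<Longrightarrow> \<exists>r. hom_laplacian (n - 2) q r"
proof (induction rule: hom_laplacian.induct)
  case (mon \<alpha> n c)
  have "\<exists>r. hom_laplacian (n - 2) (\<lambda>x. real (\<alpha> i * (\<alpha> i - 1)) * pmon (\<alpha>(i := \<alpha> i - 2)) x) r" for i
  proof (cases "\<alpha> i < 2")
    \<comment> \<open>Natural subtraction truncates the exponent here, but the coefficient is
      0.\<close>
    case True
    then have "\<alpha> i * (\<alpha> i - 1) = 0" by auto
    then have "(\<lambda>x. real (\<alpha> i * (\<alpha> i - 1)) * pmon (\<alpha>(i := \<alpha> i - 2)) x) = (\<lambda>x. 0)"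
      by (simp only: of_nat_0 mult_zero_left)
    then show ?thesis using hom_laplacian_zero by metis
  next
    case False
    then have "sum (\<alpha>(i := \<alpha> i - 2)) UNIV = n - 2"
      using sum_update_nat[of \<alpha> i "\<alpha> i - 2"] mon by simp
    then show ?thesis using hom_laplacian.mon by blast
  qed
  then obtain r where "\<And>i. hom_laplacian (n - 2)
      (\<lambda>x. real (\<alpha> i * (\<alpha> i - 1)) * pmon (\<alpha>(i := \<alpha> i - 2)) x) (r i)"
    by metis
  then have "hom_laplacian (n - 2)
      (\<lambda>x. c * (\<Sum>i\<in>UNIV. real (\<alpha> i * (\<alpha> i - 1)) * pmon (\<alpha>(i := \<alpha> i - 2)) x))
      (\<lambda>x. c * (\<Sum>i\<in>UNIV. r i x))"
    by (intro hom_laplacian_cmult hom_laplacian_sum)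
  then show ?case by blast
next
  case (add n p q p' q')
  then show ?case using hom_laplacian.add by blast
qed

lemma hom_laplacian_low_degree: "hom_laplacian n p q \<Longrightarrow> n < 2 \<Longrightarrow> q = (\<lambda>x. 0)"
proof (induction rule: hom_laplacian.induct)
  case (mon \<alpha> n c)
  have "\<alpha> i < 2" for i
    using mon member_le_sum[of i UNIV \<alpha>] by simp
  then have "\<alpha> i * (\<alpha> i - 1) = 0" for i
    by (metis One_nat_def diff_is_0_eq less_2_cases_iff less_numeral_extra(3) mult_is_0 order_refl)
  then show ?case by (simp only: of_nat_0 mult_zero_left sum.neutral_const mult_zero_right)
qed simp

text \<open>With \<open>|x|^2\<close> split into the squares of the coordinates, the Laplacian of
  \<open>x $ j ^ 2 * pmon \<alpha> x\<close> is \<open>4 * \<alpha> j + 2\<close> times the monomial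
  plus \<open>x $ j ^ 2\<close> times its Laplacian. Summed over \<open>j\<close>, the coefficients
  give \<open>4 n + 2 CARD('n)\<close>.\<close>

lemma hom_laplacian_radius:
  fixes v q :: "real^'n \<Rightarrow> real"
  assumes "hom_laplacian n v q"
  shows "hom_laplacian (n + 2) (\<lambda>x. (x \<bullet> x) * v x)
    (\<lambda>x. 2 * (real CARD('n) + 2 * real n) * v x + (x \<bullet> x) * q x)"
  using assms
proof (induction rule: hom_laplacian.induct)
  case (mon \<alpha> n c)
  define q where "q x = (\<Sum>i\<in>UNIV. real (\<alpha> i * (\<alpha> i - 1)) * pmon (\<alpha>(i := \<alpha> i - 2)) x)" for x :: "real^'n"
  have sq: "(x \<bullet> x) * y = (\<Sum>j\<in>UNIV. x $ j ^ 2 * y)" for x :: "real^'n" and y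
    by (simp add: inner_vec_def sum_distrib_right power2_eq_square)
  have step: "hom_laplacian (n + 2) (\<lambda>x. x $ j ^ 2 * (c * pmon \<alpha> x))
      (\<lambda>x. c * (real (4 * \<alpha> j + 2) * pmon \<alpha> x + x $ j ^ 2 * q x))" for j
  proof -
    let ?\<beta> = "\<alpha>(j := \<alpha> j + 2)"
    have deg: "sum ?\<beta> UNIV = n + 2"
      using sum_update_nat[of \<alpha> j "\<alpha> j + 2"] mon by simp
    have "(\<Sum>i\<in>UNIV. real (?\<beta> i * (?\<beta> i - 1)) * pmon (?\<beta>(i := ?\<beta> i - 2)) x)
        = real (4 * \<alpha> j + 2) * pmon \<alpha> x + x $ j ^ 2 * q x" for x
    proof -
      have other: "real (?\<beta> i * (?\<beta> i - 1)) * pmon (?\<beta>(i := ?\<beta> i - 2)) x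
          = x $ j ^ 2 * (real (\<alpha> i * (\<alpha> i - 1)) * pmon (\<alpha>(i := \<alpha> i - 2)) x)" if "i \<noteq> j" for i
      proof -
        have "?\<beta>(i := ?\<beta> i - 2) = (\<alpha>(i := \<alpha> i - 2))(j := (\<alpha>(i := \<alpha> i - 2)) j + 2)"
          using that by auto
        then have "pmon (?\<beta>(i := ?\<beta> i - 2)) x = x $ j ^ 2 * pmon (\<alpha>(i := \<alpha> i - 2)) x"
          by (simp only: pmon_shift)
        then show ?thesis using that by simp
      qed
      have self: "x $ j ^ 2 * (real (\<alpha> j * (\<alpha> j - 1)) * pmon (\<alpha>(j := \<alpha> j - 2)) x)
          = real (\<alpha> j * (\<alpha> j - 1)) * pmon \<alpha> x"
      proof (cases "\<alpha> j < 2")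
        case True
        then have "\<alpha> j * (\<alpha> j - 1) = 0" by auto
        then show ?thesis by (simp only: of_nat_0 mult_zero_left mult_zero_right)
      next
        case False
        then have "x $ j ^ 2 * x $ j ^ (\<alpha> j - 2) = x $ j ^ \<alpha> j"
          by (metis le_add_diff_inverse not_less power_add)
        then show ?thesis unfolding pmon_update pmon_split[of \<alpha> x j] by (simp add: mult_ac)
      qed
      have "(\<Sum>i\<in>UNIV. real (?\<beta> i * (?\<beta> i - 1)) * pmon (?\<beta>(i := ?\<beta> i - 2)) x)
          = real (?\<beta> j * (?\<beta> j - 1)) * pmon (?\<beta>(j := ?\<beta> j - 2)) x
            + (\<Sum>i\<in>UNIV - {j}. real (?\<beta> i * (?\<beta> i - 1)) * pmon (?\<beta>(i := ?\<beta> i - 2)) x)"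
        by (rule sum.remove) auto
      also have "(\<Sum>i\<in>UNIV - {j}. real (?\<beta> i * (?\<beta> i - 1)) * pmon (?\<beta>(i := ?\<beta> i - 2)) x)
          = (\<Sum>i\<in>UNIV - {j}. x $ j ^ 2 * (real (\<alpha> i * (\<alpha> i - 1)) * pmon (\<alpha>(i := \<alpha> i - 2)) x))"
        by (intro sum.cong refl other) auto
      also have "real (?\<beta> j * (?\<beta> j - 1)) * pmon (?\<beta>(j := ?\<beta> j - 2)) x
          = real ((\<alpha> j + 2) * (\<alpha> j + 1)) * pmon \<alpha> x"
        by simp
      also have "real ((\<alpha> j + 2) * (\<alpha> j + 1)) * pmon \<alpha> x
          + (\<Sum>i\<in>UNIV - {j}. x $ j ^ 2 * (real (\<alpha> i * (\<alpha> i - 1)) * pmon (\<alpha>(i := \<alpha> i - 2)) x))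
          = real ((\<alpha> j + 2) * (\<alpha> j + 1)) * pmon \<alpha> x - real (\<alpha> j * (\<alpha> j - 1)) * pmon \<alpha> x
          + x $ j ^ 2 * q x"
        unfolding q_def sum_distrib_left
        using sum.remove[of UNIV j "\<lambda>i. x $ j ^ 2 * (real (\<alpha> i * (\<alpha> i - 1)) * pmon (\<alpha>(i := \<alpha> i - 2)) x)"]
        unfolding self by simp
      also have "real ((\<alpha> j + 2) * (\<alpha> j + 1)) = real (\<alpha> j * (\<alpha> j - 1)) + real (4 * \<alpha> j + 2)"
        by (cases "\<alpha> j") (auto simp: algebra_simps)
      also have "(real (\<alpha> j * (\<alpha> j - 1)) + real (4 * \<alpha> j + 2)) * pmon \<alpha> x
          - real (\<alpha> j * (\<alpha> j - 1)) * pmon \<alpha> x + x $ j ^ 2 * q x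
          = real (4 * \<alpha> j + 2) * pmon \<alpha> x + x $ j ^ 2 * q x"
        by (simp add: algebra_simps)
      finally show ?thesis .
    qed
    moreover have "(\<lambda>x. x $ j ^ 2 * (c * pmon \<alpha> x)) = (\<lambda>x. c * pmon ?\<beta> x)"
      by (simp only: mult.left_commute[of _ c] pmon_shift)
    ultimately show ?thesis using hom_laplacian.mon[OF deg, of c] by (simp only:)
  qed
  have total: "(\<Sum>j\<in>UNIV. c * (real (4 * \<alpha> j + 2) * pmon \<alpha> x + x $ j ^ 2 * q x))
      = 2 * (real CARD('n) + 2 * real n) * (c * pmon \<alpha> x) + (x \<bullet> x) * (c * q x)" for x :: "real^'n"
  proof -
    have "(\<Sum>j\<in>UNIV. real (4 * \<alpha> j + 2)) = 2 * (real CARD('n) + 2 * real n)"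
      using mon by (simp add: sum.distrib sum_distrib_left[symmetric] flip: of_nat_sum)
    then show ?thesis
      unfolding sq by (simp add: distrib_left sum.distrib sum_distrib_left[symmetric] mult_ac
        flip: sum_distrib_right)
  qed
  show ?case
    unfolding q_def[symmetric] unfolding total[symmetric] unfolding sq by (rule hom_laplacian_sum[OF step])
next
  case (add n p q p' q')
  then show ?case using hom_laplacian.add[OF add.IH] by (simp add: algebra_simps)
qed

text \<open>Since \<open>\<Delta>(|x|\<^sup>2 v)\<close> is a positive multiple of \<open>v\<close> plus \<open>|x|\<^sup>2 \<Delta>v\<close>, the ansatz
  \<open>s = (q - |x|\<^sup>2 v) / l\<close> turns the equation into one of the same shape for \<open>\<Delta>q\<close>, two degrees lower.\<close>
lemma hom_laplacian_solve:
  fixes q q' :: "real^'n \<Rightarrow> real"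
  assumes "hom_laplacian n q q'" "l > 0"
  shows "\<exists>s s'. hom_laplacian n s s' \<and> (\<forall>x. l * s x + (x \<bullet> x) * s' x = q x)"
  using assms
proof (induction n arbitrary: q q' l rule: less_induct)
  case (less n)
  show ?case
  proof (cases "n < 2")
    case True
    have "hom_laplacian n (\<lambda>x. 1 / l * q x) (\<lambda>x. 1 / l * q' x)"
      by (rule hom_laplacian_cmult[OF less.prems(1)])
    then show ?thesis using hom_laplacian_low_degree[OF less.prems(1) True] less.prems(2)
      by (intro exI[of _ "\<lambda>x. 1 / l * q x"] exI[of _ "\<lambda>x. 1 / l * q' x"]) auto
  next
    case False
    then have n: "n - 2 < n" "n - 2 + 2 = n" "2 \<le> n" by auto
    define k where "k = 2 * (real CARD('n) + 2 * real (n - 2))"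
    have k: "l + k > 0" using less.prems(2) by (simp add: k_def add_pos_nonneg)
    obtain r where "hom_laplacian (n - 2) q' r"
      using hom_laplacian_of_laplacian[OF less.prems(1) n(3)] by blast
    then obtain v v' where v: "hom_laplacian (n - 2) v v'"
      "\<And>x. (l + k) * v x + (x \<bullet> x) * v' x = q' x"
      using less.IH[OF n(1) _ k] by blast
    have "hom_laplacian n (\<lambda>x. 1 / l * (q x - (x \<bullet> x) * v x))
        (\<lambda>x. 1 / l * (q' x - (k * v x + (x \<bullet> x) * v' x)))"
      using hom_laplacian_radius[OF v(1)] unfolding n k_def[symmetric]
      by (intro hom_laplacian_cmult hom_laplacian_diff less.prems(1))
    moreover have "1 / l * (q' x - (k * v x + (x \<bullet> x) * v' x)) = v x" for x
      using less.prems(2) by (simp add: v(2)[symmetric] field_simps)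
    ultimately have "hom_laplacian n (\<lambda>x. 1 / l * (q x - (x \<bullet> x) * v x)) v"
      by simp
    then show ?thesis using less.prems(2)
      by (intro exI[of _ "\<lambda>x. 1 / l * (q x - (x \<bullet> x) * v x)"] exI[of _ v]) auto
  qed
qed

text \<open>Equality is asked on the sphere only. There the factor \<open>|x|^2\<close> is 1, so
  that components of different degrees can represent a homogeneous polynomial.\<close>

definition harmonic_sum :: "nat \<Rightarrow> (real^'n \<Rightarrow> real) \<Rightarrow> bool" where
  "harmonic_sum N h \<longleftrightarrow> (\<exists>Y. (\<forall>k. hom_laplacian k (Y k) (\<lambda>x. 0)) \<and>
     (\<forall>x\<in>sphere 0 1. h x = (\<Sum>k\<le>N. Y k x)))"

lemma harmonic_sum_add:
  assumes "harmonic_sum N h" "harmonic_sum N h'"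
  shows "harmonic_sum N (\<lambda>x. h x + h' x)"
proof -
  obtain Y Y' where Y: "\<And>k. hom_laplacian k (Y k) (\<lambda>x. 0)" "\<And>x. x \<in> sphere 0 1 \<Longrightarrow> h x = (\<Sum>k\<le>N. Y k x)"
    "\<And>k. hom_laplacian k (Y' k) (\<lambda>x. 0)" "\<And>x. x \<in> sphere 0 1 \<Longrightarrow> h' x = (\<Sum>k\<le>N. Y' k x)"
    using assms unfolding harmonic_sum_def by blast
  show ?thesis unfolding harmonic_sum_def
  proof (intro exI[of _ "\<lambda>k x. Y k x + Y' k x"] conjI allI ballI)
    show "hom_laplacian k (\<lambda>x. Y k x + Y' k x) (\<lambda>x. 0)" for k
      using add[OF Y(1,3), of k] by simp
  qed (simp add: Y sum.distrib)
qed

lemma harmonic_sum_mono: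
  assumes "harmonic_sum N h" "N \<le> N'"
  shows "harmonic_sum N' h"
proof -
  obtain Y where Y: "\<And>k. hom_laplacian k (Y k) (\<lambda>x. 0)" "\<And>x. x \<in> sphere 0 1 \<Longrightarrow> h x = (\<Sum>k\<le>N. Y k x)"
    using assms unfolding harmonic_sum_def by blast
  show ?thesis unfolding harmonic_sum_def
  proof (intro exI[of _ "\<lambda>k. if k \<le> N then Y k else (\<lambda>x. 0)"] conjI allI ballI)
    show "hom_laplacian k (if k \<le> N then Y k else (\<lambda>x. 0)) (\<lambda>x. 0)" for k
      using Y(1) hom_laplacian_zero by auto
    show "h x = (\<Sum>k\<le>N'. (if k \<le> N then Y k else (\<lambda>x. 0)) x)" if "x \<in> sphere 0 1" for x
    proof -
      have "(\<Sum>k\<le>N'. (if k \<le> N then Y k else (\<lambda>x. 0)) x) = (\<Sum>k\<le>N. Y k x)"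
        using assms(2) by (intro sum.mono_neutral_cong_right) auto
      then show ?thesis using Y(2)[OF that] by simp
    qed
  qed
qed

lemma harmonic_sum_harmonic:
  assumes "hom_laplacian n h (\<lambda>x. 0)"
  shows "harmonic_sum n h"
  unfolding harmonic_sum_def
proof (intro exI[of _ "\<lambda>k. if k = n then h else (\<lambda>x. 0)"] conjI allI ballI)
  show "hom_laplacian k (if k = n then h else (\<lambda>x. 0)) (\<lambda>x. 0)" for k
    using assms hom_laplacian_zero by auto
  show "h x = (\<Sum>k\<le>n. (if k = n then h else (\<lambda>x. 0)) x)" for x
    by (subst sum.remove[of _ n]) auto
qed

text \<open>The classical decomposition: \<open>v\<close> is chosen such that \<open>|x|^2 v\<close>
  has the same Laplacian as \<open>q\<close>. Then \<open>q - |x|^2 v\<close> is harmonic, and on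
  the sphere \<open>q\<close> is this harmonic plus \<open>v\<close>, which is two degrees
  lower.\<close>

lemma harmonic_sum_homogeneous:
  fixes q q' :: "real^'n \<Rightarrow> real"
  shows "hom_laplacian n q q' \<Longrightarrow> harmonic_sum n q"
proof (induction n arbitrary: q q' rule: less_induct)
  case (less n)
  show ?case
  proof (cases "n < 2")
    case True
    then show ?thesis
      using less.prems hom_laplacian_low_degree[OF less.prems True] harmonic_sum_harmonic by simp
  next
    case False
    then have n: "n - 2 < n" "n - 2 + 2 = n" "2 \<le> n" by auto
    define k where "k = 2 * (real CARD('n) + 2 * real (n - 2))"
    have k: "k > 0" by (simp add: k_def add_pos_nonneg)
    obtain r where "hom_laplacian (n - 2) q' r"
      using hom_laplacian_of_laplacian[OF less.prems n(3)] by blast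
    then obtain v v' where v: "hom_laplacian (n - 2) v v'" "\<And>x. k * v x + (x \<bullet> x) * v' x = q' x"
      using hom_laplacian_solve[OF _ k] by blast
    have "hom_laplacian n (\<lambda>x. q x - (x \<bullet> x) * v x) (\<lambda>x. q' x - (k * v x + (x \<bullet> x) * v' x))"
      using hom_laplacian_radius[OF v(1)] unfolding n k_def[symmetric]
      by (intro hom_laplacian_diff less.prems)
    then have "harmonic_sum n (\<lambda>x. q x - (x \<bullet> x) * v x)"
      unfolding v(2) by (intro harmonic_sum_harmonic) simp
    moreover have "harmonic_sum n v"
      using harmonic_sum_mono[OF less.IH[OF n(1) v(1)]] n by simp
    ultimately have "harmonic_sum n (\<lambda>x. q x - (x \<bullet> x) * v x + v x)"
      by (rule harmonic_sum_add)
    moreover have "q x - (x \<bullet> x) * v x + v x = q x" if "x \<in> sphere 0 1" for x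
      using that by (simp add: dot_square_norm)
    ultimately show ?thesis unfolding harmonic_sum_def by metis
  qed
qed

section \<open>Polynomials of bounded degree\<close>

inductive degree_le :: "nat \<Rightarrow> (real^'n \<Rightarrow> real) \<Rightarrow> bool" where
  mon: "sum \<alpha> UNIV \<le> n \<Longrightarrow> degree_le n (\<lambda>x. c * pmon \<alpha> x)"
| add: "degree_le n p \<Longrightarrow> degree_le n p' \<Longrightarrow> degree_le n (\<lambda>x. p x + p' x)"

lemma degree_le_harmonic_sum: "degree_le n p \<Longrightarrow> harmonic_sum n p"
proof (induction rule: degree_le.induct)
  case (mon \<alpha> n c)
  then show ?case
    using harmonic_sum_mono[OF harmonic_sum_homogeneous[OF hom_laplacian.mon[OF refl]]] by blast
qed (rule harmonic_sum_add)

lemma degree_le_mono: "degree_le n p \<Longrightarrow> n \<le> m \<Longrightarrow> degree_le m p"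
  by (induction rule: degree_le.induct) (auto intro: degree_le.intros)

lemma degree_le_pmon_mult:
  "degree_le n p \<Longrightarrow> degree_le (n + sum \<alpha> UNIV) (\<lambda>x. c * pmon \<alpha> x * p x)"
proof (induction rule: degree_le.induct)
  case (mon \<beta> n a)
  have "(\<lambda>x. c * pmon \<alpha> x * (a * pmon \<beta> x)) = (\<lambda>x. (c * a) * pmon (\<lambda>i. \<alpha> i + \<beta> i) x)"
    by (simp add: pmon_mult[symmetric] mult_ac)
  moreover have "sum (\<lambda>i. \<alpha> i + \<beta> i) UNIV \<le> n + sum \<alpha> UNIV"
    using mon by (simp add: sum.distrib)
  ultimately show ?case using degree_le.mon by metis
next
  case (add n p p')
  then show ?case using degree_le.add by (simp add: distrib_left) blast
qed

lemma degree_le_mult: "degree_le n p \<Longrightarrow> degree_le m q \<Longrightarrow> degree_le (n + m) (\<lambda>x. p x * q x)"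
proof (induction rule: degree_le.induct)
  case (mon \<alpha> n c)
  then show ?case
    using degree_le_mono[OF degree_le_pmon_mult[of m q \<alpha> c]] by (simp add: add.commute)
next
  case (add n p p')
  then show ?case using degree_le.add by (simp add: distrib_right)
qed

lemma degree_le_const: "degree_le n (\<lambda>x. c)"
  using degree_le.mon[of "\<lambda>_. 0" n c] by (simp add: pmon_def)

lemma degree_le_nth: "degree_le 1 (\<lambda>x. x $ i)"
proof -
  have "sum ((\<lambda>_. 0)(i := 1)) UNIV = (1::nat)"
    using sum_update_nat[of "\<lambda>_. 0" i 1] by simp
  moreover have "pmon ((\<lambda>_. 0)(i := 1)) = (\<lambda>x. x $ i)"
    by (rule ext) (simp add: pmon_update)
  ultimately show ?thesis using degree_le.mon[of "(\<lambda>_. 0)(i := 1)" 1 1] by simp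
qed

lemma degree_le_sum:
  "(\<And>j. j \<in> J \<Longrightarrow> degree_le n (p j)) \<Longrightarrow> degree_le n (\<lambda>x. \<Sum>j\<in>J. p j x)"
  by (induction J rule: infinite_finite_induct) (auto simp: degree_le_const degree_le.add)

lemma degree_le_prod:
  assumes "finite J" "\<And>j. j \<in> J \<Longrightarrow> degree_le (e j) (p j)"
  shows "degree_le (sum e J) (\<lambda>x. \<Prod>j\<in>J. p j x)"
  using assms by (induction J rule: finite_induct) (auto simp: degree_le_const degree_le_mult)

text \<open>Links the polynomials delivered by Stone-Weierstrass to combinations of monomials and
  thereby to spherical harmonics.\<close>

lemma real_polynomial_degree_le:
  fixes p :: "real^'n \<Rightarrow> real"
  shows "real_polynomial_function p \<Longrightarrow> \<exists>n. degree_le n p"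
proof (induction rule: real_polynomial_function.induct)
  case (linear f)
  have lin: "linear f" using linear by (rule bounded_linear.linear)
  have "f x = (\<Sum>i\<in>UNIV. f (axis i 1) * x $ i)" for x
    by (subst basis_expansion[of x, symmetric], unfold scalar_mult_eq_scaleR)
      (simp add: linear_sum[OF lin] linear_scale[OF lin] mult.commute)
  moreover have "degree_le 1 (\<lambda>x. f (axis i 1) * x $ i)" for i
    using degree_le_mult[OF degree_le_const[of 0] degree_le_nth] by simp
  ultimately show ?case using degree_le_sum[of UNIV 1 "\<lambda>i x. f (axis i 1) * x $ i"] by (metis (no_types, lifting) ext)
next
  case (add f g)
  then obtain n m where "degree_le n f" "degree_le m g" by blast
  then have "degree_le (max n m) f" "degree_le (max n m) g"
    by (auto intro: degree_le_mono)
  then show ?case using degree_le.add by blast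
qed (auto intro: degree_le_const degree_le_mult)

section \<open>Dot-product kernels\<close>

lemma sphere_measurable_borel:
  fixes g :: "real^'n \<Rightarrow> 'b::topological_space"
  assumes "g \<in> borel_measurable (restrict_space borel (sphere 0 1))"
  shows "g \<in> borel_measurable sphere_measure"
proof -
  have "g \<in> borel_measurable borel_sphere_measure"
    using assms by (simp cong: measurable_cong_sets)
  then show ?thesis unfolding sphere_measure_completion by (rule measurable_completion)
qed

text \<open>General in \<open>M\<close> and \<open>f\<close> so as to cover the weighted measure and
  the kernel of \<open>-f\<close>.\<close>

lemma kernel_operator_sphere:
  fixes M :: "(real^'n) measure" and f :: "real \<Rightarrow> real"
  assumes M: "finite_measure M" "sets M = sets sphere_measure"
    and f: "continuous_on {-1..1} f" "\<And>s. s \<in> {-1..1} \<Longrightarrow> \<bar>f s\<bar> \<le> B"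
  shows "kernel_operator M (\<lambda>x y. f (x \<bullet> y)) B"
proof -
  have space: "space M = sphere 0 1"
    using sets_eq_imp_space_eq[OF M(2)] by simp
  have meas: "g \<in> borel_measurable M" if "g \<in> borel_measurable (restrict_space borel (sphere 0 1))"
    for g :: "real^'n \<Rightarrow> 'b::topological_space"
    using sphere_measurable_borel[OF that] M(2) by (simp cong: measurable_cong_sets)
  have inner: "x \<bullet> y \<in> {-1..1}" if "x \<in> sphere 0 1" "y \<in> sphere 0 1" for x y :: "real^'n"
    using Cauchy_Schwarz_ineq2[of x y] that by (auto simp: abs_le_iff)
  interpret finite_measure M by fact
  show ?thesis
  proof
    show "compact (space M)" by (simp add: space)
    show "g \<in> borel_measurable M" if "continuous_on (space M) g" for g :: "real^'n \<Rightarrow> real"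
      using that unfolding space by (intro meas borel_measurable_continuous_on_restrict)
    show "(\<lambda>(x, y). f (x \<bullet> y)) \<in> borel_measurable (M \<Otimes>\<^sub>M M)"
    proof -
      have id: "(\<lambda>x. x) \<in> borel_measurable M"
        by (intro meas borel_measurable_continuous_on_restrict continuous_on_id)
      have [measurable]: "fst \<in> borel_measurable (M \<Otimes>\<^sub>M M)" "snd \<in> borel_measurable (M \<Otimes>\<^sub>M M)"
        using measurable_compose[OF measurable_fst id] measurable_compose[OF measurable_snd id] by auto
      \<comment> \<open>Clamping the argument extends \<open>f\<close> continuously to the real
        line, so that it can be composed with the inner product as a Borel function; on the sphere
        nothing changes.\<close>
      define f' where "f' s = f (max (-1) (min 1 s))" for s
      have "continuous_on UNIV f'"
        unfolding f'_def by (rule continuous_on_compose2[OF f(1)]) (auto intro!: continuous_intros)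
      then have [measurable]: "f' \<in> borel_measurable borel"
        by (rule borel_measurable_continuous_onI)
      have "(\<lambda>p. f' (fst p \<bullet> snd p)) \<in> borel_measurable (M \<Otimes>\<^sub>M M)" by measurable
      moreover have "f' (fst p \<bullet> snd p) = (case p of (x, y) \<Rightarrow> f (x \<bullet> y))" if "p \<in> space (M \<Otimes>\<^sub>M M)" for p
        using that inner[of "fst p" "snd p"] by (auto simp: space_pair_measure space f'_def)
      ultimately show ?thesis by (subst measurable_cong[symmetric])
    qed
    show "\<bar>f (x \<bullet> y)\<bar> \<le> B" if "x \<in> space M" "y \<in> space M" for x y
      using that inner f(2) by (simp add: space)
    show "0 \<le> B" using f(2)[of 0] by simp
    show "f (x \<bullet> y) = f (y \<bullet> x)" for x y :: "real^'n" by (simp add: inner_commute)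
    show "\<exists>d>0. \<forall>x'\<in>space M. norm (x - x') < d \<longrightarrow> (\<forall>y\<in>space M. \<bar>f (x \<bullet> y) - f (x' \<bullet> y)\<bar> \<le> e)"
      if x: "x \<in> space M" and e: "e > 0" for x e
    proof -
      obtain d where d: "d > 0" "\<And>s s'. s \<in> {-1..1} \<Longrightarrow> s' \<in> {-1..1} \<Longrightarrow> dist s' s < d \<Longrightarrow> dist (f s') (f s) < e"
        using compact_uniformly_continuous[OF f(1)] e unfolding uniformly_continuous_on_def by (metis compact_Icc)
      have "\<bar>f (x \<bullet> y) - f (x' \<bullet> y)\<bar> \<le> e"
        if "x' \<in> space M" "norm (x - x') < d" "y \<in> space M" for x' y
      proof -
        have "\<bar>x \<bullet> y - x' \<bullet> y\<bar> \<le> norm (x - x') * norm y"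
          using Cauchy_Schwarz_ineq2[of "x - x'" y] by (simp add: inner_diff_left)
        then have "dist (x \<bullet> y) (x' \<bullet> y) < d"
          using that by (simp add: space dist_real_def)
        then have "dist (f (x \<bullet> y)) (f (x' \<bullet> y)) < e"
          using x that inner by (intro d(2)) (auto simp: space)
        then show ?thesis by (simp add: dist_real_def)
      qed
      then show ?thesis using d(1) by blast
    qed
  qed
qed

text \<open>Rotations act transitively on the sphere in dimension at least 2, and by compactness
  finitely many of them suffice.\<close>

lemma sphere_cover:
  fixes z :: "real^'n"
  assumes "CARD('n) \<ge> 2" "z \<in> sphere 0 1" "r > 0"
  obtains \<R> :: "(real^'n \<Rightarrow> real^'n) set" where "finite \<R>" "\<R> \<noteq> {}" "\<And>R. R \<in> \<R> \<Longrightarrow> orthogonal_transformation R"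
    "\<And>y. y \<in> sphere 0 1 \<Longrightarrow> \<exists>R\<in>\<R>. y \<in> ball (R z) r"
proof -
  have "\<exists>R. orthogonal_transformation R \<and> R z = y" if y: "y \<in> sphere 0 1" for y :: "real^'n"
  proof -
    have "norm z = norm y" using assms(2) y by simp
    then obtain R where "orthogonal_transformation R" "det (matrix R) = 1" "R z = y"
      by (rule rotation_exists[OF assms(1)])
    then show ?thesis by blast
  qed
  then have "\<forall>y\<in>sphere (0::real^'n) 1. \<exists>R. orthogonal_transformation R \<and> R z = y"
    by blast
  from bchoice[OF this] obtain \<rho> where
    \<rho>: "\<And>y::real^'n. y \<in> sphere 0 1 \<Longrightarrow> orthogonal_transformation (\<rho> y) \<and> \<rho> y z = y"
    by blast
  obtain Y :: "(real^'n) set" where Y: "finite Y" "Y \<subseteq> sphere 0 1" "sphere 0 1 \<subseteq> (\<Union>y\<in>Y. ball y r)"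
  proof (rule compactE_image[of "sphere 0 1 :: (real^'n) set" "sphere 0 1" "\<lambda>y. ball y r"])
    show "sphere 0 1 \<subseteq> (\<Union>y\<in>sphere 0 1. ball (y::real^'n) r)" using assms(3) by force
  qed auto
  show ?thesis
  proof (rule that[of "\<rho> ` Y"])
    show "\<rho> ` Y \<noteq> {}" using Y(3) assms(2) by auto
    show "\<exists>R\<in>\<rho> ` Y. y \<in> ball (R z) r" if y: "y \<in> sphere 0 1" for y :: "real^'n"
    proof -
      obtain y' where y': "y' \<in> Y" "y \<in> ball y' r" using Y(3) y by blast
      then have "\<rho> y' z = y'" using \<rho> Y(2) by blast
      then show ?thesis using y' by (intro bexI[of _ "\<rho> y'"]) auto
    qed
  qed (use Y \<rho> in auto)
qed

lemma orthogonal_transformation_ball: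
  fixes R :: "'a::euclidean_space \<Rightarrow> 'a"
  assumes "orthogonal_transformation R"
  shows "R x \<in> ball (R z) r \<longleftrightarrow> x \<in> ball z r"
  using assms by (simp add: orthogonal_transformation_isometry)

lemma indicator_ball_sphere_measurable:
  "(\<lambda>x. indicator (ball z r) x :: real) \<in> borel_measurable (restrict_space borel (sphere 0 1))"
  by (intro measurable_restrict_space1 borel_measurable_indicator) auto

lemma integrable_ball_sphere:
  fixes z :: "real^'n"
  shows "integrable sphere_measure (\<lambda>x. indicator (ball z r) x :: real)"
proof (rule finite_measure.integrable_const_bound[OF finite_measure_sphere, of _ 1])
  show "(\<lambda>x. indicator (ball z r) x :: real) \<in> borel_measurable sphere_measure"
    by (intro sphere_measurable_borel indicator_ball_sphere_measurable)
qed (simp add: indicator_def)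

lemma measure_sphere_pos: "measure (sphere_measure :: (real^'n) measure) (sphere 0 1) > 0"
  using emeasure_sphere_space[where 'n = 'n]
  by (simp add: measure_def enn2real_positive_iff zero_less_iff_neq_zero less_top[symmetric])

text \<open>Finitely many rotated copies of the ball, all with the same integral, cover a sphere of
  positive measure.\<close>

lemma sphere_ball_integral_pos:
  fixes z :: "real^'n"
  assumes "CARD('n) \<ge> 2" "z \<in> sphere 0 1" "r > 0"
  shows "(LINT x|sphere_measure. indicator (ball z r) x) > (0::real)"
proof -
  interpret finite_measure "sphere_measure :: (real^'n) measure" by (rule finite_measure_sphere)
  obtain \<R> :: "(real^'n \<Rightarrow> real^'n) set" where \<R>: "finite \<R>" "\<And>R. R \<in> \<R> \<Longrightarrow> orthogonal_transformation R"
    "\<And>y. y \<in> sphere 0 1 \<Longrightarrow> \<exists>R\<in>\<R>. y \<in> ball (R z) r"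
    using sphere_cover[OF assms] by metis
  let ?I = "\<lambda>(z :: real^'n) x. indicator (ball z r) x :: real"
  note int = integrable_ball_sphere
  have rot: "(LINT x|sphere_measure. ?I (R z) x) = (LINT x|sphere_measure. ?I z x)" if "R \<in> \<R>" for R
  proof -
    have "?I (R z) (R x) = ?I z x" for x
      using orthogonal_transformation_ball[OF \<R>(2)[OF that]] by (simp add: indicator_def del: mem_ball)
    then show ?thesis
      using sphere_integral_rotate[OF \<R>(2)[OF that] indicator_ball_sphere_measurable[of "R z" r]] by simp
  qed
  have "0 < (LINT x|(sphere_measure :: (real^'n) measure). 1 :: real)"
    using measure_sphere_pos[where 'n = 'n] by simp
  also have "\<dots> \<le> (LINT x|sphere_measure. (\<Sum>R\<in>\<R>. ?I (R z) x))"
  proof (rule integral_mono)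
    show "1 \<le> (\<Sum>R\<in>\<R>. ?I (R z) x)" if x: "x \<in> space sphere_measure" for x
    proof -
      obtain R where R: "R \<in> \<R>" "x \<in> ball (R z) r" using \<R>(3)[of x] x by auto
      then have "?I (R z) x \<le> (\<Sum>R\<in>\<R>. ?I (R z) x)"
        by (intro member_le_sum \<R>(1)) auto
      then show ?thesis using R(2) by (simp add: indicator_def)
    qed
  qed (auto intro!: Bochner_Integration.integrable_sum int)
  also have "\<dots> = (\<Sum>R\<in>\<R>. (LINT x|sphere_measure. ?I (R z) x))"
    by (intro Bochner_Integration.integral_sum int)
  also have "\<dots> = (\<Sum>R\<in>\<R>. (LINT x|sphere_measure. ?I z x))"
    by (rule sum.cong[OF refl rot])
  also have "\<dots> = real (card \<R>) * (LINT x|sphere_measure. ?I z x)"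
    by (rule sum_constant)
  finally show ?thesis by (simp add: zero_less_mult_iff)
qed

text \<open>\<open>area\<close> is the total surface measure. The sequence \<mu> refers to the
  normalized measure, so the eigenvalues of the operator for \<sigma> itself are
  \<open>area * \<mu> n\<close>.\<close>

locale dot_kernel =
  fixes f :: "real \<Rightarrow> real" and B area :: real and \<mu> :: "nat \<Rightarrow> real" and K :: "real^'n \<Rightarrow> real^'n \<Rightarrow> real"
  assumes K_eq: "K = (\<lambda>x y. f (x \<bullet> y))"
    and area_pos: "area > 0"
    and dim: "CARD('n) \<ge> 2"
    and f_cont: "continuous_on {-1..1} f"
    and f_bound: "\<And>s. s \<in> {-1..1} \<Longrightarrow> \<bar>f s\<bar> \<le> B"
    and eig: "\<forall>n (Y :: real^'n \<Rightarrow> real) x. spherical_harmonic n Y \<longrightarrow> x \<in> sphere 0 1 \<longrightarrow>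
       (LINT y|sphere_measure. f (x \<bullet> y) * Y y) / area = \<mu> n * Y x"
    and \<mu>_pos: "\<And>n. \<mu> n > 0"
begin

sublocale kernel_operator sphere_measure K B
  unfolding K_eq by (rule kernel_operator_sphere[OF finite_measure_sphere refl f_cont f_bound])

abbreviation "\<sigma> \<equiv> (sphere_measure :: (real^'n) measure)"

lemma op_integral: "op u x = (LINT y|\<sigma>. f (x \<bullet> y) * u y)"
  unfolding op_def by (simp only: K_eq)

lemma op_harmonic:
  assumes "hom_laplacian n Y (\<lambda>x. 0)" "x \<in> sphere 0 1"
  shows "op Y x = area * \<mu> n * Y x"
  using eig[rule_format, OF hom_laplacian_spherical_harmonic[OF assms(1)] assms(2)] area_pos
  by (simp add: op_integral field_simps)

lemma continuous_polynomial:
  "real_polynomial_function p \<Longrightarrow> continuous_on (sphere (0::real^'n) 1) p"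
  using continuous_on_polymonial_function real_polynomial_function_eq by metis

lemma harmonic_L2: "hom_laplacian n Y (\<lambda>x. 0) \<Longrightarrow> Y \<in> L2 \<sigma>"
  by (rule continuous_L2) (simp add: continuous_polynomial hom_laplacian_polynomial)

lemma ip_op_harmonic:
  assumes "hom_laplacian n Y (\<lambda>x. 0)" "u \<in> L2 \<sigma>"
  shows "ip \<sigma> (op u) Y = area * \<mu> n * ip \<sigma> u Y"
proof -
  have "ip \<sigma> (op u) Y = ip \<sigma> u (op Y)"
    by (rule op_adjoint[OF assms(2) harmonic_L2[OF assms(1)]])
  also have "\<dots> = ip \<sigma> u (\<lambda>x. area * \<mu> n * Y x)"
    by (rule ip_cong_space) (use op_harmonic[OF assms(1)] in auto)
  finally show ?thesis by (simp only: ip_cmult_right)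
qed

text \<open>Completeness of the harmonics in weak form: continuous functions are uniform limits of
  polynomials, which are sums of harmonics on the sphere. Continuous \<open>g\<close> is enough
  because it will be the image of \<open>u\<close> under an integral operator.\<close>

lemma orth_harmonics_orth_continuous:
  assumes u: "u \<in> L2 \<sigma>" and orth: "\<And>k Y. hom_laplacian k Y (\<lambda>x. 0) \<Longrightarrow> ip \<sigma> u Y = 0"
    and g: "continuous_on (sphere 0 1) g"
  shows "ip \<sigma> u g = 0"
proof -
  have poly: "ip \<sigma> u p = 0" if "real_polynomial_function p" for p
  proof -
    obtain N where "degree_le N p" using real_polynomial_degree_le[OF \<open>real_polynomial_function p\<close>] by blast
    then obtain Y where Y: "\<And>k. hom_laplacian k (Y k) (\<lambda>x. 0)" "\<And>x. x \<in> sphere 0 1 \<Longrightarrow> p x = (\<Sum>k\<le>N. Y k x)"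
      using degree_le_harmonic_sum unfolding harmonic_sum_def by blast
    have "ip \<sigma> u p = ip \<sigma> u (\<lambda>x. \<Sum>k\<le>N. 1 * Y k x)"
      by (rule ip_cong_space) (use Y(2) in auto)
    also have "\<dots> = (\<Sum>k\<le>N. 1 * ip \<sigma> u (Y k))"
      by (rule ip_sum_right) (use Y(1) harmonic_L2 u in auto)
    finally show ?thesis using orth[OF Y(1)] by simp
  qed
  have gL: "g \<in> L2 \<sigma>" using g by (intro continuous_L2) simp
  have "(ip \<sigma> u g)\<^sup>2 \<le> 0"
  proof (rule field_le_epsilon)
    fix e :: real assume e: "0 < e"
    \<comment> \<open>Chosen to make the final bound equal to \<open>e\<close>; the summand 1 avoids
      division by 0.\<close>
    define a where "a = sqrt (e / (ip \<sigma> u u * mass + 1))"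
    have den: "ip \<sigma> u u * mass + 1 > 0" 
      by (intro add_nonneg_pos mult_nonneg_nonneg ip_nonneg) auto
    then have a: "a > 0" "a\<^sup>2 = e / (ip \<sigma> u u * mass + 1)" using e by (auto simp: a_def)
    obtain p where p: "real_polynomial_function p" "\<And>x. x \<in> sphere 0 1 \<Longrightarrow> \<bar>g x - p x\<bar> < a"
      using Stone_Weierstrass_real_polynomial_function[OF compact_sphere g a(1)] by blast
    have pL: "p \<in> L2 \<sigma>" using continuous_polynomial[OF p(1)] by (intro continuous_L2) simp
    have dL: "(\<lambda>x. g x - p x) \<in> L2 \<sigma>" by (rule L2_diff[OF gL pL])
    have "ip \<sigma> u g = ip \<sigma> (\<lambda>x. g x - p x) u"
      using ip_diff[OF gL pL u] poly[OF p(1)] by (simp add: ip_commute[of \<sigma> _ u])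
    then have "(ip \<sigma> u g)\<^sup>2 \<le> ip \<sigma> (\<lambda>x. g x - p x) (\<lambda>x. g x - p x) * ip \<sigma> u u"
      using ip_Cauchy_Schwarz[OF dL u] by simp
    also have "\<dots> \<le> (a\<^sup>2 * mass) * ip \<sigma> u u"
    proof (rule mult_right_mono[OF _ ip_nonneg])
      have "(g x - p x)\<^sup>2 \<le> a\<^sup>2" if "x \<in> sphere 0 1" for x
        using p(2)[OF that] by (metis abs_ge_zero less_imp_le power2_abs power_mono)
      then show "ip \<sigma> (\<lambda>x. g x - p x) (\<lambda>x. g x - p x) \<le> a\<^sup>2 * mass"
        using ip_self_bound[OF L2_measurable[OF dL], of "a\<^sup>2"] by simp
    qed
    also have "\<dots> \<le> a\<^sup>2 * (ip \<sigma> u u * mass + 1)"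
      by (simp add: algebra_simps)
    also have "\<dots> = e" using den by (simp add: a(2))
    finally show "(ip \<sigma> u g)\<^sup>2 \<le> 0 + e" by simp
  qed
  then show ?thesis by simp
qed

text \<open>A negative value of the form would yield an eigenfunction of \<open>-K\<close> with positive eigenvalue;
  it is orthogonal to all spherical harmonics, which have eigenvalues of the other sign.\<close>
lemma op_nonneg:
  assumes u: "u \<in> L2 \<sigma>"
  shows "0 \<le> ip \<sigma> (op u) u"
proof (rule ccontr)
  assume neg: "\<not> 0 \<le> ip \<sigma> (op u) u"
  interpret N: kernel_operator \<sigma> "\<lambda>x y. - f (x \<bullet> y)" B
    by (rule kernel_operator_sphere[OF finite_measure_sphere refl])
      (use f_cont f_bound in \<open>auto intro: continuous_on_minus\<close>)
  have Nop: "N.op v = (\<lambda>x. - 1 * op v x)" for v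
    by (rule ext) (simp add: N.op_def op_integral)
  have pos: "ip \<sigma> u u > 0"
  proof (rule ccontr)
    assume "\<not> ip \<sigma> u u > 0"
    then have "ip \<sigma> u u = 0" using ip_nonneg[of \<sigma> u] by simp
    then show False using ip_op_bound[OF u] neg by simp
  qed
  define t where "t = - ip \<sigma> (op u) u / ip \<sigma> u u"
  have t: "t > 0" using neg pos by (simp add: t_def divide_neg_pos)
  have "\<exists>g. eigensystem \<sigma> (\<lambda>x y. - f (x \<bullet> y)) (Suc 0) t ((\<lambda>_ _. 0)(0 := g))"
  proof (rule N.eigensystem_extend[OF _ t, where h = u])
    show "eigensystem \<sigma> (\<lambda>x y. - f (x \<bullet> y)) 0 t (\<lambda>_ _. 0)" by (simp add: eigensystem_def)
    show "u \<in> N.orth 0 (\<lambda>_ _. 0)" using u by (simp add: N.orth_def)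
    show "t * ip \<sigma> u u \<le> ip \<sigma> (N.op u) u"
      unfolding Nop ip_cmult using pos by (simp add: t_def)
  qed (rule pos)
  then obtain g where g: "eigensystem \<sigma> (\<lambda>x y. - f (x \<bullet> y)) (Suc 0) t ((\<lambda>_ _. 0)(0 := g))" by blast
  have gL: "g \<in> L2 \<sigma>" and g1: "ip \<sigma> g g = 1" using g by (auto simp: eigensystem_def)
  obtain l where l: "l \<ge> t" "AE x in \<sigma>. N.op g x = l * g x"
    using N.eigensystemD(2)[OF g, of 0] by auto
  have eq: "ip \<sigma> (N.op g) v = l * ip \<sigma> g v" if "v \<in> L2 \<sigma>" for v
    using ip_cong_AE[OF N.op_L2[OF gL] L2_cmult[OF gL] that l(2)] by (simp add: ip_cmult)
  have orth: "ip \<sigma> g Y = 0" if Y: "hom_laplacian k Y (\<lambda>x. 0)" for k Y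
  proof -
    have "l * ip \<sigma> g Y = - (area * \<mu> k * ip \<sigma> g Y)"
      using eq[OF harmonic_L2[OF Y]] ip_op_harmonic[OF Y gL] unfolding Nop ip_cmult by simp
    then have "(l + area * \<mu> k) * ip \<sigma> g Y = 0" by (simp add: algebra_simps)
    moreover have "l + area * \<mu> k > 0" using l(1) t area_pos \<mu>_pos[of k] by (simp add: add_pos_pos)
    ultimately show ?thesis by simp
  qed
  have cont: "continuous_on (sphere 0 1) (N.op g)" using N.op_continuous[OF gL] by simp
  have "ip \<sigma> g (N.op g) = 0"
    by (rule orth_harmonics_orth_continuous[OF gL _ cont]) (rule orth)
  then show False using eq[OF gL] g1 l(1) t by (simp add: ip_commute)
qed

text \<open>Available because the form is non-negative. It will relate a rotated span element to a
  weighted test function.\<close>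

lemma op_Cauchy_Schwarz:
  assumes u: "u \<in> L2 \<sigma>" and v: "v \<in> L2 \<sigma>"
  shows "(ip \<sigma> (op u) v)\<^sup>2 \<le> ip \<sigma> (op u) u * ip \<sigma> (op v) v"
proof (rule discriminant_le)
  fix a b
  let ?w = "\<lambda>x. a * u x + b * v x"
  have w: "?w \<in> L2 \<sigma>" by (rule L2_comb[OF u v])
  note L = u v op_L2[OF u] op_L2[OF v] w
  have "ip \<sigma> (op ?w) ?w = ip \<sigma> (\<lambda>x. a * op u x + b * op v x) ?w"
    using L by (intro ip_cong_space) (auto simp: op_comb)
  also have "\<dots> = a * ip \<sigma> (op u) ?w + b * ip \<sigma> (op v) ?w"
    using L by (simp add: ip_comb)
  also have "ip \<sigma> (op u) ?w = a * ip \<sigma> (op u) u + b * ip \<sigma> (op u) v"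
    using ip_comb[OF u v op_L2[OF u], of a b] by (simp add: ip_commute)
  also have "ip \<sigma> (op v) ?w = a * ip \<sigma> (op u) v + b * ip \<sigma> (op v) v"
    using ip_comb[OF u v op_L2[OF v], of a b] op_adjoint[OF u v] by (simp add: ip_commute)
  finally show "0 \<le> ip \<sigma> (op u) u * a\<^sup>2 + 2 * ip \<sigma> (op u) v * a * b + ip \<sigma> (op v) v * b\<^sup>2"
    using op_nonneg[OF w] by (simp add: power2_eq_square algebra_simps)
qed

text \<open>The surface measure charges every ball centred on the sphere, so a value at one point
  certifies that a continuous test function is not degenerate.\<close>

lemma ip_self_pos:
  assumes g: "continuous_on (sphere 0 1) g" and z: "z \<in> sphere 0 1" "g z \<noteq> 0"
  shows "ip \<sigma> g g > 0"
proof -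
  define c where "c = \<bar>g z\<bar> / 2"
  have c: "c > 0" using z(2) by (simp add: c_def)
  obtain r where r: "r > 0" "\<And>x. x \<in> sphere 0 1 \<Longrightarrow> dist x z < r \<Longrightarrow> dist (g x) (g z) < c"
    using g z(1) c unfolding continuous_on_iff by blast
  have "0 < c\<^sup>2 * (LINT x|\<sigma>. indicator (ball z r) x)"
    using sphere_ball_integral_pos[OF dim z(1) r(1)] c by simp
  also have "\<dots> = (LINT x|\<sigma>. c\<^sup>2 * indicator (ball z r) x)" by simp
  also have "\<dots> \<le> ip \<sigma> g g"
    unfolding ip_def
  proof (rule integral_mono)
    show "integrable \<sigma> (\<lambda>x. c\<^sup>2 * indicator (ball z r) x)"
      by (intro integrable_mult_right integrable_ball_sphere)
    show "integrable \<sigma> (\<lambda>x. g x * g x)"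
      using g by (intro L2_integrable_mult continuous_L2) auto
    show "c\<^sup>2 * indicator (ball z r) x \<le> g x * g x" if "x \<in> space \<sigma>" for x
    proof (cases "x \<in> ball z r")
      case True
      then have "\<bar>g x - g z\<bar> < c" using r(2)[of x] that by (simp add: dist_commute dist_real_def)
      then have "c \<le> \<bar>g x\<bar>" unfolding c_def by arith
      then have "c\<^sup>2 \<le> \<bar>g x\<bar>\<^sup>2" using c by (intro power_mono) auto
      then show ?thesis using True by (simp add: power2_eq_square)
    qed simp
  qed
  finally show ?thesis .
qed

text \<open>Spherical harmonics of degrees \<open>k\<close>, \<open>l\<close> need not be orthogonal when \<open>\<mu> k = \<mu> l\<close>, but then their
  contributions can be merged: in both cases \<open>b k * ip (Y k) (Y l) = sqrt (b k) * sqrt (b l) * ip (Y k) (Y l)\<close>.\<close>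
lemma op_harmonic_sum_ge:
  assumes h: "harmonic_sum N h" and tau: "\<And>k. k \<le> N \<Longrightarrow> \<tau> \<le> area * \<mu> k"
  shows "\<tau> * ip \<sigma> h h \<le> ip \<sigma> (op h) h"
proof -
  obtain Y where Y: "\<And>k. hom_laplacian k (Y k) (\<lambda>x. 0)" "\<And>x. x \<in> sphere 0 1 \<Longrightarrow> h x = (\<Sum>k\<le>N. Y k x)"
    using h unfolding harmonic_sum_def by blast
  note YL = harmonic_L2[OF Y(1)]
  define b where "b k = area * \<mu> k - \<tau>" for k
  have b: "b k \<ge> 0" if "k \<le> N" for k using tau[OF that] by (simp add: b_def)
  define h' where "h' = (\<lambda>x. \<Sum>k\<le>N. 1 * Y k x)"
  have h'L: "h' \<in> L2 \<sigma>" unfolding h'_def by (rule L2_sum) (rule YL)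
  have hL: "h \<in> L2 \<sigma>" by (rule L2_cong_space[OF h'L]) (simp add: h'_def Y(2))
  \<comment> \<open>The difference of the two sides of the claim will turn out to be
    \<open>ip \<sigma> s s\<close>.\<close>
  define s where "s = (\<lambda>x. \<Sum>k\<le>N. sqrt (b k) * Y k x)"
  have sL: "s \<in> L2 \<sigma>" unfolding s_def by (rule L2_sum) (rule YL)
  have hh: "ip \<sigma> h w = ip \<sigma> h' w" for w
    by (rule ip_cong_space) (auto simp: h'_def Y(2))
  have hY: "ip \<sigma> h w = (\<Sum>k\<le>N. ip \<sigma> (Y k) w)" if "w \<in> L2 \<sigma>" for w
  proof -
    have "ip \<sigma> h' w = (\<Sum>k\<le>N. 1 * ip \<sigma> (Y k) w)"
      unfolding h'_def by (rule ip_sum) (use YL that in auto)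
    then show ?thesis by (simp add: hh)
  qed
  have ophh: "ip \<sigma> (op h) h = (\<Sum>k\<le>N. \<Sum>l\<le>N. area * \<mu> l * ip \<sigma> (Y k) (Y l))"
  proof -
    have "ip \<sigma> (op h) h = ip \<sigma> (op h) h'"
      by (rule ip_cong_space) (auto simp: h'_def Y(2))
    also have "\<dots> = (\<Sum>l\<le>N. 1 * ip \<sigma> (op h) (Y l))"
      unfolding h'_def by (rule ip_sum_right) (use YL op_L2[OF hL] in auto)
    also have "\<dots> = (\<Sum>l\<le>N. \<Sum>k\<le>N. area * \<mu> l * ip \<sigma> (Y k) (Y l))"
      by (simp add: ip_op_harmonic[OF Y(1) hL] hY[OF YL] sum_distrib_left)
    also have "\<dots> = (\<Sum>k\<le>N. \<Sum>l\<le>N. area * \<mu> l * ip \<sigma> (Y k) (Y l))" by (rule sum.swap)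
    finally show ?thesis .
  qed
  have iphh: "ip \<sigma> h h = (\<Sum>k\<le>N. \<Sum>l\<le>N. ip \<sigma> (Y k) (Y l))"
  proof -
    have "ip \<sigma> h h = (\<Sum>k\<le>N. ip \<sigma> (Y k) h)"
      by (rule hY[OF hL])
    also have "\<dots> = (\<Sum>k\<le>N. \<Sum>l\<le>N. ip \<sigma> (Y l) (Y k))"
      by (intro sum.cong refl) (simp only: ip_commute[of \<sigma> "Y _" h] hY[OF YL])
    also have "\<dots> = (\<Sum>k\<le>N. \<Sum>l\<le>N. ip \<sigma> (Y k) (Y l))" by (rule sum.swap)
    finally show ?thesis .
  qed
  have "ip \<sigma> (op h) h - \<tau> * ip \<sigma> h h = (\<Sum>k\<le>N. \<Sum>l\<le>N. b l * ip \<sigma> (Y k) (Y l))"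
    unfolding ophh iphh by (simp add: b_def sum_distrib_left sum_subtractf left_diff_distrib)
  also have "\<dots> = (\<Sum>k\<le>N. \<Sum>l\<le>N. sqrt (b k) * (sqrt (b l) * ip \<sigma> (Y k) (Y l)))"
  proof (intro sum.cong refl)
    fix k l assume kl: "k \<in> {..N}" "l \<in> {..N}"
    have "ip \<sigma> (op (Y k)) (Y l) = ip \<sigma> (op (Y l)) (Y k)"
      using op_adjoint[OF YL YL, of k l] ip_commute[of \<sigma> "Y k" "op (Y l)"] by (rule trans)
    then have "area * \<mu> l * ip \<sigma> (Y k) (Y l) = area * \<mu> k * ip \<sigma> (Y l) (Y k)"
      unfolding ip_op_harmonic[OF Y(1) YL] .
    then have "\<mu> l * ip \<sigma> (Y k) (Y l) = \<mu> k * ip \<sigma> (Y k) (Y l)"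
      using area_pos by (simp add: ip_commute[of \<sigma> "Y l" "Y k"])
    then have "b k = b l \<or> ip \<sigma> (Y k) (Y l) = 0" by (auto simp: b_def)
    then show "b l * ip \<sigma> (Y k) (Y l) = sqrt (b k) * (sqrt (b l) * ip \<sigma> (Y k) (Y l))"
      using b kl by (auto simp flip: mult.assoc)
  qed
  also have "\<dots> = ip \<sigma> s s"
  proof -
    have "ip \<sigma> s s = (\<Sum>k\<le>N. sqrt (b k) * ip \<sigma> (Y k) s)"
      unfolding s_def by (rule ip_sum) (use YL sL s_def in auto)
    also have "\<dots> = (\<Sum>k\<le>N. sqrt (b k) * (\<Sum>l\<le>N. sqrt (b l) * ip \<sigma> (Y k) (Y l)))"
      unfolding s_def using YL by (intro sum.cong refl arg_cong2[where f = "(*)"] ip_sum_right) auto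
    finally show ?thesis by (simp add: sum_distrib_left)
  qed
  finally show ?thesis using ip_nonneg[of \<sigma> s] by simp
qed

end

text \<open>The image of an eigenfunction divided by its eigenvalue is continuous and agrees with it
  almost everywhere. The eigenvalue equation then holds at every point, hence also after a
  rotation.\<close>

lemma (in kernel_operator) eigensystem_continuous:
  assumes es: "eigensystem M K i t fs" and t: "t > 0"
  obtains e where "\<And>j. j < i \<Longrightarrow> continuous_on (space M) (e j)"
    "eigensystem M K i t e" "\<And>j. j < i \<Longrightarrow> \<exists>l\<ge>t. \<forall>x\<in>space M. op (e j) x = l * e j x"
proof -
  have "\<exists>l\<ge>t. AE x in M. op (fs j) x = l * fs j x" if "j < i" for j
    using eigensystemD(2)[OF es that] .
  then obtain l where l: "\<And>j. j < i \<Longrightarrow> l j \<ge> t" "\<And>j. j < i \<Longrightarrow> AE x in M. op (fs j) x = l j * fs j x"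
    by metis
  define e where "e j x = op (fs j) x / l j" for j x
  have fL: "fs j \<in> L2 M" if "j < i" for j using eigensystemD(1)[OF es that] .
  have l0: "l j > 0" if "j < i" for j using l(1)[OF that] t by simp
  have cont: "continuous_on (space M) (e j)" if "j < i" for j
    unfolding e_def using op_continuous[OF fL[OF that]] l0[OF that] by (intro continuous_intros) auto
  have eL: "e j \<in> L2 M" if "j < i" for j by (rule continuous_L2[OF cont[OF that]])
  have ae: "AE x in M. e j x = fs j x" if j: "j < i" for j
    using l(2)[OF j] by eventually_elim (use l0[OF j] in \<open>simp add: e_def\<close>)
  have ope: "op (e j) x = l j * e j x" if "j < i" "x \<in> space M" for j x
    using op_cong_AE[OF that(2) eL[OF that(1)] fL[OF that(1)] ae[OF that(1)]] l0[OF that(1)]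
    by (simp add: e_def[of j x])
  have ipe: "ip M (e j) (e k) = ip M (fs j) (fs k)" if "j < i" "k < i" for j k
  proof -
    have "ip M (e j) (e k) = ip M (fs j) (e k)"
      by (rule ip_cong_AE) (use eL fL ae that in auto)
    also have "\<dots> = ip M (e k) (fs j)" by (rule ip_commute)
    also have "\<dots> = ip M (fs k) (fs j)"
      by (rule ip_cong_AE) (use eL fL ae that in auto)
    finally show ?thesis by (simp only: ip_commute)
  qed
  have "eigensystem M K i t e"
    unfolding eigensystem_def
  proof (intro conjI allI impI)
    show "\<exists>l\<ge>t. AE x in M. (LINT y|M. K x y * e j y) = l * e j x" if "j < i" for j
      using ope[OF that] l(1)[OF that] by (intro exI[of _ "l j"] conjI AE_I2) (auto simp: op_def)
    show "ip M (e j) (e j') = (if j = j' then 1 else 0)" if "j < i" "j' < i" for j j'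
      unfolding ipe[OF that] using es that by (simp add: eigensystem_def)
  qed (rule eL)
  then show ?thesis using that cont ope l(1) by metis
qed

text \<open>In coordinates the form and the squared norm of the image are sums weighted by
  \<open>l j\<close> and its square. With \<open>l j \<ge> t > 0\<close>, each of the three
  quantities is at least \<open>t\<close> times the preceding one.\<close>

lemma (in kernel_operator) eigensystem_span:
  fixes i :: nat
  assumes eL: "\<And>j. j < i \<Longrightarrow> e j \<in> L2 M"
    and orthonormal: "\<And>j k. j < i \<Longrightarrow> k < i \<Longrightarrow> ip M (e j) (e k) = (if j = k then 1 else 0)"
    and op_e: "\<And>j x. j < i \<Longrightarrow> x \<in> space M \<Longrightarrow> op (e j) x = l j * e j x"
  defines "w \<equiv> \<lambda>c x. \<Sum>j<i. c j * e j x"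
  shows "ip M (w c) (w c) = (\<Sum>j<i. c j * c j)"
    "ip M (op (w c)) (w c) = (\<Sum>j<i. l j * (c j * c j))"
    "ip M (op (w c)) (op (w c)) = (\<Sum>j<i. l j * l j * (c j * c j))"
proof -
  have ip_w: "ip M (w a) (w b) = (\<Sum>j<i. a j * b j)" for a b
  proof -
    have "ip M (w a) (w b) = (\<Sum>j<i. a j * ip M (e j) (w b))"
      unfolding w_def by (rule ip_sum) (use eL L2_sum[of "{..<i}" e] in auto)
    also have "\<dots> = (\<Sum>j<i. a j * b j)"
    proof (intro sum.cong refl arg_cong2[where f = "(*)"])
      fix j assume j: "j \<in> {..<i}"
      have "ip M (e j) (w b) = (\<Sum>k<i. b k * ip M (e j) (e k))"
        unfolding w_def by (rule ip_sum_right) (use eL j in auto)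
      also have "\<dots> = (\<Sum>k<i. if j = k then b k else 0)"
        using j by (intro sum.cong) (auto simp: orthonormal)
      finally show "ip M (e j) (w b) = b j" using j by simp
    qed
    finally show ?thesis .
  qed
  have op_w: "op (w c) x = w (\<lambda>j. l j * c j) x" if "x \<in> space M" for x
    unfolding w_def using op_sum[OF that, of "{..<i}" e c] eL op_e[OF _ that] by (simp add: mult_ac)
  show "ip M (w c) (w c) = (\<Sum>j<i. c j * c j)" by (rule ip_w)
  have "ip M (op (w c)) (w c) = ip M (w (\<lambda>j. l j * c j)) (w c)"
    by (rule ip_cong_space) (auto simp: op_w)
  then show "ip M (op (w c)) (w c) = (\<Sum>j<i. l j * (c j * c j))"
    by (simp add: ip_w mult.assoc)
  have "ip M (op (w c)) (op (w c)) = ip M (w (\<lambda>j. l j * c j)) (w (\<lambda>j. l j * c j))"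
    by (rule ip_cong_space) (auto simp: op_w)
  then show "ip M (op (w c)) (op (w c)) = (\<Sum>j<i. l j * l j * (c j * c j))"
    by (simp add: ip_w mult_ac)
qed

section \<open>Counting eigenvalues\<close>

context dot_kernel
begin

lemma degree_le_continuous: "degree_le n p \<Longrightarrow> continuous_on (sphere (0::real^'n) 1) p"
proof (induction rule: degree_le.induct)
  case (mon \<alpha> n c)
  then show ?case by (intro continuous_intros continuous_polynomial polynomial_pmon)
qed (rule continuous_on_add)

lemma pmon_L2: "pmon \<alpha> \<in> L2 \<sigma>"
  by (rule continuous_L2) (simp add: continuous_polynomial polynomial_pmon)

text \<open>On the sphere \<open>x\<^sub>j\<^sup>2 = 1 - (\<Sum>i\<noteq>j. x\<^sub>i\<^sup>2)\<close>, so a monomial reduces to monomials with exponent at most 1 in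
  \<open>x\<^sub>j\<close> without raising the degree.\<close>
lemma orth_monomials:
  assumes u: "u \<in> L2 \<sigma>"
    and red: "\<And>\<alpha>. \<alpha> j \<le> 1 \<Longrightarrow> (\<And>i. \<alpha> i < N) \<Longrightarrow> ip \<sigma> (pmon \<alpha>) u = 0"
  shows "sum \<alpha> UNIV < N \<Longrightarrow> ip \<sigma> (pmon \<alpha>) u = 0"
proof (induction "\<alpha> j" arbitrary: \<alpha> rule: less_induct)
  case less
  show ?case
  proof (cases "\<alpha> j \<le> 1")
    case True
    have "\<alpha> i < N" for i
      using less.prems member_le_sum[of i UNIV \<alpha>] by simp
    then show ?thesis using red True by blast
  next
    case False
    define \<beta> where "\<beta> = \<alpha>(j := \<alpha> j - 2)"
    have \<beta>: "sum \<beta> UNIV + 2 = sum \<alpha> UNIV" "\<beta> j < \<alpha> j" "\<beta> j + 2 = \<alpha> j"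
      using sum_update_nat[of \<alpha> j "\<alpha> j - 2"] False by (auto simp: \<beta>_def)
    define \<gamma> where "\<gamma> i = \<beta>(i := \<beta> i + 2)" for i
    have \<gamma>: "sum (\<gamma> i) UNIV = sum \<alpha> UNIV" for i
      using sum_update_nat[of \<beta> i "\<beta> i + 2"] \<beta>(1) by (simp add: \<gamma>_def)
    have \<alpha>_eq: "\<gamma> j = \<alpha>" using \<beta>(3) by (auto simp: \<gamma>_def \<beta>_def)
    have IH\<beta>: "ip \<sigma> (pmon \<beta>) u = 0"
      using less.hyps[of \<beta>] \<beta>(2) less.prems \<beta>(1) by simp
    have IH\<gamma>: "ip \<sigma> (pmon (\<gamma> i)) u = 0" if "i \<noteq> j" for i
      using less.hyps[of "\<gamma> i"] that \<beta>(2) \<gamma>[of i] less.prems by (simp add: \<gamma>_def)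
    have "pmon \<alpha> x = 1 * pmon \<beta> x + (-1) * (\<Sum>i\<in>UNIV - {j}. 1 * pmon (\<gamma> i) x)"
      if x: "x \<in> sphere 0 1" for x
    proof -
      have "(x \<bullet> x) * pmon \<beta> x = (\<Sum>i\<in>UNIV. pmon (\<gamma> i) x)"
        unfolding inner_vec_def sum_distrib_right \<gamma>_def pmon_shift[of x _ 2, symmetric]
        by (simp add: power2_eq_square)
      also have "\<dots> = pmon (\<gamma> j) x + (\<Sum>i\<in>UNIV - {j}. pmon (\<gamma> i) x)"
        by (rule sum.remove) auto
      finally show ?thesis using x by (simp add: \<alpha>_eq dot_square_norm)
    qed
    then have "ip \<sigma> (pmon \<alpha>) u
        = ip \<sigma> (\<lambda>x. 1 * pmon \<beta> x + (-1) * (\<Sum>i\<in>UNIV - {j}. 1 * pmon (\<gamma> i) x)) u"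
      by (intro ip_cong_space) auto
    also have "\<dots> = 1 * ip \<sigma> (pmon \<beta>) u + (-1) * ip \<sigma> (\<lambda>x. \<Sum>i\<in>UNIV - {j}. 1 * pmon (\<gamma> i) x) u"
      by (rule ip_comb[OF pmon_L2 L2_sum[OF pmon_L2] u])
    also have "ip \<sigma> (\<lambda>x. \<Sum>i\<in>UNIV - {j}. 1 * pmon (\<gamma> i) x) u = (\<Sum>i\<in>UNIV - {j}. 1 * ip \<sigma> (pmon (\<gamma> i)) u)"
      by (rule ip_sum[OF pmon_L2 u])
    also have "\<dots> = 0" by (rule sum.neutral) (simp add: IH\<gamma>)
    finally show ?thesis using IH\<beta> by simp
  qed
qed

lemma orth_low_degree:
  assumes u: "u \<in> L2 \<sigma>" and mons: "\<And>\<alpha>. sum \<alpha> UNIV < N \<Longrightarrow> ip \<sigma> (pmon \<alpha>) u = 0"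
    and h: "hom_laplacian k p q" "k < N"
  shows "ip \<sigma> p u = 0"
proof -
  have "hom_laplacian k p q \<Longrightarrow> k < N \<Longrightarrow> p \<in> L2 \<sigma> \<and> ip \<sigma> p u = 0"
  proof (induction rule: hom_laplacian.induct)
    case (mon \<alpha> n c)
    then show ?case using mons[of \<alpha>] L2_cmult[OF pmon_L2] by (simp add: ip_cmult)
  next
    case (add n p q p' q')
    then show ?case using L2_comb[of p \<sigma> p' 1 1] ip_comb[of p \<sigma> p' u 1 1] u by simp
  qed
  then show ?thesis using h by blast
qed

text \<open>If \<open>i\<close> were larger, some non-trivial \<open>w\<close> in the span would be
  orthogonal to all polynomials of degree below \<open>N\<close>, by counting. It is orthogonal to
  the harmonics of degree at least \<open>N\<close> as well, since these belong to eigenvalues below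
  \<open>t\<close>. By completeness \<open>w\<close> is orthogonal to \<open>op w\<close>, although
  the form is positive on the span.\<close>

lemma eigensystem_upper:
  assumes es: "eigensystem \<sigma> K i t fs" and t: "t > 0" and N: "\<And>n. n \<ge> N \<Longrightarrow> area * \<mu> n < t"
  shows "i \<le> 2 * N ^ (CARD('n) - 1)"
proof (rule ccontr)
  assume "\<not> i \<le> 2 * N ^ (CARD('n) - 1)"
  then have big: "2 * N ^ (CARD('n) - 1) < i" by simp
  obtain e where e: "\<And>j. j < i \<Longrightarrow> continuous_on (space \<sigma>) (e j)" "eigensystem \<sigma> K i t e"
    "\<And>j. j < i \<Longrightarrow> \<exists>l\<ge>t. \<forall>x\<in>space \<sigma>. op (e j) x = l * e j x"
    using eigensystem_continuous[OF es t] by blast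
  obtain l where l: "\<And>j. j < i \<Longrightarrow> l j \<ge> t" "\<And>j x. j < i \<Longrightarrow> x \<in> space \<sigma> \<Longrightarrow> op (e j) x = l j * e j x"
    using e(3) by metis
  have eL: "\<And>j. j < i \<Longrightarrow> e j \<in> L2 \<sigma>"
    and orthonormal: "\<And>j k. j < i \<Longrightarrow> k < i \<Longrightarrow> ip \<sigma> (e j) (e k) = (if j = k then 1 else 0)"
    using e(2) by (auto simp: eigensystem_def)
  obtain j0 :: 'n where True by simp
  \<comment> \<open>By \<open>orth_monomials\<close> these exponents suffice: at most 1 in the
    coordinate \<open>j0\<close> and below \<open>N\<close> in the others, which gives the count
    \<open>2 N ^ (CARD('n) - 1)\<close>.\<close>
  define R :: "('n \<Rightarrow> nat) set" where "R = PiE UNIV (\<lambda>i. if i = j0 then {..<2} else {..<N})"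
  have "card R = (\<Prod>i\<in>UNIV. card (if i = j0 then {..<2} else {..<N}))"
    unfolding R_def by (rule card_PiE) simp
  also have "\<dots> = 2 * (\<Prod>i\<in>UNIV - {j0}. card (if i = j0 then {..<2} else {..<N}))"
    by (subst prod.remove[of UNIV j0]) auto
  also have "(\<Prod>i\<in>UNIV - {j0}. card (if i = j0 then {..<2} else {..<N})) = (\<Prod>i\<in>UNIV - {j0}. N)"
    by (intro prod.cong) auto
  finally have cardR: "card R = 2 * N ^ (CARD('n) - 1)" by simp
  have finR: "finite R" unfolding R_def by (rule finite_PiE) auto
  obtain c where c: "\<exists>j\<in>{..<i}. c j \<noteq> 0" "\<forall>\<alpha>\<in>R. (\<Sum>j<i. ip \<sigma> (pmon \<alpha>) (e j) * c j) = 0"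
    using underdetermined_system[OF finR finite_lessThan[of i], of "\<lambda>\<alpha> j. ip \<sigma> (pmon \<alpha>) (e j)"]
      big cardR by auto
  define w where "w = (\<lambda>x. \<Sum>j<i. c j * e j x)"
  have wL: "w \<in> L2 \<sigma>" unfolding w_def by (rule L2_sum) (use eL in auto)
  have R0: "ip \<sigma> (pmon \<alpha>) w = 0" if "\<alpha> j0 \<le> 1" "\<And>i. \<alpha> i < N" for \<alpha>
  proof -
    have "\<alpha> \<in> R" using that by (auto simp: R_def PiE_def)
    moreover have "ip \<sigma> (pmon \<alpha>) w = (\<Sum>j<i. c j * ip \<sigma> (pmon \<alpha>) (e j))"
      unfolding w_def by (rule ip_sum_right) (use eL pmon_L2 in auto)
    ultimately show ?thesis using c(2) by (simp add: mult.commute)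
  qed
  have harm: "ip \<sigma> w Y = 0" if Y: "hom_laplacian k Y (\<lambda>x. 0)" for k Y
  proof (cases "k < N")
    case True
    have "ip \<sigma> Y w = 0"
      by (rule orth_low_degree[OF wL _ Y True]) (rule orth_monomials[OF wL R0])
    then show ?thesis by (subst ip_commute)
  next
    case False
    have "ip \<sigma> (e j) Y = 0" if j: "j < i" for j
    proof -
      have "area * \<mu> k * ip \<sigma> (e j) Y = ip \<sigma> (op (e j)) Y"
        by (rule ip_op_harmonic[OF Y eL[OF j], symmetric])
      also have "\<dots> = ip \<sigma> (\<lambda>x. l j * e j x) Y"
        by (rule ip_cong_space) (use l(2)[OF j] in auto)
      finally have "(l j - area * \<mu> k) * ip \<sigma> (e j) Y = 0"
        by (simp only: ip_cmult left_diff_distrib diff_self)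
      moreover have "l j - area * \<mu> k > 0" using N[of k] False l(1)[OF j] by simp
      ultimately show ?thesis by (metis less_irrefl mult_eq_0_iff)
    qed
    moreover have "ip \<sigma> w Y = (\<Sum>j<i. c j * ip \<sigma> (e j) Y)"
      unfolding w_def by (rule ip_sum) (use eL harmonic_L2[OF Y] in auto)
    ultimately show ?thesis by simp
  qed
  have cont: "continuous_on (sphere 0 1) (op w)" using op_continuous[OF wL] by simp
  have "ip \<sigma> w (op w) = 0"
    by (rule orth_harmonics_orth_continuous[OF wL _ cont]) (rule harm)
  moreover have "ip \<sigma> (op w) w = (\<Sum>j<i. l j * (c j * c j))"
    unfolding w_def by (rule eigensystem_span(2)[OF eL orthonormal l(2)])
  moreover have "(\<Sum>j<i. l j * (c j * c j)) > 0"
  proof -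
    obtain j where j: "j < i" "c j \<noteq> 0" using c(1) by auto
    have l0: "l j > 0" if "j < i" for j using l(1)[OF that] t by simp
    show ?thesis
    proof (rule sum_pos2[of _ j])
      show "0 < l j * (c j * c j)" using l0[OF j(1)] j(2) by (auto simp: zero_less_mult_iff)
      show "0 \<le> l k * (c k * c k)" if "k \<in> {..<i}" for k using l0[of k] that by simp
    qed (use j in auto)
  qed
  ultimately show False by (simp add: ip_commute[of \<sigma> w])
qed

text \<open>The tensor Lagrange polynomials of a \<open>k \<times> \<dots> \<times> k\<close> grid in the equatorial ball, lifted to the sphere
  through the coordinate \<open>j\<close>, are linearly independent on the sphere.\<close>
lemma lagrange_grid:
  fixes j :: 'n and k :: nat
  defines "A \<equiv> PiE (UNIV - {j}) (\<lambda>_. {..<k})"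
  obtains L :: "('n \<Rightarrow> nat) \<Rightarrow> real^'n \<Rightarrow> real" and z :: "('n \<Rightarrow> nat) \<Rightarrow> real^'n"
  where "\<And>a. a \<in> A \<Longrightarrow> degree_le ((CARD('n) - 1) * k) (L a)" "\<And>a. a \<in> A \<Longrightarrow> z a \<in> sphere 0 1"
    "\<And>a b. a \<in> A \<Longrightarrow> b \<in> A \<Longrightarrow> L a (z b) = 0 \<longleftrightarrow> a \<noteq> b"
proof -
  let ?D = "UNIV - {j}"
  \<comment> \<open>The grid spacing keeps each coordinate below \<open>1 / CARD('n)\<close>, so the
    squares sum to at most 1 and leave room for coordinate \<open>j\<close>.\<close>
  define \<epsilon> where "\<epsilon> = 1 / (real k * real CARD('n))"
  define L where "L a x = (\<Prod>i\<in>?D. \<Prod>b\<in>{..<k} - {a i}. (x $ i - real b * \<epsilon>))"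
    for a :: "'n \<Rightarrow> nat" and x :: "real^'n"
  define r where "r a = (\<Sum>i\<in>?D. (real (a i) * \<epsilon>)\<^sup>2)" for a :: "'n \<Rightarrow> nat"
  define z :: "('n \<Rightarrow> nat) \<Rightarrow> real^'n"
    where "z a = (\<chi> i. if i = j then sqrt (1 - r a) else real (a i) * \<epsilon>)" for a
  have aD: "a i < k" if "a \<in> A" "i \<noteq> j" for a i
    using that by (auto simp: A_def PiE_def Pi_def)
  have deg: "degree_le ((CARD('n) - 1) * k) (L a)" for a
  proof -
    have factor: "degree_le 1 (\<lambda>x. x $ i - real b * \<epsilon>)" for i :: 'n and b
      using degree_le.add[OF degree_le_nth degree_le_const[of 1 "- (real b * \<epsilon>)"]] by simp
    have "degree_le (sum (\<lambda>_. k) ?D) (L a)"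
      unfolding L_def[abs_def]
    proof (rule degree_le_prod)
      fix i :: 'n
      have "degree_le (sum (\<lambda>_. 1) ({..<k} - {a i})) (\<lambda>x. \<Prod>b\<in>{..<k} - {a i}. (x $ i - real b * \<epsilon>))"
        by (rule degree_le_prod) (use factor in auto)
      then show "degree_le k (\<lambda>x. \<Prod>b\<in>{..<k} - {a i}. (x $ i - real b * \<epsilon>))"
        by (rule degree_le_mono) (use card_mono[of "{..<k}" "{..<k} - {a i}"] in auto)
    qed simp
    then show ?thesis by simp
  qed
  have sphere: "z a \<in> sphere 0 1" if a: "a \<in> A" for a
  proof -
    have "(real (a i) * \<epsilon>)\<^sup>2 \<le> 1 / real CARD('n)" if i: "i \<in> ?D" for i
    proof -
      have k: "a i < k" using aD[OF a] i by simp
      then have "real (a i) * \<epsilon> \<le> real k * \<epsilon>"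
        by (intro mult_right_mono) (auto simp: \<epsilon>_def)
      also have "\<dots> = 1 / real CARD('n)" using k by (simp add: \<epsilon>_def)
      finally have 1: "real (a i) * \<epsilon> \<le> 1 / real CARD('n)" .
      have 0: "0 \<le> real (a i) * \<epsilon>" by (simp add: \<epsilon>_def)
      have "real (a i) * \<epsilon> \<le> 1" using 1 by (rule order_trans) (simp add: field_simps)
      then have "(real (a i) * \<epsilon>)\<^sup>2 \<le> real (a i) * \<epsilon>"
        using 0 by (simp add: power2_eq_square mult_left_le)
      then show ?thesis using 1 by linarith
    qed
    then have "r a \<le> (\<Sum>i\<in>?D. 1 / real CARD('n))"
      unfolding r_def by (rule sum_mono)
    also have "\<dots> \<le> 1" by (simp add: field_simps)
    finally have r: "r a \<le> 1" .
    have "z a \<bullet> z a = (z a $ j)\<^sup>2 + (\<Sum>i\<in>?D. (z a $ i)\<^sup>2)"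
      unfolding inner_vec_def inner_real_def power2_eq_square by (rule sum.remove) auto
    also have "(\<Sum>i\<in>?D. (z a $ i)\<^sup>2) = r a"
      unfolding r_def by (intro sum.cong) (auto simp: z_def)
    also have "(z a $ j)\<^sup>2 = 1 - r a" using r by (simp add: z_def)
    finally have "z a \<bullet> z a = 1" by simp
    then show ?thesis by (simp add: norm_eq_sqrt_inner)
  qed
  have zero: "L a (z b) = 0 \<longleftrightarrow> a \<noteq> b" if ab: "a \<in> A" "b \<in> A" for a b
  proof -
    have zb: "z b $ i = real (b i) * \<epsilon>" if "i \<in> ?D" for i using that by (simp add: z_def)
    have "L a (z b) = 0 \<longleftrightarrow> (\<exists>i\<in>?D. \<exists>c\<in>{..<k} - {a i}. real (b i) * \<epsilon> - real c * \<epsilon> = 0)"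
      unfolding L_def by (simp add: prod_zero_iff zb cong: bex_cong)
    also have "\<dots> \<longleftrightarrow> (\<exists>i\<in>?D. b i \<noteq> a i)"
    proof (rule bex_cong[OF refl])
      fix i assume i: "i \<in> ?D"
      have b: "b i < k" using aD[OF ab(2)] i by simp
      then have "\<epsilon> \<noteq> 0" by (auto simp: \<epsilon>_def)
      then show "(\<exists>c\<in>{..<k} - {a i}. real (b i) * \<epsilon> - real c * \<epsilon> = 0) \<longleftrightarrow> b i \<noteq> a i"
        using b by auto
    qed
    also have "\<dots> \<longleftrightarrow> a \<noteq> b"
      using PiE_ext[of a ?D "\<lambda>_. {..<k}" b] ab unfolding A_def by metis
    finally show ?thesis .
  qed
  show ?thesis by (rule that[OF deg sphere zero])
qed

text \<open>The Lagrange polynomials of the grid provide \<open>k ^ (CARD('n) - 1)\<close>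
  dimensions of sums of harmonics of degree at most \<open>(CARD('n) - 1) * k\<close>, on which the
  quotient is at least \<tau>. Evaluation at a grid point \<open>z a\<close> isolates the
  coefficient \<open>c a\<close>, so a non-trivial combination does not vanish.\<close>

lemma eigensystem_lower:
  assumes i: "i \<le> k ^ (CARD('n) - 1)" and tau: "\<tau> > 0"
    and N: "\<And>n. n \<le> (CARD('n) - 1) * k \<Longrightarrow> \<tau> \<le> area * \<mu> n"
  shows "\<exists>fs. eigensystem \<sigma> K i \<tau> fs"
proof (rule eigensystem_minimax[OF tau])
  fix p fs assume p: "p < i" and es: "eigensystem \<sigma> K p \<tau> fs"
  obtain j :: 'n where True by simp
  define A where "A = PiE (UNIV - {j}) (\<lambda>_. {..<k})"
  have finA: "finite A" unfolding A_def by (rule finite_PiE) auto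
  have cardA: "card A = k ^ (CARD('n) - 1)"
    unfolding A_def by (subst card_PiE) auto
  obtain L :: "('n \<Rightarrow> nat) \<Rightarrow> real^'n \<Rightarrow> real" and z where L: "\<And>a. a \<in> A \<Longrightarrow> degree_le ((CARD('n) - 1) * k) (L a)"
    and z: "\<And>a. a \<in> A \<Longrightarrow> z a \<in> sphere 0 1"
    and Lz: "\<And>a b. a \<in> A \<Longrightarrow> b \<in> A \<Longrightarrow> L a (z b) = 0 \<longleftrightarrow> a \<noteq> b"
    by (rule lagrange_grid[of j k, folded A_def]) blast
  have LL: "L a \<in> L2 \<sigma>" if "a \<in> A" for a
    using degree_le_continuous[OF L[OF that]] by (intro continuous_L2) simp
  obtain c where c: "\<exists>a\<in>A. c a \<noteq> 0" "\<forall>r\<in>{..<p}. (\<Sum>a\<in>A. ip \<sigma> (L a) (fs r) * c a) = 0"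
    using underdetermined_system[OF finite_lessThan[of p] finA, of "\<lambda>r a. ip \<sigma> (L a) (fs r)"] p i cardA by auto
  define h where "h = (\<lambda>x. \<Sum>a\<in>A. c a * L a x)"
  have hdeg: "degree_le ((CARD('n) - 1) * k) h"
    unfolding h_def using degree_le_mult[OF degree_le_const[of 0] L] by (intro degree_le_sum) simp
  have hL: "h \<in> L2 \<sigma>" unfolding h_def by (rule L2_sum) (rule LL)
  have "ip \<sigma> h (fs r) = 0" if "r < p" for r
  proof -
    have "ip \<sigma> h (fs r) = (\<Sum>a\<in>A. c a * ip \<sigma> (L a) (fs r))"
      unfolding h_def by (rule ip_sum[OF LL eigensystemD(1)[OF es that]])
    then show ?thesis using c(2) that by (simp add: mult.commute)
  qed
  then have "h \<in> orth p fs" using hL by (simp add: orth_def)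
  moreover have "\<tau> * ip \<sigma> h h \<le> ip \<sigma> (op h) h"
    by (rule op_harmonic_sum_ge[OF degree_le_harmonic_sum[OF hdeg] N])
  moreover have "ip \<sigma> h h > 0"
  proof -
    obtain a where a: "a \<in> A" "c a \<noteq> 0" using c(1) by auto
    have "h (z a) = (\<Sum>b\<in>A. if b = a then c a * L a (z a) else 0)"
      unfolding h_def using Lz[OF _ a(1)] by (intro sum.cong) auto
    then have "h (z a) \<noteq> 0" using finA a Lz[OF a(1) a(1)] by simp
    moreover have "continuous_on (sphere 0 1) h" by (rule degree_le_continuous[OF hdeg])
    ultimately show ?thesis using ip_self_pos z[OF a(1)] by blast
  qed
  ultimately show "\<exists>h\<in>orth p fs. ip \<sigma> h h > 0 \<and> \<tau> * ip \<sigma> h h \<le> ip \<sigma> (op h) h" by blast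
qed

end

section \<open>Regularity of the eigenvalue sequence\<close>

text \<open>If the ratios \<open>\<mu> (2 n + 2) / \<mu> n\<close> were not bounded away from 0, levels \<open>\<delta>\<close> just below \<open>\<mu> n\<close> and
  \<open>e = \<mu> (2 n + 2)\<close> would satisfy \<open>e = o(\<delta>)\<close> although \<open>N(e) \<le> 2 N(\<delta>) + 1\<close>.\<close>
lemma EDR_doubling:
  assumes "EDR d \<mu>"
  shows "\<exists>c>0. \<forall>n. c * \<mu> n \<le> \<mu> (2 * n + 2)"
proof -
  have pos: "\<mu> n > 0" and dec: "m \<le> n \<Longrightarrow> \<mu> n \<le> \<mu> m" for m n
    using assms by (auto simp: EDR_def decseq_def)
  have little: "(\<lambda>k. real (edr_N \<mu> (\<delta> k))) \<in> o(\<lambda>k. real (edr_N \<mu> (e k)))"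
    if "\<And>k::nat. e k > 0" "\<And>k. \<delta> k > 0" "e \<longlonglongrightarrow> 0" "\<delta> \<longlonglongrightarrow> 0" "e \<in> o(\<delta>)" for e \<delta>
    using assms that unfolding EDR_def by blast
  show ?thesis
  proof (cases "\<exists>\<epsilon>>0. \<forall>n. \<mu> n \<ge> \<epsilon>")
    \<comment> \<open>Here small levels are exceeded by all \<open>\<mu> n\<close>, and
      \<open>Max\<close> in \<open>edr_N\<close> is taken over an infinite set. The ratios are
      bounded below directly by \<open>\<epsilon> / \<mu> 0\<close>.\<close>
    case True
    then obtain \<epsilon> where \<epsilon>: "\<epsilon> > 0" "\<And>n. \<mu> n \<ge> \<epsilon>" by blast
    have "\<epsilon> / \<mu> 0 * \<mu> n \<le> \<mu> (2 * n + 2)" for n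
    proof -
      have "\<epsilon> / \<mu> 0 * \<mu> n \<le> \<epsilon> / \<mu> 0 * \<mu> 0"
        using dec[of 0 n] pos[of 0] \<epsilon>(1) by (intro mult_left_mono) auto
      also have "\<dots> = \<epsilon>" using pos[of 0] by simp
      finally show ?thesis using \<epsilon>(2)[of "2 * n + 2"] by simp
    qed
    moreover have "\<epsilon> / \<mu> 0 > 0" using \<epsilon>(1) pos[of 0] by simp
    ultimately show ?thesis by blast
  next
    case False
    have small: "\<exists>n. \<mu> n < \<epsilon>" if "\<epsilon> > 0" for \<epsilon>
      using False that by (metis not_le)
    have lim: "\<mu> \<longlonglongrightarrow> 0"
    proof (rule LIMSEQ_I)
      fix r :: real assume "0 < r"
      then obtain n where n: "\<mu> n < r" using small by blast
      have "norm (\<mu> m - 0) < r" if "m \<ge> n" for m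
        using dec[OF that] n pos[of m] by simp
      then show "\<exists>no. \<forall>m\<ge>no. norm (\<mu> m - 0) < r" by blast
    qed
    have fin: "finite {n. \<mu> n > \<epsilon>}" if \<epsilon>: "\<epsilon> > 0" for \<epsilon>
    proof -
      obtain n where n: "\<mu> n < \<epsilon>" using small[OF \<epsilon>] by blast
      have "m \<le> n" if "\<mu> m > \<epsilon>" for m
        using dec[of n m] that n by (cases "m \<le> n") auto
      then have "{m. \<mu> m > \<epsilon>} \<subseteq> {..n}" by auto
      then show ?thesis by (rule finite_subset) simp
    qed
    show ?thesis
    proof (rule ccontr)
      assume neg: "\<not> ?thesis"
      have "\<exists>n. \<mu> (2 * n + 2) < 1 / real (Suc k) * \<mu> n" for k
      proof -
        have "(0::real) < 1 / real (Suc k)" by simp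
        then show ?thesis using neg by (metis not_le)
      qed
      then obtain s where s: "\<And>k. \<mu> (2 * s k + 2) < 1 / real (Suc k) * \<mu> (s k)" by metis
      define e where "e k = \<mu> (2 * s k + 2)" for k
      \<comment> \<open>Halving makes the inequality in \<open>edr_N\<close> strict, so that
        \<open>s k\<close> itself is counted.\<close>
      define \<delta> where "\<delta> k = \<mu> (s k) / 2" for k
      have inv_lim: "(\<lambda>k. a / real (Suc k)) \<longlonglongrightarrow> 0" for a
        using tendsto_mult_right_zero[OF LIMSEQ_inverse_real_of_nat, of a] by (simp add: divide_inverse)
      have e_lim: "e \<longlonglongrightarrow> 0"
      proof (rule tendsto_sandwich[where f = "\<lambda>_. 0" and h = "\<lambda>k. \<mu> 0 / real (Suc k)"])
        have "e k \<le> \<mu> 0 / real (Suc k)" for k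
        proof -
          have "1 / real (Suc k) * \<mu> (s k) \<le> 1 / real (Suc k) * \<mu> 0"
            using dec[of 0 "s k"] by (intro mult_left_mono) auto
          then show ?thesis using s[of k] by (simp add: e_def)
        qed
        then show "\<forall>\<^sub>F k in sequentially. e k \<le> \<mu> 0 / real (Suc k)" by simp
        show "\<forall>\<^sub>F k in sequentially. 0 \<le> e k" using pos by (simp add: e_def less_imp_le)
      qed (rule tendsto_const, rule inv_lim)
      \<comment> \<open>The values \<open>e k\<close> tend to 0 while every \<open>\<mu> n\<close>
        is positive, so the indices \<open>s k\<close> are unbounded; this gives the limit of
        \<delta> and, at the end, \<open>s k \<ge> 1\<close>.\<close>
      have s_large: "\<forall>\<^sub>F k in sequentially. n \<le> s k" for n
      proof -
        have "\<forall>\<^sub>F k in sequentially. e k < \<mu> (2 * n)"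
          using order_tendstoD(2)[OF e_lim pos] .
        then show ?thesis
        proof eventually_elim
          case (elim k)
          show ?case
          proof (rule ccontr)
            assume "\<not> n \<le> s k"
            then have "2 * s k + 2 \<le> 2 * n" by simp
            then show False using dec[of "2 * s k + 2" "2 * n"] elim by (simp add: e_def)
          qed
        qed
      qed
      then have "filterlim s at_top sequentially" by (simp add: filterlim_at_top)
      then have "(\<lambda>k. \<mu> (s k)) \<longlonglongrightarrow> 0" by (rule filterlim_compose[OF lim])
      then have \<delta>_lim: "\<delta> \<longlonglongrightarrow> 0" unfolding \<delta>_def by (rule tendsto_divide_zero)
      have "(\<lambda>k. e k / \<delta> k) \<longlonglongrightarrow> 0"
      proof (rule tendsto_sandwich[where f = "\<lambda>_. 0" and h = "\<lambda>k. 2 / real (Suc k)"])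
        have "e k / \<delta> k \<le> 2 / real (Suc k)" for k
          using s[of k] pos[of "s k"] by (simp add: e_def \<delta>_def field_simps)
        then show "\<forall>\<^sub>F k in sequentially. e k / \<delta> k \<le> 2 / real (Suc k)" by simp
        show "\<forall>\<^sub>F k in sequentially. 0 \<le> e k / \<delta> k" using pos by (simp add: e_def \<delta>_def less_imp_le)
      qed (rule tendsto_const, rule inv_lim)
      moreover have "\<delta> k > 0" "e k > 0" for k using pos by (auto simp: \<delta>_def e_def)
      ultimately have "e \<in> o(\<delta>)"
        by (intro smalloI_tendsto) (auto simp: less_imp_neq[THEN not_sym])
      then have "(\<lambda>k. real (edr_N \<mu> (\<delta> k))) \<in> o(\<lambda>k. real (edr_N \<mu> (e k)))"
        using \<open>\<And>k. \<delta> k > 0\<close> \<open>\<And>k. e k > 0\<close> e_lim \<delta>_lim by (intro little)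
      \<comment> \<open>With the factor 1/4 the counts yield
        \<open>s k \<le> (2 * s k + 1) / 4\<close>, impossible for
        \<open>s k \<ge> 1\<close>.\<close>
      then have "\<forall>\<^sub>F k in sequentially. norm (real (edr_N \<mu> (\<delta> k))) \<le> 1/4 * norm (real (edr_N \<mu> (e k)))"
        by (rule landau_o.smallD) simp
      then have "\<forall>\<^sub>F k in sequentially. False"
        using s_large[of 1]
      proof eventually_elim
        case (elim k)
        have "s k \<le> edr_N \<mu> (\<delta> k)"
          unfolding edr_N_def using pos[of "s k"]
          by (intro Max_ge fin) (auto simp: \<delta>_def)
        moreover have "edr_N \<mu> (e k) \<le> 2 * s k + 1"
          unfolding edr_N_def
        proof (rule Max.boundedI)
          show "finite {n. e k < \<mu> n}" using \<open>\<And>k. e k > 0\<close> by (rule fin)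
          have "1 / real (Suc k) * \<mu> (s k) \<le> 1 * \<mu> (s k)"
            using pos[of "s k"] by (intro mult_right_mono) auto
          then have "e k < \<mu> (s k)" using s[of k] by (simp add: e_def)
          then show "{n. e k < \<mu> n} \<noteq> {}" by blast
          fix n assume "n \<in> {n. e k < \<mu> n}"
          then have "\<mu> (2 * s k + 2) < \<mu> n" by (simp add: e_def)
          then have "\<not> 2 * s k + 2 \<le> n" using dec[of "2 * s k + 2" n] by linarith
          then show "n \<le> 2 * s k + 1" by simp
        qed
        ultimately have "real (s k) \<le> 1/4 * real (2 * s k + 1)"
          using elim(1) by simp
        then show False using elim(2) by simp
      qed
      then show False by simp
    qed
  qed
qed

text \<open>The map from \<open>n\<close> to \<open>2 n + 2\<close>, iterated \<open>j\<close>
  times, sends \<open>n\<close> to \<open>2 ^ j * (n + 2) - 2\<close>. For \<open>j = A + 1\<close>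
  this is at least \<open>A * (n + 1)\<close>, and \<mu> decreases.\<close>

lemma EDR_dilation:
  assumes "EDR d \<mu>"
  shows "\<exists>c>0. \<forall>n. c * \<mu> n \<le> \<mu> (A * (n + 1))"
proof -
  have dec: "m \<le> n \<Longrightarrow> \<mu> n \<le> \<mu> m" for m n
    using assms by (auto simp: EDR_def decseq_def)
  obtain c where c: "c > 0" "\<And>n. c * \<mu> n \<le> \<mu> (2 * n + 2)"
    using EDR_doubling[OF assms] by blast
  have iter: "c ^ j * \<mu> n \<le> \<mu> (2 ^ j * (n + 2) - 2)" for j n
  proof (induction j)
    case (Suc j)
    have "c ^ Suc j * \<mu> n \<le> c * \<mu> (2 ^ j * (n + 2) - 2)"
      using Suc c(1) by (simp add: mult.assoc)
    also have "\<dots> \<le> \<mu> (2 * (2 ^ j * (n + 2) - 2) + 2)" by (rule c(2))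
    also have "2 * (2 ^ j * (n + 2) - 2) + 2 = 2 ^ Suc j * (n + 2) - 2"
    proof -
      have "(2::nat) \<le> 2 ^ j * (n + 2)"
        using mult_le_mono[of 1 "2 ^ j" 2 "n + 2"] by simp
      then show ?thesis by (simp add: algebra_simps)
    qed
    finally show ?case .
  qed simp
  have "c ^ (A + 1) * \<mu> n \<le> \<mu> (A * (n + 1))" for n
  proof -
    have "A + 1 \<le> 2 ^ (A + 1)" using less_exp[of "A + 1"] by simp
    then have "(A + 1) * (n + 2) \<le> 2 ^ (A + 1) * (n + 2)" by (rule mult_right_mono) simp
    moreover have "A * (n + 1) + 2 \<le> (A + 1) * (n + 2)" by (simp add: algebra_simps)
    ultimately have "A * (n + 1) \<le> 2 ^ (A + 1) * (n + 2) - 2" by linarith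
    then show ?thesis using iter[of "A + 1" n] dec by (meson order_trans)
  qed
  then show ?thesis using c(1) by (intro exI[of _ "c ^ (A + 1)"]) auto
qed

text \<open>Let \<open>N\<close> be the first degree with \<open>area * c2 * \<mu>' N < t\<close>.
  The upper count gives \<open>i \<le> 2 N ^ D\<close> with \<open>D = CARD('n) - 1\<close>, so
  \<open>m * i \<le> (2 m N) ^ D\<close>, and the lower count with a grid of size
  \<open>2 m N\<close> yields that many eigenfunctions. The degrees involved are at most
  \<open>D * (2 m N)\<close>, where \<open>\<mu>'\<close> is still comparable to its value at
  \<open>N - 1\<close>, the last degree at which level \<open>t\<close> was not undercut. The counts
  run through \<open>\<mu>'\<close> because \<mu> itself need not be monotone.\<close>

lemma (in dot_kernel) eigensystem_multiply:
  assumes edr: "EDR d \<mu>'" and c12: "c1 > 0" "c2 > 0"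
    and equiv: "\<And>n. c1 * \<mu>' n \<le> \<mu> n" "\<And>n. \<mu> n \<le> c2 * \<mu>' n" and m: "m > 0"
  shows "\<exists>c>0. \<forall>i>0. \<forall>t>0. \<forall>fs. eigensystem \<sigma> K i t fs \<longrightarrow> (\<exists>gs. eigensystem \<sigma> K (m * i) (c * t) gs)"
proof -
  let ?D = "CARD('n) - 1"
  have D: "?D \<ge> 1" using dim by simp
  have pos: "\<mu>' n > 0" and dec: "m \<le> n \<Longrightarrow> \<mu>' n \<le> \<mu>' m" for m n
    using edr by (auto simp: EDR_def decseq_def)
  \<comment> \<open>With \<open>N = n0 + 1\<close>, the degree bound \<open>D * (2 m N)\<close> of
    the lower count is \<open>A * (n0 + 1)\<close>.\<close>
  define A where "A = ?D * (2 * m)"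
  obtain a where a: "a > 0" "\<And>n. a * \<mu>' n \<le> \<mu>' (A * (n + 1))"
    using EDR_dilation[OF edr] by blast
  have "a * \<mu>' 0 \<le> 1 * \<mu>' 0" using a(2)[of 0] dec[of 0 "A * (0 + 1)"] by simp
  then have a1: "a \<le> 1" using pos[of 0] by (simp only: mult_le_cancel_right_pos)
  define c where "c = c1 * a / c2"
  have c: "c > 0" using a(1) c12 by (simp add: c_def)
  have level: "c * t \<le> area * \<mu> n" if "t \<le> area * c2 * s" "a * s \<le> \<mu>' n" "t > 0" for s t n
  proof -
    have "c * t \<le> c * (area * c2 * s)" using that(1) c by (intro mult_left_mono) auto
    also have "\<dots> = area * c1 * (a * s)" using c12 by (simp add: c_def)
    also have "\<dots> \<le> area * c1 * \<mu>' n" using that(2) area_pos c12 by (intro mult_left_mono) auto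
    also have "\<dots> \<le> area * \<mu> n" using equiv(1)[of n] area_pos by simp
    finally show ?thesis .
  qed
  have "\<exists>gs. eigensystem \<sigma> K (m * i) (c * t) gs" if i: "i > 0" and t: "t > 0" and es: "eigensystem \<sigma> K i t fs" for i t fs
  proof (cases "\<exists>N. area * c2 * \<mu>' N < t")
    case True
    define N where "N = (LEAST N. area * c2 * \<mu>' N < t)"
    have N: "area * c2 * \<mu>' N < t" unfolding N_def using True by (rule LeastI_ex)
    have bound: "i \<le> 2 * N ^ ?D"
    proof (rule eigensystem_upper[OF es t])
      fix n assume "n \<ge> N"
      have "area * \<mu> n \<le> area * (c2 * \<mu>' n)" using equiv(2)[of n] area_pos by simp
      also have "\<dots> \<le> area * (c2 * \<mu>' N)"
        using dec[OF \<open>n \<ge> N\<close>] area_pos c12 by (intro mult_left_mono) auto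
      finally show "area * \<mu> n < t" using N by (simp add: mult.assoc)
    qed
    then have "N \<noteq> 0" using i D by (metis le_zero_eq mult_0_right not_gr_zero not_one_le_zero power_0_left)
    then obtain n0 where n0: "N = n0 + 1" by (metis Suc_eq_plus1 not0_implies_Suc)
    then have ge: "t \<le> area * c2 * \<mu>' n0"
      using not_less_Least[of n0 "\<lambda>N. area * c2 * \<mu>' N < t"] N_def by simp
    have "m * i \<le> m * (2 * N ^ ?D)" using bound by (rule mult_le_mono2)
    also have "\<dots> = 2 * m * N ^ ?D" by simp
    also have "\<dots> \<le> (2 * m * N) ^ ?D"
      unfolding power_mult_distrib[of "2 * m"] using m D by (intro mult_right_mono self_le_power) auto
    finally have "m * i \<le> (2 * m * N) ^ ?D" .
    then show ?thesis
    proof (rule eigensystem_lower)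
      show "0 < c * t" using c t by simp
      show "c * t \<le> area * \<mu> n" if "n \<le> ?D * (2 * m * N)" for n
      proof (rule level[OF ge _ t])
        have "n \<le> A * (n0 + 1)" using that unfolding A_def n0 by (simp only: mult.assoc)
        then show "a * \<mu>' n0 \<le> \<mu>' n" using a(2)[of n0] dec by (meson order_trans)
      qed
    qed
  next
    \<comment> \<open>Every degree stays above the level, so the count is unrestricted: grid size
      \<open>m * i\<close> suffices, and \<open>a \<le> 1\<close> absorbs the dilation
      constant.\<close>
    case False
    have "m * i \<le> (m * i) ^ ?D" using m i D by (intro self_le_power) auto
    then show ?thesis
    proof (rule eigensystem_lower)
      show "0 < c * t" using c t by simp
      show "c * t \<le> area * \<mu> n" for n
      proof (rule level[of _ "\<mu>' n", OF _ _ t])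
        show "t \<le> area * c2 * \<mu>' n" using False by (simp add: not_less)
        show "a * \<mu>' n \<le> \<mu>' n" using a1 pos[of n] by simp
      qed
    qed
  qed
  then show ?thesis using c by blast
qed

section \<open>Comparison of the weighted and the unweighted operator\<close>

text \<open>The preimage of an open set is a relatively open set together with a subset of the
  discontinuity set. That subset is measurable because the surface measure is complete.\<close>

lemma riemann_integrable_sphere_measurable:
  fixes \<rho> :: "real^'n \<Rightarrow> real"
  assumes "riemann_integrable_sphere \<rho>"
  shows "\<rho> \<in> borel_measurable sphere_measure"
proof (rule borel_measurableI)
  fix U :: "real set" assume U: "open U"
  let ?S = "sphere 0 1 :: (real^'n) set"
  define D where "D = {x\<in>?S. \<not> continuous (at x within ?S) \<rho>}"
  have D: "D \<in> null_sets sphere_measure"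
    using assms by (simp add: riemann_integrable_sphere_def D_def)
  define V where "V = \<Union>{T. open T \<and> T \<inter> ?S \<subseteq> \<rho> -` U}"
  have V: "open V" "V \<inter> ?S \<subseteq> \<rho> -` U" by (auto simp: V_def)
  have cover: "x \<in> V \<or> x \<in> D" if x: "x \<in> ?S" "\<rho> x \<in> U" for x
  proof (cases "x \<in> D")
    case False
    then have "continuous (at x within ?S) \<rho>" using x by (simp add: D_def)
    then have "(\<rho> \<longlongrightarrow> \<rho> x) (at x within ?S)" by (simp add: continuous_within)
    then have "eventually (\<lambda>y. \<rho> y \<in> U) (at x within ?S)"
      using U x(2) by (simp add: tendsto_def)
    then obtain T where T: "open T" "x \<in> T" "\<And>y. y \<in> T \<Longrightarrow> y \<noteq> x \<Longrightarrow> y \<in> ?S \<Longrightarrow> \<rho> y \<in> U"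
      unfolding eventually_at_topological by blast
    have "T \<inter> ?S \<subseteq> \<rho> -` U"
    proof
      fix y assume "y \<in> T \<inter> ?S"
      then show "y \<in> \<rho> -` U" using T(3)[of y] x(2) by (cases "y = x") auto
    qed
    then have "open T \<and> T \<inter> ?S \<subseteq> \<rho> -` U \<and> x \<in> T" using T by auto
    then show ?thesis unfolding V_def by blast
  qed simp
  have eq: "\<rho> -` U \<inter> space sphere_measure = (V \<inter> ?S) \<union> (\<rho> -` U \<inter> ?S \<inter> D)"
    unfolding space_sphere_measure using V(2) cover by blast
  have "V \<inter> ?S \<in> sets borel_sphere_measure"
    using V(1) by (auto simp: sets_restrict_space)
  then have "V \<inter> ?S \<in> sets sphere_measure"
    unfolding sphere_measure_completion by (rule sets_completionI_sets)
  moreover have "\<rho> -` U \<inter> ?S \<inter> D \<in> null_sets sphere_measure"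
    using D unfolding sphere_measure_completion by (rule null_sets_completion_subset[rotated]) auto
  ultimately show "\<rho> -` U \<inter> space sphere_measure \<in> sets sphere_measure"
    unfolding eq by (auto simp: null_sets_def)
qed

text \<open>A function vanishing at all its continuity points would vanish almost everywhere. Near a
  continuity point with non-zero value, \<rho> keeps at least half of that value in modulus.\<close>

lemma riemann_integrable_sphere_lower_bound:
  fixes \<rho> :: "real^'n \<Rightarrow> real"
  assumes ri: "riemann_integrable_sphere \<rho>" and nz: "\<not> (AE x in sphere_measure. \<rho> x = 0)"
  obtains z r c where "z \<in> sphere 0 1" "r > 0" "c > 0"
    "\<And>x. x \<in> sphere 0 1 \<Longrightarrow> x \<in> ball z r \<Longrightarrow> c \<le> (\<rho> x)\<^sup>2"
proof -
  let ?S = "sphere 0 1 :: (real^'n) set"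
  define D where "D = {x\<in>?S. \<not> continuous (at x within ?S) \<rho>}"
  have D: "D \<in> null_sets sphere_measure"
    using ri by (simp add: riemann_integrable_sphere_def D_def)
  have "\<exists>z\<in>?S. z \<notin> D \<and> \<rho> z \<noteq> 0"
  proof (rule ccontr)
    assume "\<not> ?thesis"
    then have "{x \<in> space sphere_measure. \<rho> x \<noteq> 0} \<subseteq> D" by auto
    then have "AE x in sphere_measure. \<rho> x = 0" by (rule AE_I'[OF D])
    then show False using nz by blast
  qed
  then obtain z where z: "z \<in> ?S" "z \<notin> D" "\<rho> z \<noteq> 0" by blast
  then have "continuous (at z within ?S) \<rho>" by (simp add: D_def)
  moreover have "\<bar>\<rho> z\<bar> / 2 > 0" using z(3) by simp
  ultimately obtain r where r: "r > 0"
    "\<And>x. x \<in> ?S \<Longrightarrow> dist x z < r \<Longrightarrow> dist (\<rho> x) (\<rho> z) < \<bar>\<rho> z\<bar> / 2"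
    unfolding continuous_within_eps_delta by blast
  have "(\<bar>\<rho> z\<bar> / 2)\<^sup>2 \<le> (\<rho> x)\<^sup>2" if "x \<in> ?S" "x \<in> ball z r" for x
  proof -
    have "\<bar>\<rho> x - \<rho> z\<bar> < \<bar>\<rho> z\<bar> / 2"
      using r(2)[OF that(1)] that(2) by (simp add: dist_commute dist_real_def)
    then have "\<bar>\<rho> z\<bar> / 2 \<le> \<bar>\<rho> x\<bar>" by arith
    then have "(\<bar>\<rho> z\<bar> / 2)\<^sup>2 \<le> \<bar>\<rho> x\<bar>\<^sup>2" by (intro power_mono) auto
    then show ?thesis by simp
  qed
  then show ?thesis using z r(1) by (intro that[of z r "(\<bar>\<rho> z\<bar> / 2)\<^sup>2"]) auto
qed

section \<open>Transfer of eigensystems between the two measures\<close>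

locale weighted_dot_kernel = dot_kernel f B area \<mu> K
  for f B area \<mu> and K :: "real^'n \<Rightarrow> real^'n \<Rightarrow> real" +
  fixes \<rho> :: "real^'n \<Rightarrow> real" and b :: real
  assumes \<rho>_measurable: "\<rho> \<in> borel_measurable sphere_measure"
    and \<rho>_bound: "\<And>x. x \<in> sphere 0 1 \<Longrightarrow> \<bar>\<rho> x\<bar> \<le> b"
    and b_pos: "b > 0"
begin

abbreviation "\<nu> \<equiv> density (sphere_measure :: (real^'n) measure) (\<lambda>x. ennreal ((\<rho> x)\<^sup>2))"

lemma \<rho>_square_bound: "x \<in> sphere 0 1 \<Longrightarrow> (\<rho> x)\<^sup>2 \<le> b\<^sup>2"
  using \<rho>_bound[of x] by (metis abs_ge_zero power2_abs power_mono)

lemma finite_measure_\<nu>: "finite_measure \<nu>"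
proof (rule finite_measureI)
  have int: "integrable \<sigma> (\<lambda>x. (\<rho> x)\<^sup>2)"
    using \<rho>_measurable \<rho>_square_bound by (intro integrable_const_bound[of _ "b\<^sup>2"]) auto
  have "emeasure \<nu> (space \<nu>) = (\<integral>\<^sup>+x. ennreal ((\<rho> x)\<^sup>2) * indicator (space \<sigma>) x \<partial>\<sigma>)"
    using \<rho>_measurable by (simp add: emeasure_density del: space_sphere_measure)
  also have "\<dots> = (\<integral>\<^sup>+x. ennreal ((\<rho> x)\<^sup>2) \<partial>\<sigma>)"
    by (intro nn_integral_cong) simp
  also have "\<dots> = ennreal (LINT x|\<sigma>. (\<rho> x)\<^sup>2)"
    using int by (intro nn_integral_eq_integral) auto
  finally show "emeasure \<nu> (space \<nu>) \<noteq> \<infinity>" by simp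
qed

sublocale N: kernel_operator \<nu> K B
  unfolding K_eq by (rule kernel_operator_sphere[OF finite_measure_\<nu> _ f_cont f_bound]) auto

lemma ip_weight:
  assumes "u \<in> borel_measurable \<sigma>" "v \<in> borel_measurable \<sigma>"
  shows "ip \<nu> u v = ip \<sigma> (\<lambda>x. (\<rho> x)\<^sup>2 * u x) v"
  unfolding ip_def using assms \<rho>_measurable
  by (subst integral_density) (auto simp: mult.assoc)

lemma L2_weight_measurable: "u \<in> L2 \<nu> \<Longrightarrow> u \<in> borel_measurable \<sigma>"
  using L2_measurable[of u \<nu>] by simp

text \<open>One factor \<open>(\<rho> x)\<^sup>2\<close> of the squared product is absorbed by the
  density, the other one is bounded by \<open>b\<^sup>2\<close>.\<close>

lemma L2_weight:
  assumes u: "u \<in> L2 \<nu>"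
  shows "(\<lambda>x. (\<rho> x)\<^sup>2 * u x) \<in> L2 \<sigma>"
    "ip \<sigma> (\<lambda>x. (\<rho> x)\<^sup>2 * u x) (\<lambda>x. (\<rho> x)\<^sup>2 * u x) \<le> b\<^sup>2 * ip \<nu> u u"
proof -
  have um: "u \<in> borel_measurable \<sigma>" using u by (rule L2_weight_measurable)
  have int: "integrable \<sigma> (\<lambda>x. (\<rho> x)\<^sup>2 * (u x)\<^sup>2)"
  proof -
    have "integrable \<nu> (\<lambda>x. (u x)\<^sup>2)" using u by (simp add: L2_def)
    then show ?thesis
      using um \<rho>_measurable by (subst (asm) integrable_density) auto
  qed
  have le: "((\<rho> x)\<^sup>2 * u x)\<^sup>2 \<le> b\<^sup>2 * ((\<rho> x)\<^sup>2 * (u x)\<^sup>2)" if "x \<in> sphere 0 1" for x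
  proof -
    have "((\<rho> x)\<^sup>2 * u x)\<^sup>2 = (\<rho> x)\<^sup>2 * ((\<rho> x)\<^sup>2 * (u x)\<^sup>2)"
      by (simp add: power2_eq_square mult_ac)
    also have "\<dots> \<le> b\<^sup>2 * ((\<rho> x)\<^sup>2 * (u x)\<^sup>2)"
      using \<rho>_square_bound[OF that] by (intro mult_right_mono) auto
    finally show ?thesis .
  qed
  have int2: "integrable \<sigma> (\<lambda>x. ((\<rho> x)\<^sup>2 * u x)\<^sup>2)"
  proof (rule Bochner_Integration.integrable_bound)
    show "integrable \<sigma> (\<lambda>x. b\<^sup>2 * ((\<rho> x)\<^sup>2 * (u x)\<^sup>2))" using int by simp
    show "AE x in \<sigma>. norm (((\<rho> x)\<^sup>2 * u x)\<^sup>2) \<le> norm (b\<^sup>2 * ((\<rho> x)\<^sup>2 * (u x)\<^sup>2))"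
      using le by (intro AE_I2) simp
  qed (use um \<rho>_measurable in measurable)
  show L: "(\<lambda>x. (\<rho> x)\<^sup>2 * u x) \<in> L2 \<sigma>"
    using int2 um \<rho>_measurable by (simp add: L2_def)
  have "ip \<sigma> (\<lambda>x. (\<rho> x)\<^sup>2 * u x) (\<lambda>x. (\<rho> x)\<^sup>2 * u x) \<le> (LINT x|\<sigma>. b\<^sup>2 * ((\<rho> x)\<^sup>2 * (u x)\<^sup>2))"
    unfolding ip_def using int int2 le by (intro integral_mono) (auto simp: power2_eq_square)
  also have "\<dots> = b\<^sup>2 * ip \<nu> u u"
    unfolding ip_weight[OF um um] by (simp add: ip_def power2_eq_square mult.assoc)
  finally show "ip \<sigma> (\<lambda>x. (\<rho> x)\<^sup>2 * u x) (\<lambda>x. (\<rho> x)\<^sup>2 * u x) \<le> b\<^sup>2 * ip \<nu> u u" .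
qed

lemma op_weight:
  assumes "u \<in> L2 \<nu>" "x \<in> sphere 0 1"
  shows "N.op u x = op (\<lambda>x. (\<rho> x)\<^sup>2 * u x) x"
proof -
  have "N.op u x = ip \<nu> u (K x)" by (simp add: N.op_ip ip_commute)
  also have "\<dots> = ip \<sigma> (\<lambda>x. (\<rho> x)\<^sup>2 * u x) (K x)"
    using assms by (intro ip_weight L2_weight_measurable K_section_measurable) auto
  also have "\<dots> = op (\<lambda>x. (\<rho> x)\<^sup>2 * u x) x" by (simp add: op_ip ip_commute)
  finally show ?thesis .
qed

text \<open>Multiplication by \<open>\<rho>\<^sup>2\<close> carries the weighted form exactly to the
  unweighted one; only the norms have to be compared.\<close>

lemma ip_op_weight:
  assumes u: "u \<in> L2 \<nu>"
  shows "ip \<nu> (N.op u) u = ip \<sigma> (op (\<lambda>x. (\<rho> x)\<^sup>2 * u x)) (\<lambda>x. (\<rho> x)\<^sup>2 * u x)"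
proof -
  have "ip \<nu> (N.op u) u = ip \<nu> u (N.op u)" by (rule ip_commute)
  also have "\<dots> = ip \<sigma> (\<lambda>x. (\<rho> x)\<^sup>2 * u x) (N.op u)"
    using u N.op_L2[OF u] by (intro ip_weight L2_weight_measurable)
  also have "\<dots> = ip \<sigma> (N.op u) (\<lambda>x. (\<rho> x)\<^sup>2 * u x)" by (rule ip_commute)
  also have "\<dots> = ip \<sigma> (op (\<lambda>x. (\<rho> x)\<^sup>2 * u x)) (\<lambda>x. (\<rho> x)\<^sup>2 * u x)"
    by (rule ip_cong_space) (use op_weight[OF u] in auto)
  finally show ?thesis .
qed

text \<open>Under multiplication by \<open>\<rho>\<^sup>2\<close> the form is preserved while the
  squared norm grows by at most \<open>b\<^sup>2\<close>, which costs the factor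
  \<open>1 / b\<^sup>2\<close> in the quotient.\<close>

lemma eigensystem_from_weight:
  assumes es: "eigensystem \<nu> K i t fs" and t: "t > 0"
  shows "\<exists>gs. eigensystem \<sigma> K i (1 / b\<^sup>2 * t) gs"
proof (rule eigensystem_minimax)
  show "0 < 1 / b\<^sup>2 * t" using t b_pos by simp
  fix p gs assume p: "p < i" and gs: "eigensystem \<sigma> K p (1 / b\<^sup>2 * t) gs"
  obtain e where e: "\<And>j. j < i \<Longrightarrow> continuous_on (space \<nu>) (e j)" "eigensystem \<nu> K i t e"
    "\<And>j. j < i \<Longrightarrow> \<exists>l\<ge>t. \<forall>x\<in>space \<nu>. N.op (e j) x = l * e j x"
    by (rule N.eigensystem_continuous[OF es t]) blast
  obtain l where l: "\<And>j. j < i \<Longrightarrow> l j \<ge> t" "\<And>j x. j < i \<Longrightarrow> x \<in> space \<nu> \<Longrightarrow> N.op (e j) x = l j * e j x"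
    using e(3) by metis
  have eL: "\<And>j. j < i \<Longrightarrow> e j \<in> L2 \<nu>"
    and orthonormal: "\<And>j k. j < i \<Longrightarrow> k < i \<Longrightarrow> ip \<nu> (e j) (e k) = (if j = k then 1 else 0)"
    using e(2) by (auto simp: eigensystem_def)
  define E where "E j = (\<lambda>x. (\<rho> x)\<^sup>2 * e j x)" for j
  have EL: "E j \<in> L2 \<sigma>" if "j < i" for j unfolding E_def by (rule L2_weight(1)[OF eL[OF that]])
  obtain c where c: "\<exists>j\<in>{..<i}. c j \<noteq> 0" "\<forall>r\<in>{..<p}. (\<Sum>j<i. ip \<sigma> (E j) (gs r) * c j) = 0"
    using underdetermined_system[OF finite_lessThan[of p] finite_lessThan[of i], of "\<lambda>r j. ip \<sigma> (E j) (gs r)"] p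
    by auto
  define w where "w = (\<lambda>x. \<Sum>j<i. c j * e j x)"
  have wL: "w \<in> L2 \<nu>" unfolding w_def by (rule L2_sum) (use eL in auto)
  define h where "h = (\<lambda>x. (\<rho> x)\<^sup>2 * w x)"
  have h_sum: "h = (\<lambda>x. \<Sum>j<i. c j * E j x)"
    by (simp add: h_def w_def E_def sum_distrib_left mult.left_commute)
  have hL: "h \<in> L2 \<sigma>" unfolding h_def by (rule L2_weight(1)[OF wL])
  have "ip \<sigma> h (gs r) = 0" if "r < p" for r
  proof -
    have "ip \<sigma> h (gs r) = (\<Sum>j<i. c j * ip \<sigma> (E j) (gs r))"
      unfolding h_sum by (rule ip_sum) (use EL eigensystemD(1)[OF gs that] in auto)
    then show ?thesis using c(2) that by (simp add: mult.commute)
  qed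
  then have orth: "h \<in> orth p gs" using hL by (simp add: orth_def)
  have ww: "ip \<nu> w w = (\<Sum>j<i. c j * c j)"
    unfolding w_def by (rule N.eigensystem_span(1)[OF eL orthonormal l(2)])
  have opww: "ip \<nu> (N.op w) w = (\<Sum>j<i. l j * (c j * c j))"
    unfolding w_def by (rule N.eigensystem_span(2)[OF eL orthonormal l(2)])
  have op_ge: "t * ip \<nu> w w \<le> ip \<nu> (N.op w) w"
    unfolding ww opww sum_distrib_left using l(1) by (intro sum_mono mult_right_mono) auto
  have w_pos: "ip \<nu> w w > 0"
  proof -
    obtain j where "j < i" "c j \<noteq> 0" using c(1) by auto
    then show ?thesis unfolding ww by (intro sum_pos2[of _ j]) (auto simp: zero_less_mult_iff)
  qed
  have op_h: "ip \<nu> (N.op w) w = ip \<sigma> (op h) h"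
    unfolding h_def by (rule ip_op_weight[OF wL])
  \<comment> \<open>The weight may vanish on large sets, so non-degeneracy of \<open>h\<close> is
    read off from its form, which equals that of \<open>w\<close> and is positive.\<close>
  have "ip \<sigma> (op h) h > 0"
    using op_ge op_h w_pos t by (metis less_le_trans mult_pos_pos)
  then have "ip \<sigma> h h > 0"
    using ip_op_bound[OF hL] ip_nonneg[of \<sigma> h] by (cases "ip \<sigma> h h = 0") auto
  moreover have "1 / b\<^sup>2 * t * ip \<sigma> h h \<le> ip \<sigma> (op h) h"
  proof -
    have "1 / b\<^sup>2 * t * ip \<sigma> h h \<le> 1 / b\<^sup>2 * t * (b\<^sup>2 * ip \<nu> w w)"
      unfolding h_def using L2_weight(2)[OF wL] t by (intro mult_left_mono) auto
    also have "\<dots> = t * ip \<nu> w w" using b_pos by simp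
    finally show ?thesis using op_ge op_h by simp
  qed
  ultimately show "\<exists>h\<in>orth p gs. ip \<sigma> h h > 0 \<and> 1 / b\<^sup>2 * t * ip \<sigma> h h \<le> ip \<sigma> (op h) h"
    using orth by blast
qed

lemma continuous_rotate:
  fixes R :: "real^'n \<Rightarrow> real^'n" and g :: "real^'n \<Rightarrow> real"
  assumes "orthogonal_transformation R" "continuous_on (sphere 0 1) g"
  shows "continuous_on (sphere 0 1) (\<lambda>x. g (R x))"
proof (rule continuous_on_compose2[OF assms(2)])
  show "continuous_on (sphere 0 1) R"
    using orthogonal_transformation_linear[OF assms(1)]
    by (intro linear_continuous_on) (simp add: linear_conv_bounded_linear)
qed (auto simp: orthogonal_transformation_norm[OF assms(1)])

text \<open>Kernel and surface measure are both invariant under rotations, so the operator commutes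
  with them.\<close>

lemma op_rotate:
  assumes R: "orthogonal_transformation R" and w: "continuous_on (sphere 0 1) w" and x: "x \<in> sphere 0 1"
  shows "op (\<lambda>y. w (R y)) x = op w (R x)"
proof -
  have Rx: "R x \<in> sphere 0 1" using x orthogonal_transformation_norm[OF R] by simp
  have "continuous_on (sphere 0 1) (\<lambda>y. f (R x \<bullet> y) * w y)"
  proof (intro continuous_on_mult w continuous_on_compose2[OF f_cont])
    have "R x \<bullet> y \<in> {-1..1}" if "y \<in> sphere 0 1" for y
      using Cauchy_Schwarz_ineq2[of "R x" y] that Rx by (auto simp: abs_le_iff)
    then show "(\<lambda>y. R x \<bullet> y) ` sphere 0 1 \<subseteq> {-1..1}" by blast
  qed (intro continuous_intros)
  then have "(LINT y|\<sigma>. f (R x \<bullet> R y) * w (R y)) = (LINT y|\<sigma>. f (R x \<bullet> y) * w y)"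
    by (intro sphere_integral_rotate[OF R, of "\<lambda>y. f (R x \<bullet> y) * w y"] borel_measurable_continuous_on_restrict)
  moreover have "R x \<bullet> R y = x \<bullet> y" for y using R by (simp add: orthogonal_transformation_def)
  ultimately show ?thesis by (simp add: op_integral)
qed

text \<open>With \<open>w\<close> in the span of the given eigenfunctions and \<open>u = op w\<close>, every rotated copy of \<open>u\<close> that is
  orthogonal to the \<open>gs\<close> but has small Rayleigh quotient for \<open>\<nu>\<close> satisfies
  \<open>ip \<nu> u u \<le> t' * ip \<sigma> (op w) w\<close>, by Cauchy-Schwarz for the form of \<open>K\<close>. Summing over rotations whose
  images of the ball cover the sphere recovers \<open>ip \<sigma> u u\<close>, which is at least \<open>t * ip \<sigma> (op w) w\<close>.\<close>
lemma eigensystem_to_weight: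
  fixes \<R> :: "(real^'n \<Rightarrow> real^'n) set"
  assumes z: "c0 > 0" "\<And>x. x \<in> sphere 0 1 \<Longrightarrow> x \<in> ball z r \<Longrightarrow> c0 \<le> (\<rho> x)\<^sup>2"
    and \<R>: "finite \<R>" "\<R> \<noteq> {}" "\<And>R. R \<in> \<R> \<Longrightarrow> orthogonal_transformation R"
      "\<And>y. y \<in> sphere 0 1 \<Longrightarrow> \<exists>R\<in>\<R>. y \<in> ball (R z) r"
    and es: "eigensystem \<sigma> K (card \<R> * i) t fs" and t: "t > 0"
  shows "\<exists>gs. eigensystem \<nu> K i (c0 * t / (2 * real (card \<R>))) gs"
proof -
  define m where "m = card \<R>"
  have m: "m > 0" using \<R> by (simp add: m_def card_gt_0_iff)
  \<comment> \<open>The factor 2 turns the final chain of inequalities into a contradiction: it ends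
    in half of its starting value.\<close>
  define t' where "t' = c0 * t / (2 * real m)"
  have t': "t' > 0" using z t m by (simp add: t'_def)
  obtain e where e: "\<And>j. j < m * i \<Longrightarrow> continuous_on (space \<sigma>) (e j)" "eigensystem \<sigma> K (m * i) t e"
    "\<And>j. j < m * i \<Longrightarrow> \<exists>l\<ge>t. \<forall>x\<in>space \<sigma>. op (e j) x = l * e j x"
    by (rule eigensystem_continuous[OF es[folded m_def] t]) blast
  obtain l where l: "\<And>j. j < m * i \<Longrightarrow> l j \<ge> t" "\<And>j x. j < m * i \<Longrightarrow> x \<in> space \<sigma> \<Longrightarrow> op (e j) x = l j * e j x"
    using e(3) by metis
  have eC: "\<And>j. j < m * i \<Longrightarrow> continuous_on (sphere 0 1) (e j)" using e(1) by simp
  have eL: "\<And>j. j < m * i \<Longrightarrow> e j \<in> L2 \<sigma>"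
    and orthonormal: "\<And>j k. j < m * i \<Longrightarrow> k < m * i \<Longrightarrow> ip \<sigma> (e j) (e k) = (if j = k then 1 else 0)"
    using e(2) by (auto simp: eigensystem_def)
  have "\<exists>gs. eigensystem \<nu> K i t' gs"
  proof (rule N.eigensystem_minimax[OF t'])
    fix p gs assume p: "p < i" and gs: "eigensystem \<nu> K p t' gs"
    define v where "v R j x = l j * e j (R x)" for R :: "real^'n \<Rightarrow> real^'n" and j x
    have vL: "v R j \<in> L2 \<nu>" if "R \<in> \<R>" "j < m * i" for R j
      unfolding v_def using continuous_rotate[OF \<R>(3)[OF that(1)] eC[OF that(2)]]
      by (intro N.continuous_L2 continuous_on_mult continuous_on_const) simp
    \<comment> \<open>One condition for each rotation and each of the \<open>p\<close> functions,
      against \<open>m * i\<close> unknowns; this is where the index \<open>m * i\<close> comes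
      from.\<close>
    have card: "card (\<R> \<times> {..<p}) < card {..<m * i}"
      using p m by (simp add: card_cartesian_product m_def[symmetric])
    have fin: "finite (\<R> \<times> {..<p})" using \<R>(1) by simp
    obtain c where c: "\<exists>j\<in>{..<m * i}. c j \<noteq> 0"
      "\<forall>q\<in>\<R> \<times> {..<p}. (\<Sum>j<m * i. ip \<nu> (v (fst q) j) (gs (snd q)) * c j) = 0"
      using underdetermined_system[OF fin finite_lessThan card, of "\<lambda>q j. ip \<nu> (v (fst q) j) (gs (snd q))"]
      by auto
    define w where "w = (\<lambda>x. \<Sum>j<m * i. c j * e j x)"
    have wC: "continuous_on (sphere 0 1) w"
      unfolding w_def by (intro continuous_on_sum continuous_on_mult continuous_on_const eC) simp
    have wL: "w \<in> L2 \<sigma>" using wC by (intro continuous_L2) simp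
    define q where "q = ip \<sigma> (op w) w"
    have q: "q = (\<Sum>j<m * i. l j * (c j * c j))"
      unfolding q_def w_def by (rule eigensystem_span(2)[OF eL orthonormal l(2)])
    have opop: "ip \<sigma> (op w) (op w) = (\<Sum>j<m * i. l j * l j * (c j * c j))"
      unfolding w_def by (rule eigensystem_span(3)[OF eL orthonormal l(2)])
    have l0: "l j > 0" if "j < m * i" for j using l(1)[OF that] t by simp
    have q_pos: "q > 0"
    proof -
      obtain j where j: "j < m * i" "c j \<noteq> 0" using c(1) by auto
      show ?thesis unfolding q
      proof (rule sum_pos2[of _ j])
        show "0 < l j * (c j * c j)" using l0[OF j(1)] j(2) by (auto simp: zero_less_mult_iff)
        show "0 \<le> l k * (c k * c k)" if "k \<in> {..<m * i}" for k using l0[of k] that by simp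
      qed (use j in auto)
    qed
    have opop_ge: "t * q \<le> ip \<sigma> (op w) (op w)"
      unfolding q opop sum_distrib_left mult.assoc[of "l _" "l _"] using l(1) l0
      by (intro sum_mono mult_right_mono) (auto simp: less_imp_le)
    have uC: "continuous_on (sphere 0 1) (op w)" using op_continuous[OF wL] by simp
    \<comment> \<open>The image of \<open>w\<close> is rotated instead of \<open>w\<close> itself,
      so that \<open>ip \<nu> (u R) (u R)\<close> becomes a value of the bilinear form of
      \<open>op\<close>, between the rotated \<open>w\<close> and
      \<open>\<rho>\<^sup>2 * u R\<close>.\<close>
    define u where "u R x = op w (R x)" for R :: "real^'n \<Rightarrow> real^'n" and x
    have u_orth: "u R \<in> N.orth p gs" if R: "R \<in> \<R>" for R
    proof -
      have uL: "u R \<in> L2 \<nu>"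
        unfolding u_def using continuous_rotate[OF \<R>(3)[OF R] uC] by (intro N.continuous_L2) simp
      have u_sum: "u R x = (\<Sum>j<m * i. c j * v R j x)" if x: "x \<in> space \<nu>" for x
      proof -
        have "R x \<in> space \<sigma>" using x orthogonal_transformation_norm[OF \<R>(3)[OF R]] by simp
        then show ?thesis
          unfolding u_def w_def v_def using op_sum[of "R x" "{..<m * i}" e c] eL l(2) by simp
      qed
      have "ip \<nu> (u R) (gs s) = 0" if s: "s < p" for s
      proof -
        have "ip \<nu> (u R) (gs s) = ip \<nu> (\<lambda>x. \<Sum>j<m * i. c j * v R j x) (gs s)"
          by (rule ip_cong_space) (use u_sum in auto)
        also have "\<dots> = (\<Sum>j<m * i. c j * ip \<nu> (v R j) (gs s))"
          by (rule ip_sum) (use vL[OF R] N.eigensystemD(1)[OF gs s] in auto)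
        also have "\<dots> = 0" using c(2) R s by (force simp: mult.commute)
        finally show ?thesis .
      qed
      then show ?thesis using uL by (simp add: N.orth_def)
    qed
    have uL: "u R \<in> L2 \<nu>" if "R \<in> \<R>" for R
      using u_orth[OF that] by (simp add: N.orth_def)
    show "\<exists>h\<in>N.orth p gs. ip \<nu> h h > 0 \<and> t' * ip \<nu> h h \<le> ip \<nu> (N.op h) h"
    proof (rule ccontr)
      assume neg: "\<not> ?thesis"
      have small: "ip \<nu> (u R) (u R) \<le> t' * q" if R: "R \<in> \<R>" for R
      proof -
        note ortho = \<R>(3)[OF R]
        define a where "a = ip \<nu> (u R) (u R)"
        have a0: "a \<ge> 0" unfolding a_def by (rule ip_nonneg)
        have rayleigh: "ip \<nu> (N.op (u R)) (u R) \<le> t' * a"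
        proof (cases "a = 0")
          case True
          then show ?thesis using N.ip_op_bound[OF uL[OF R]] by (simp add: a_def)
        next
          case False
          then have "ip \<nu> (u R) (u R) > 0" using a0 by (simp add: a_def)
          then show ?thesis using neg u_orth[OF R] unfolding a_def by (meson less_imp_le not_le)
        qed
        let ?g = "\<lambda>x. (\<rho> x)\<^sup>2 * u R x"
        have gL: "?g \<in> L2 \<sigma>" by (rule L2_weight(1)[OF uL[OF R]])
        let ?w = "\<lambda>x. w (R x)"
        have wRL: "?w \<in> L2 \<sigma>" using continuous_rotate[OF ortho wC] by (intro continuous_L2) simp
        have opw: "op ?w x = u R x" if "x \<in> sphere 0 1" for x
          unfolding u_def by (rule op_rotate[OF ortho wC that])
        have "a = ip \<sigma> ?g (u R)"
          unfolding a_def by (rule ip_weight) (use L2_weight_measurable[OF uL[OF R]] in auto)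
        also have "\<dots> = ip \<sigma> (u R) ?g" by (rule ip_commute)
        also have "\<dots> = ip \<sigma> (op ?w) ?g"
          by (rule ip_cong_space) (use opw in auto)
        finally have a_eq: "a = ip \<sigma> (op ?w) ?g" .
        have "ip \<sigma> (op ?w) ?w = (LINT x|\<sigma>. op w (R x) * w (R x))"
          unfolding ip_def by (rule Bochner_Integration.integral_cong) (use opw in \<open>auto simp: u_def\<close>)
        also have "\<dots> = q"
          unfolding q_def ip_def
          by (rule sphere_integral_rotate[OF ortho])
            (intro borel_measurable_continuous_on_restrict continuous_on_mult uC wC)
        finally have qR: "ip \<sigma> (op ?w) ?w = q" .
        have "a\<^sup>2 \<le> q * ip \<sigma> (op ?g) ?g"
          using op_Cauchy_Schwarz[OF wRL gL] unfolding a_eq[symmetric] qR .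
        also have "\<dots> \<le> q * (t' * a)"
          using rayleigh q_pos unfolding ip_op_weight[OF uL[OF R]] by (intro mult_left_mono) auto
        finally have "a * a \<le> (t' * q) * a" by (simp add: power2_eq_square mult_ac)
        then show ?thesis
          using a0 t' q_pos unfolding a_def[symmetric] by (cases "a = 0") (auto simp: mult_le_cancel_right)
      qed
      let ?I = "\<lambda>R x. indicator (ball (R z) r) x :: real"
      have uu: "op w x * op w x \<ge> 0" for x by simp
      have intI: "integrable \<sigma> (\<lambda>x. ?I R x * (op w x * op w x))" for R
      proof (rule Bochner_Integration.integrable_bound)
        show "integrable \<sigma> (\<lambda>x. op w x * op w x)"
          by (intro L2_integrable_mult op_L2 wL)
        show "(\<lambda>x. ?I R x * (op w x * op w x)) \<in> borel_measurable \<sigma>"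
          by (rule borel_measurable_times[OF sphere_measurable_borel[OF indicator_ball_sphere_measurable]
              borel_measurable_times[OF L2_measurable[OF op_L2[OF wL]] L2_measurable[OF op_L2[OF wL]]]])
      qed (auto simp: indicator_def)
      \<comment> \<open>The rotation moves the mass of \<open>op w\<close> on the ball around
        \<open>R z\<close> to the ball around \<open>z\<close>, where
        \<open>\<rho>\<^sup>2 \<ge> c0\<close>.\<close>
      have large: "c0 * (LINT x|\<sigma>. ?I R x * (op w x * op w x)) \<le> ip \<nu> (u R) (u R)" if R: "R \<in> \<R>" for R
      proof -
        note ortho = \<R>(3)[OF R]
        have um: "u R \<in> borel_measurable \<sigma>" by (rule L2_weight_measurable[OF uL[OF R]])
        have "(LINT x|\<sigma>. ?I R x * (op w x * op w x)) = (LINT x|\<sigma>. ?I R (R x) * (op w (R x) * op w (R x)))"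
          by (rule sphere_integral_rotate[OF ortho, symmetric])
            (intro borel_measurable_times borel_measurable_continuous_on_restrict uC indicator_ball_sphere_measurable)
        also have "\<dots> = (LINT x|\<sigma>. indicator (ball z r) x * (u R x * u R x))"
          using orthogonal_transformation_ball[OF ortho] by (simp add: indicator_def u_def del: mem_ball)
        finally have "c0 * (LINT x|\<sigma>. ?I R x * (op w x * op w x))
            = (LINT x|\<sigma>. c0 * (indicator (ball z r) x * (u R x * u R x)))"
          by simp
        also have "\<dots> \<le> (LINT x|\<sigma>. (\<rho> x)\<^sup>2 * u R x * u R x)"
        proof (rule integral_mono')
          show "integrable \<sigma> (\<lambda>x. (\<rho> x)\<^sup>2 * u R x * u R x)"
          proof -
            have "u R \<in> L2 \<sigma>"
              unfolding u_def using continuous_rotate[OF ortho uC] by (intro continuous_L2) simp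
            then show ?thesis by (rule L2_integrable_mult[OF L2_weight(1)[OF uL[OF R]]])
          qed
          show "c0 * (indicator (ball z r) x * (u R x * u R x)) \<le> (\<rho> x)\<^sup>2 * u R x * u R x"
            if "x \<in> space \<sigma>" for x
            using mult_right_mono[OF z(2)[of x], of "u R x * u R x"] that
            by (cases "x \<in> ball z r") (auto simp: mult.assoc)
        qed (simp add: mult.assoc)
        also have "\<dots> = ip \<nu> (u R) (u R)"
          unfolding ip_weight[OF um um] by (simp add: ip_def)
        finally show ?thesis .
      qed
      have "c0 * (t * q) \<le> c0 * ip \<sigma> (op w) (op w)"
        using opop_ge z(1) by simp
      also have "ip \<sigma> (op w) (op w) \<le> (LINT x|\<sigma>. (\<Sum>R\<in>\<R>. ?I R x * (op w x * op w x)))"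
        unfolding ip_def
      proof (rule integral_mono)
        show "integrable \<sigma> (\<lambda>x. op w x * op w x)" by (intro L2_integrable_mult op_L2 wL)
        show "integrable \<sigma> (\<lambda>x. \<Sum>R\<in>\<R>. ?I R x * (op w x * op w x))"
          by (intro Bochner_Integration.integrable_sum intI)
        fix x assume x: "x \<in> space \<sigma>"
        obtain R where R: "R \<in> \<R>" "x \<in> ball (R z) r" using \<R>(4)[of x] x by auto
        have "op w x * op w x = ?I R x * (op w x * op w x)" using R(2) by (simp add: indicator_def)
        also have "\<dots> \<le> (\<Sum>R\<in>\<R>. ?I R x * (op w x * op w x))"
          by (rule member_le_sum[OF R(1) _ \<R>(1)]) simp
        finally show "op w x * op w x \<le> (\<Sum>R\<in>\<R>. ?I R x * (op w x * op w x))" .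
      qed
      also have "\<dots> = (\<Sum>R\<in>\<R>. (LINT x|\<sigma>. ?I R x * (op w x * op w x)))"
        by (intro Bochner_Integration.integral_sum intI)
      finally have "c0 * (t * q) \<le> (\<Sum>R\<in>\<R>. c0 * (LINT x|\<sigma>. ?I R x * (op w x * op w x)))"
        using z(1) by (simp add: sum_distrib_left)
      also have "\<dots> \<le> (\<Sum>R\<in>\<R>. t' * q)"
        by (rule sum_mono) (use large small in \<open>blast intro: order_trans\<close>)
      also have "\<dots> = c0 * t * q / 2"
        using m by (simp add: t'_def m_def[symmetric])
      finally show False using z(1) t q_pos by (simp add: mult.assoc[symmetric])
    qed
  qed
  then show ?thesis by (simp add: t'_def m_def)
qed

end

theorem theorem8:
  fixes f :: "real \<Rightarrow> real" and \<mu> \<mu>' :: "nat \<Rightarrow> real" and \<rho> :: "real^'n \<Rightarrow> real" and d :: nat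
  assumes dim: "CARD('n) = d + 1" and d1: "d \<ge> 1"
    and cont: "continuous_on {-1..1} f"
    and pd: "\<forall>(xs :: (real^'n) list) (cs :: real list). set xs \<subseteq> sphere 0 1 \<longrightarrow> length cs = length xs \<longrightarrow>
               (\<Sum>i<length xs. \<Sum>j<length xs. cs ! i * cs ! j * f (xs ! i \<bullet> xs ! j)) \<ge> 0"
    and eig: "\<forall>n (Y :: real^'n \<Rightarrow> real) x. spherical_harmonic n Y \<longrightarrow> x \<in> sphere 0 1 \<longrightarrow>
               (LINT y|sphere_measure. f (x \<bullet> y) * Y y) / measure sphere_measure (sphere 0 1) = \<mu> n * Y x"
    and edr: "EDR d \<mu>'"
    and equiv: "\<exists>c C. c > 0 \<and> C > 0 \<and> (\<forall>n. c * \<mu>' n \<le> \<mu> n \<and> \<mu> n \<le> C * \<mu>' n)"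
    and riem: "riemann_integrable_sphere \<rho>"
    and nonzero: "\<not> (AE x in sphere_measure. \<rho> x = 0)"
  shows "\<exists>c C. c > 0 \<and> C > 0 \<and> (\<forall>i\<ge>1.
           c * kernel_eigenvalue (\<lambda>x y. f (x \<bullet> y)) (sphere_measure :: (real^'n) measure) i
             \<le> kernel_eigenvalue (\<lambda>x y. f (x \<bullet> y)) (density sphere_measure (\<lambda>x. ennreal ((\<rho> x)\<^sup>2))) i \<and>
           kernel_eigenvalue (\<lambda>x y. f (x \<bullet> y)) (density sphere_measure (\<lambda>x. ennreal ((\<rho> x)\<^sup>2))) i
             \<le> C * kernel_eigenvalue (\<lambda>x y. f (x \<bullet> y)) (sphere_measure :: (real^'n) measure) i)"
proof -
  let ?\<sigma> = "sphere_measure :: (real^'n) measure"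
  let ?\<nu> = "density ?\<sigma> (\<lambda>x. ennreal ((\<rho> x)\<^sup>2))"
  let ?K = "\<lambda>x y :: real^'n. f (x \<bullet> y)"
  obtain c1 c2 where c12: "c1 > 0" "c2 > 0" "\<And>n. c1 * \<mu>' n \<le> \<mu> n" "\<And>n. \<mu> n \<le> c2 * \<mu>' n"
    using equiv by blast
  have "\<mu>' n > 0" for n using edr by (simp add: EDR_def)
  then have \<mu>_pos: "\<mu> n > 0" for n using c12(1,3) by (meson less_le_trans mult_pos_pos)
  have "bounded (f ` {-1..1})"
    using cont by (intro compact_imp_bounded compact_continuous_image) auto
  then obtain B where B: "\<forall>s\<in>{-1..1}. \<bar>f s\<bar> \<le> B"
    unfolding bounded_iff by auto
  have "bounded (\<rho> ` sphere 0 1)" using riem by (simp add: riemann_integrable_sphere_def)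
  then obtain b where b: "b > 0" "\<forall>x\<in>sphere 0 1. \<bar>\<rho> x\<bar> \<le> b"
    unfolding bounded_pos by auto
  have card: "CARD('n) \<ge> 2" using dim d1 by simp
  have "\<exists>area>0. \<forall>n (Y :: real^'n \<Rightarrow> real) x. spherical_harmonic n Y \<longrightarrow> x \<in> sphere 0 1 \<longrightarrow>
      (LINT y|sphere_measure. f (x \<bullet> y) * Y y) / area = \<mu> n * Y x"
    using eig measure_sphere_pos by blast
  then obtain area where area: "area > 0" "\<forall>n (Y :: real^'n \<Rightarrow> real) x. spherical_harmonic n Y \<longrightarrow>
      x \<in> sphere 0 1 \<longrightarrow> (LINT y|sphere_measure. f (x \<bullet> y) * Y y) / area = \<mu> n * Y x"
    by blast
  interpret weighted_dot_kernel f B area \<mu> ?K \<rho> b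
  proof unfold_locales
    show "\<forall>n (Y :: real^'n \<Rightarrow> real) x. spherical_harmonic n Y \<longrightarrow> x \<in> sphere 0 1 \<longrightarrow>
      (LINT y|sphere_measure. f (x \<bullet> y) * Y y) / area = \<mu> n * Y x"
      by (rule area(2))
    show "\<rho> \<in> borel_measurable sphere_measure"
      by (rule riemann_integrable_sphere_measurable[OF riem])
  qed (use card cont B area(1) \<mu>_pos b in auto)
  obtain z r c0 where z: "z \<in> sphere 0 1" "r > 0" "c0 > 0"
    "\<And>x. x \<in> sphere 0 1 \<Longrightarrow> x \<in> ball z r \<Longrightarrow> c0 \<le> (\<rho> x)\<^sup>2"
    by (rule riemann_integrable_sphere_lower_bound[OF riem nonzero]) blast
  obtain \<R> :: "(real^'n \<Rightarrow> real^'n) set" where \<R>: "finite \<R>" "\<R> \<noteq> {}"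
    "\<And>R. R \<in> \<R> \<Longrightarrow> orthogonal_transformation R"
    "\<And>y. y \<in> sphere 0 1 \<Longrightarrow> \<exists>R\<in>\<R>. y \<in> ball (R z) r"
    by (rule sphere_cover[OF card z(1,2)]) blast
  have m: "card \<R> > 0" using \<R> by (simp add: card_gt_0_iff)
  obtain c where c: "c > 0" "\<And>i t fs. i > 0 \<Longrightarrow> t > 0 \<Longrightarrow> eigensystem ?\<sigma> ?K i t fs \<Longrightarrow>
      \<exists>gs. eigensystem ?\<sigma> ?K (card \<R> * i) (c * t) gs"
    using eigensystem_multiply[OF edr c12 m] by blast
  \<comment> \<open>The constant \<open>c\<close> is the cost of raising the index from
    \<open>i\<close> to \<open>card \<R> * i\<close>, the factor \<open>c0 / (2 * card \<R>)\<close>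
    that of passing to the weighted measure.\<close>
  define a where "a = c0 * c / (2 * real (card \<R>))"
  have a: "a > 0" using z(3) c(1) m by (simp add: a_def)
  have lower: "a * kernel_eigenvalue ?K ?\<sigma> i \<le> kernel_eigenvalue ?K ?\<nu> i" if i: "i \<ge> 1" for i
  proof (rule kernel_eigenvalue_le[OF N.kernel_operator_axioms _ a])
    fix t fs assume t: "(0::real) < t" and fs: "eigensystem ?\<sigma> ?K i t fs"
    obtain gs where "eigensystem ?\<sigma> ?K (card \<R> * i) (c * t) gs"
      using c(2)[OF _ t fs] i by auto
    from eigensystem_to_weight[OF z(3,4) \<R> this]
    show "\<exists>gs. eigensystem ?\<nu> ?K i (a * t) gs"
      using c(1) t by (simp add: a_def mult_ac)
  qed (use i in simp)
  have upper: "1 / b\<^sup>2 * kernel_eigenvalue ?K ?\<nu> i \<le> kernel_eigenvalue ?K ?\<sigma> i" if i: "i \<ge> 1" for i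
    by (rule kernel_eigenvalue_le[OF kernel_operator_axioms])
      (use i b(1) eigensystem_from_weight in auto)
  show ?thesis
  proof (rule exI[of _ a], rule exI[of _ "b\<^sup>2"], intro conjI allI impI)
    show "kernel_eigenvalue ?K ?\<nu> i \<le> b\<^sup>2 * kernel_eigenvalue ?K ?\<sigma> i" if "1 \<le> i" for i
      using upper[OF that] b(1) by (simp add: field_simps)
  qed (use a b(1) lower in auto)
qed

end
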